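(* There exist constants $\lambda_0<1$, $\epsilon>0$, $c>0$ and $n_0$ such that for every $n\ge n_0$ with $n\equiv 0\pmod 3$ there is a $6$-regular graph $G=(V,E)$ on $n$ vertices with $\lambda(G)\le\lambda_0$, in which every vertex is contained in an induced cycle of length at least $\epsilon\log n$, together with a starting vertex $v_0$ and a rule $\mathcal{R}$, such that the greedy random walk on $G$ with rule $\mathcal{R}$ started at $v_0$ satisfies $\mathbb{E}[C_E(G)]\ge c\,n\log n$.
   Context: A greedy random walk (GRW) on a connected locally finite graph $G=(V,E)$ with rule $\mathcal{R}$ started at $v_0$: $X_0=v_0$; with $H_t=\{\{X_{s-1},X_s\}:0<s\le t\}$ and $J_t(v)=\{e\in E: v\in e, e\notin H_t\}$, if $J_t(X_t)\ne\emptyset$ then $X_{t+1}=w$ for some $w$ with $\{X_t,w\}\in J_t(X_t)$, chosen according to an arbitrary (possibly randomized, history-dependent) rule $\mathcal{R}$; if $J_t(X_t)=\emptyset$ then $X_{t+1}$ is a uniformly random neighbor of $X_t$. $C_E(G)=\min\{t:H_t=E\}$ is the edge cover time. For a $d$-regular graph with normalized adjacency matrix $A$ ($A(u,v)=1/d$ for edges, $0$ otherwise) with eigenvalues $1=\lambda_1\ge\dots\ge\lambda_n\ge-1$, $\lambda(G)=\max_{2\le i\le n}|\lambda_i|$. *)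

theory Defs
  imports "HOL-Probability.Probability" "Jordan_Normal_Form.Char_Poly"
    "HOL-Computational_Algebra.Polynomial"
begin

definition simple_graph :: "nat \<Rightarrow> (nat \<Rightarrow> nat \<Rightarrow> bool) \<Rightarrow> bool" where
  "simple_graph n G \<longleftrightarrow>
     (\<forall>u v. G u v \<longrightarrow> u < n \<and> v < n) \<and>
     (\<forall>u v. G u v \<longrightarrow> G v u) \<and>
     (\<forall>u. \<not> G u u)"

definition neighbours :: "(nat \<Rightarrow> nat \<Rightarrow> bool) \<Rightarrow> nat \<Rightarrow> nat set" where
  "neighbours G v = {w. G v w}"

definition regular_graph :: "nat \<Rightarrow> nat \<Rightarrow> (nat \<Rightarrow> nat \<Rightarrow> bool) \<Rightarrow> bool" where
  "regular_graph n d G \<longleftrightarrow> simple_graph n G \<and> (\<forall>v<n. card (neighbours G v) = d)"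

definition edge_set :: "(nat \<Rightarrow> nat \<Rightarrow> bool) \<Rightarrow> nat set set" where
  "edge_set G = {{u, v} | u v. G u v}"

definition norm_adj :: "nat \<Rightarrow> nat \<Rightarrow> (nat \<Rightarrow> nat \<Rightarrow> bool) \<Rightarrow> real mat" where
  "norm_adj n d G = mat n n (\<lambda>(i, j). if G i j then 1 / real d else 0)"

text \<open>Eigenvalues (with multiplicity) listed in non-increasing order
  lambda_1 \<ge> ... \<ge> lambda_n: the real roots of the characteristic polynomial
  (the matrix is real symmetric, so all n eigenvalues are real).\<close>
definition eigenvalues_desc :: "real mat \<Rightarrow> real list" where
  "eigenvalues_desc A = rev (sorted_list_of_multiset (proots (char_poly A)))"

definition spectral_lambda :: "nat \<Rightarrow> nat \<Rightarrow> (nat \<Rightarrow> nat \<Rightarrow> bool) \<Rightarrow> real" where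
  "spectral_lambda n d G = Max (abs ` set (tl (eigenvalues_desc (norm_adj n d G))))"

definition induced_cycle :: "nat \<Rightarrow> (nat \<Rightarrow> nat \<Rightarrow> bool) \<Rightarrow> nat list \<Rightarrow> bool" where
  "induced_cycle n G cyc \<longleftrightarrow>
     (let k = length cyc in
       k \<ge> 3 \<and> distinct cyc \<and> set cyc \<subseteq> {0..<n} \<and>
       (\<forall>i<k. G (cyc ! i) (cyc ! ((i + 1) mod k))) \<and>
       (\<forall>i<k. \<forall>j<k. G (cyc ! i) (cyc ! j) \<longrightarrow> j = (i + 1) mod k \<or> i = (j + 1) mod k))"

definition hist_edges :: "nat list \<Rightarrow> nat set set" where
  "hist_edges h = {{h ! (s - 1), h ! s} | s. 0 < s \<and> s < length h}"

definition unused_edges :: "(nat \<Rightarrow> nat \<Rightarrow> bool) \<Rightarrow> nat list \<Rightarrow> nat set set" where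
  "unused_edges G h = {e \<in> edge_set G. last h \<in> e \<and> e \<notin> hist_edges h}"

definition valid_rule :: "(nat \<Rightarrow> nat \<Rightarrow> bool) \<Rightarrow> (nat list \<Rightarrow> nat pmf) \<Rightarrow> bool" where
  "valid_rule G R \<longleftrightarrow>
     (\<forall>h. h \<noteq> [] \<longrightarrow> unused_edges G h \<noteq> {} \<longrightarrow>
        set_pmf (R h) \<subseteq> {w. {last h, w} \<in> unused_edges G h})"

definition grw_step :: "(nat \<Rightarrow> nat \<Rightarrow> bool) \<Rightarrow> (nat list \<Rightarrow> nat pmf) \<Rightarrow> nat list \<Rightarrow> nat pmf" where
  "grw_step G R h =
     (if unused_edges G h \<noteq> {} then R h else pmf_of_set (neighbours G (last h)))"

fun grw_hist :: "(nat \<Rightarrow> nat \<Rightarrow> bool) \<Rightarrow> (nat list \<Rightarrow> nat pmf) \<Rightarrow> nat \<Rightarrow> nat \<Rightarrow> nat list pmf" where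
  "grw_hist G R v0 0 = return_pmf [v0]"
| "grw_hist G R v0 (Suc t) =
     bind_pmf (grw_hist G R v0 t) (\<lambda>h. map_pmf (\<lambda>w. h @ [w]) (grw_step G R h))"

text \<open>Expected edge cover time E[C_E(G)] where C_E = min{t. H_t = E}, computed as
  the tail sum  E[C_E] = sum_{t \<ge> 0} P(C_E > t) = sum_{t \<ge> 0} P(H_t \<noteq> E)
  (valued in ennreal; equals \<infinity> if the walk fails to cover with positive probability).\<close>
definition expected_edge_cover_time ::
  "(nat \<Rightarrow> nat \<Rightarrow> bool) \<Rightarrow> (nat list \<Rightarrow> nat pmf) \<Rightarrow> nat \<Rightarrow> ennreal" where
  "expected_edge_cover_time G R v0 =
     (\<Sum>t. ennreal (measure_pmf.prob (grw_hist G R v0 t) {h. hist_edges h \<noteq> edge_set G}))"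

end

theory Submission
  imports Defs
begin

text \<open>
  The vertices \<open>3 j + c\<close> with \<open>j < N = n / 3\<close> and \<open>c < 3\<close> form the prism over the cycle of length \<open>N\<close>
  with triangles \<open>{3 j, 3 j + 1, 3 j + 2}\<close>; a fixed-point-free permutation \<open>\<rho> c\<close> of the \<open>j\<close>'s adds the edges
  from \<open>3 j + c\<close> to the next class modulo 3. Since no edge but those of its cycle stays inside a class, every class is an
  induced cycle of length \<open>N\<close>. The permutations simulate shifts and shears of the torus
  \<open>\<int>\<^sub>k \<times> \<int>\<^sub>k\<close> on pairs of consecutive \<open>j\<close>'s, and the \<open>r\<close> left-over \<open>j\<close>'s are attached
  by a rotation. On the torus, translations force the Fourier mass of a function of small energy to sit at low frequencies, where
  the shears act as on \<open>\<int>\<^sup>2\<close> and play ping-pong, so no mass is left. This bounds the eigenvalues from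
  above; the triangles bound them away from \<open>- 1\<close>.

  The rule uses triangle edges only when no other edge is available. By parity every greedy phase returns to
  the vertex where it started and can only use up the triangle of that vertex. Covering the edges therefore
  requires a simple random walk, slowed down by greedy phases, to visit all triangles. Pairwise distant triangles have
  mutual hitting times of order \<open>n\<close>, so Matthews' argument yields the factor \<open>ln n\<close>.
\<close>

section \<open>A spectral gap on the torus\<close>

text \<open>The shifts and shears form a Margulis-type expander, explicit for every torus size.
  Besides its ring and triangle edges, a vertex of the prism has just one outgoing and one incoming
  edge. Four torus moves must therefore fit into two permutations: doubling the points lets one
  permutation carry two moves, told apart by the parity of \<open>j\<close>. The third permutation
  absorbs the sizes that are not twice a square. Degree 6 gives every vertex an even degree both in
  its triangle and outside it, which starts the parity argument. \<open>spectral_lambda\<close> is a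
  maximum over the tail of a list of real roots. So exactly one root 1 has to be split off and a
  further real root has to exist; dividing out the constant vectors serves both purposes without a
  diagonalization. Hitting times are never defined. Their lower bounds are carried by functions that
  drop by at most 1 on average in a random step. The separation \<open>L\<close> of the targets
  depends only on the gap, so linearly many targets remain, and their number produces the
  logarithm.\<close>

definition root_char :: "nat \<Rightarrow> int \<Rightarrow> complex" where
  "root_char k t = cis (2 * pi * real_of_int t / real k)"

lemma root_char_add: "root_char k (s + t) = root_char k s * root_char k t"
  unfolding root_char_def by (simp add: cis_mult ring_distribs add_divide_distrib)

lemma cmod_root_char [simp]: "cmod (root_char k t) = 1"
  unfolding root_char_def by simp

lemma root_char_0 [simp]: "root_char k 0 = 1"
  unfolding root_char_def by simp

lemma root_char_minus: "root_char k (- t) = cnj (root_char k t)"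
  unfolding root_char_def by (simp add: cis_cnj)

lemma root_char_eq_1_iff:
  assumes "k > 0" shows "root_char k t = 1 \<longleftrightarrow> int k dvd t"
proof
  assume "root_char k t = 1"
  then have "cos (2 * pi * real_of_int t / real k) = 1"
    unfolding root_char_def by (simp add: complex_eq_iff)
  then obtain m :: int where "2 * pi * real_of_int t / real k = of_int m * 2 * pi"
    using cos_one_2pi_int by auto
  then have "real_of_int t = of_int m * real k"
    using assms by (simp add: field_simps)
  then have "t = m * int k" by (metis of_int_eq_iff of_int_mult of_int_of_nat_eq)
  then show "int k dvd t" by simp
next
  assume "int k dvd t"
  then obtain m where "t = int k * m" ..
  then have "2 * pi * real_of_int t / real k = 2 * pi * of_int m"
    using assms by (simp add: field_simps)
  then show "root_char k t = 1"
    unfolding root_char_def by (simp add: complex_eq_iff)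
qed

lemma root_char_periodic:
  assumes "k > 0" "int k dvd s - t" shows "root_char k s = root_char k t"
proof -
  have "root_char k s = root_char k (s - t) * root_char k t"
    by (simp flip: root_char_add)
  then show ?thesis using assms by (simp add: root_char_eq_1_iff)
qed

lemma nat_mod_add_cancel:
  fixes c y y' k :: nat
  assumes "(c + y) mod k = (c + y') mod k" "y < k" "y' < k"
  shows "y = y'"
proof -
  have "int k dvd int y - int y'"
    using assms(1) by (metis add_diff_cancel_left mod_eq_dvd_iff of_nat_add of_nat_mod)
  then show ?thesis using assms by (auto simp: mod_eq_dvd_iff[symmetric])
qed

lemma sum_shift_mod:
  fixes f :: "nat \<Rightarrow> 'a::comm_monoid_add"
  assumes "k > 0"
  shows "(\<Sum>x<k. f ((c + x) mod k)) = (\<Sum>x<k. f x)"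
proof -
  have inj: "inj_on (\<lambda>x. (c + x) mod k) {..<k}"
    by (auto intro!: inj_onI dest: nat_mod_add_cancel)
  have "(\<lambda>x. (c + x) mod k) ` {..<k} = {..<k}"
    by (rule endo_inj_surj) (use inj assms in auto)
  then have "bij_betw (\<lambda>x. (c + x) mod k) {..<k} {..<k}" using inj by (simp add: bij_betw_def)
  then show ?thesis by (rule sum.reindex_bij_betw)
qed

text \<open>Multiplying the sum by \<open>root_char k d\<close> only permutes its terms, so it
  vanishes unless this factor is 1.\<close>

lemma sum_root_char:
  assumes k: "k > 0"
  shows "(\<Sum>a<k. root_char k (int a * d)) = (if int k dvd d then of_nat k else 0)"
proof (cases "int k dvd d")
  case True
  then have "root_char k (int a * d) = 1" for a using k by (simp add: root_char_eq_1_iff)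
  then show ?thesis using True by simp
next
  case False
  let ?S = "\<Sum>a<k. root_char k (int a * d)"
  have "?S = (\<Sum>a<k. root_char k (int ((1 + a) mod k) * d))"
    by (rule sum_shift_mod[OF k, symmetric])
  also have "\<dots> = (\<Sum>a<k. root_char k d * root_char k (int a * d))"
  proof (rule sum.cong[OF refl])
    fix a
    have "int k dvd int ((1 + a) mod k) - int (1 + a)"
      by (simp add: zmod_int mod_eq_dvd_iff[symmetric] del: of_nat_add)
    then have "int k dvd (int ((1 + a) mod k) - int (1 + a)) * d" by simp
    then have "int k dvd int ((1 + a) mod k) * d - (d + int a * d)" by (simp add: algebra_simps)
    then show "root_char k (int ((1 + a) mod k) * d) = root_char k d * root_char k (int a * d)"
      by (simp add: root_char_periodic[OF k] flip: root_char_add)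
  qed
  also have "\<dots> = root_char k d * ?S" by (simp add: sum_distrib_left)
  finally have "(1 - root_char k d) * ?S = 0" by (simp add: algebra_simps)
  then show ?thesis using False k by (auto simp: root_char_eq_1_iff)
qed

section \<open>Plancherel's identity on the torus\<close>

lemma plancherel_1:
  fixes h :: "nat \<Rightarrow> complex"
  assumes k: "k > 0"
  shows "(\<Sum>a<k. (cmod (\<Sum>x<k. h x * root_char k (int a * int x)))\<^sup>2) = k * (\<Sum>x<k. (cmod (h x))\<^sup>2)"
proof -
  have "complex_of_real (\<Sum>a<k. (cmod (\<Sum>x<k. h x * root_char k (int a * int x)))\<^sup>2) =
    (\<Sum>a<k. \<Sum>x<k. \<Sum>y<k. h x * cnj (h y) * root_char k (int a * (int x - int y)))"
    unfolding of_real_sum complex_norm_square cnj_sum sum_product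
    by (intro sum.cong refl)
      (simp add: right_diff_distrib root_char_add[of k "_ * _" "- _", simplified] root_char_minus)
  also have "\<dots> = (\<Sum>x<k. \<Sum>y<k. \<Sum>a<k. h x * cnj (h y) * root_char k (int a * (int x - int y)))"
    by (subst sum.swap, rule sum.cong[OF refl], rule sum.swap)
  also have "\<dots> = (\<Sum>x<k. \<Sum>y<k. if x = y then h x * cnj (h y) * of_nat k else 0)"
  proof (intro sum.cong refl)
    fix x y assume "x \<in> {..<k}" "y \<in> {..<k}"
    then have "int k dvd int x - int y \<longleftrightarrow> x = y"
      by (auto simp: mod_eq_dvd_iff[symmetric])
    then show "(\<Sum>a<k. h x * cnj (h y) * root_char k (int a * (int x - int y))) =
        (if x = y then h x * cnj (h y) * of_nat k else 0)"
      by (simp add: sum_root_char[OF k] flip: sum_distrib_left)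
  qed
  also have "\<dots> = complex_of_real (k * (\<Sum>x<k. (cmod (h x))\<^sup>2))"
    by (simp add: of_real_sum complex_norm_square sum_distrib_left mult_ac del: of_real_power)
  finally show ?thesis using of_real_eq_iff by blast
qed

definition dft :: "nat \<Rightarrow> (nat \<Rightarrow> nat \<Rightarrow> real) \<Rightarrow> int \<Rightarrow> int \<Rightarrow> complex" where
  "dft k g a b = (\<Sum>x<k. \<Sum>y<k. of_real (g x y) * root_char k (a * int x + b * int y))"

lemma dft_periodic:
  assumes "k > 0" "int k dvd a - a'" "int k dvd b - b'"
  shows "dft k g a b = dft k g a' b'"
proof -
  have "root_char k (a * int x + b * int y) = root_char k (a' * int x + b' * int y)" for x y
  proof (rule root_char_periodic[OF assms(1)])
    have "int k dvd (a - a') * int x + (b - b') * int y" using assms by simp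
    then show "int k dvd a * int x + b * int y - (a' * int x + b' * int y)"
      by (simp add: algebra_simps)
  qed
  then show ?thesis unfolding dft_def by simp
qed

lemma dft_diff: "dft k (\<lambda>x y. g x y - h x y) a b = dft k g a b - dft k h a b"
  unfolding dft_def by (simp add: left_diff_distrib sum_subtractf)

lemma plancherel_2:
  assumes k: "k > 0"
  shows "(\<Sum>a<k. \<Sum>b<k. (cmod (dft k g (int a) (int b)))\<^sup>2) = (real k)\<^sup>2 * (\<Sum>x<k. \<Sum>y<k. (g x y)\<^sup>2)"
proof -
  have "(\<Sum>a<k. \<Sum>b<k. (cmod (dft k g (int a) (int b)))\<^sup>2) =
    (\<Sum>b<k. \<Sum>a<k. (cmod (\<Sum>x<k. (\<Sum>y<k. of_real (g x y) * root_char k (int b * int y)) * root_char k (int a * int x)))\<^sup>2)"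
    unfolding dft_def by (subst sum.swap) (simp add: root_char_add sum_distrib_left sum_distrib_right mult_ac)
  also have "\<dots> = (\<Sum>b<k. k * (\<Sum>x<k. (cmod (\<Sum>y<k. of_real (g x y) * root_char k (int b * int y)))\<^sup>2))"
    by (simp add: plancherel_1[OF k])
  also have "\<dots> = k * (\<Sum>x<k. \<Sum>b<k. (cmod (\<Sum>y<k. of_real (g x y) * root_char k (int b * int y)))\<^sup>2)"
    by (subst sum.swap) (simp add: sum_distrib_left)
  also have "\<dots> = k * (\<Sum>x<k. k * (\<Sum>y<k. (g x y)\<^sup>2))"
    by (simp add: plancherel_1[OF k])
  finally show ?thesis by (simp add: sum_distrib_left power2_eq_square mult_ac)
qed

lemma sum_periodic_window:
  fixes p :: "int \<Rightarrow> real"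
  assumes per: "\<And>a b. int k dvd a - b \<Longrightarrow> p a = p b" and k: "k > 0"
  shows "(\<Sum>a\<in>{s..<s + int k}. p a) = (\<Sum>a<k. p (int a))"
proof (rule sum.reindex_bij_witness[where i = "\<lambda>a. s + (int a - s) mod int k" and j = "\<lambda>a. nat (a mod int k)"])
  fix a assume a: "a \<in> {s..<s + int k}"
  have "(int (nat (a mod int k)) - s) mod int k = (a - s) mod int k" using k by (simp add: mod_diff_left_eq)
  also have "\<dots> = a - s" using a by simp
  finally show "s + (int (nat (a mod int k)) - s) mod int k = a" by simp
  show "nat (a mod int k) \<in> {..<k}" using k by (simp add: nat_less_iff)
  show "p (int (nat (a mod int k))) = p a"
    by (rule per) (use k in \<open>simp add: mod_eq_dvd_iff[symmetric]\<close>)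
next
  fix a assume a: "a \<in> {..<k}"
  have "(s + (int a - s) mod int k) mod int k = int a" using a by (simp add: mod_add_right_eq)
  then show "nat ((s + (int a - s) mod int k) mod int k) = a" by simp
  show "s + (int a - s) mod int k \<in> {s..<s + int k}" using k by simp
qed

text \<open>If \<open>\<phi>\<close> is nearly invariant under \<open>T\<close>, then the part \<open>P\<close> of \<open>S\<close> that the image of \<open>S\<close> misses
  carries little mass.\<close>

lemma ping_pong_mass:
  fixes \<phi> :: "'a \<Rightarrow> complex"
  assumes fin: "finite V" and sub: "B \<subseteq> V" "S \<subseteq> B" "P \<subseteq> S" and inj: "inj_on T S"
    and TS: "T ` S \<subseteq> V - P" "T ` S \<inter> B \<subseteq> S"
  shows "(\<Sum>x\<in>P. (cmod (\<phi> x))\<^sup>2) \<le> (\<Sum>x\<in>V. (cmod (\<phi> x))\<^sup>2) / 8 + (\<Sum>x\<in>V - B. (cmod (\<phi> x))\<^sup>2)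
           + 9 * (\<Sum>x\<in>V. (cmod (\<phi> (T x) - \<phi> x))\<^sup>2)"
proof -
  let ?q = "\<lambda>x. (cmod (\<phi> x))\<^sup>2"
  let ?d = "\<lambda>x. (cmod (\<phi> (T x) - \<phi> x))\<^sup>2"
  \<comment> \<open>The slack is (p - 8 r)^2 / 8. The weight is tuned to four applications, which
    together lose half of the total mass.\<close>
  have pointwise: "?q x \<le> 9/8 * ?q (T x) + 9 * ?d x" for x
  proof -
    let ?p = "cmod (\<phi> (T x))" and ?r = "cmod (\<phi> (T x) - \<phi> x)"
    have "cmod (\<phi> x) \<le> ?p + ?r"
      by (metis norm_triangle_sub norm_minus_commute)
    then have "?q x \<le> (?p + ?r)\<^sup>2" by (intro power_mono) auto
    also have "\<dots> \<le> 9/8 * ?p\<^sup>2 + 9 * ?r\<^sup>2"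
      using zero_le_power2[of "?p - 8 * ?r"] by (simp add: power2_eq_square algebra_simps)
    finally show ?thesis .
  qed
  have finS: "finite S" "finite B" "finite P" using fin sub finite_subset by (meson subset_trans)+
  have "(\<Sum>x\<in>S. ?q x) \<le> 9/8 * (\<Sum>x\<in>S. ?q (T x)) + 9 * (\<Sum>x\<in>S. ?d x)"
    unfolding sum_distrib_left sum.distrib[symmetric] by (rule sum_mono) (rule pointwise)
  moreover have "(\<Sum>x\<in>S. ?q (T x)) = (\<Sum>x\<in>T ` S. ?q x)"
    by (simp add: sum.reindex[OF inj])
  moreover have "(\<Sum>x\<in>T ` S. ?q x) \<le> (\<Sum>x\<in>V. ?q x)"
    by (rule sum_mono2) (use fin TS in auto)
  moreover have "(\<Sum>x\<in>T ` S. ?q x) \<le> (\<Sum>x\<in>(S - P) \<union> (V - B). ?q x)"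
    by (rule sum_mono2) (use fin finS TS in auto)
  moreover have "(\<Sum>x\<in>(S - P) \<union> (V - B). ?q x) = (\<Sum>x\<in>S - P. ?q x) + (\<Sum>x\<in>V - B. ?q x)"
    by (rule sum.union_disjoint) (use fin finS sub in auto)
  moreover have "(\<Sum>x\<in>S. ?q x) = (\<Sum>x\<in>S - P. ?q x) + (\<Sum>x\<in>P. ?q x)"
    by (rule sum.subset_diff) (use finS sub in auto)
  moreover have "(\<Sum>x\<in>S. ?d x) \<le> (\<Sum>x\<in>V. ?d x)"
    by (rule sum_mono2) (use fin sub in auto)
  ultimately show ?thesis by linarith
qed

section \<open>Shifts and shears on the Fourier side\<close>

lemma sum_root_char_shift:
  assumes k: "k > 0"
  shows "(\<Sum>y<k. h ((c + y) mod k) * root_char k (u + b * int y)) =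
         (\<Sum>y<k. h y * root_char k (u + b * (int y - int c)))"
proof -
  have "(\<Sum>y<k. h y * root_char k (u + b * (int y - int c))) =
     (\<Sum>y<k. h ((c + y) mod k) * root_char k (u + b * (int ((c + y) mod k) - int c)))"
    by (rule sum_shift_mod[OF k, symmetric])
  also have "\<dots> = (\<Sum>y<k. h ((c + y) mod k) * root_char k (u + b * int y))"
  proof -
    have "root_char k (u + b * (int ((c + y) mod k) - int c)) = root_char k (u + b * int y)" for y
    proof (rule root_char_periodic[OF k])
      have "int k dvd int ((c + y) mod k) - int (c + y)"
        by (simp add: zmod_int mod_eq_dvd_iff[symmetric] del: of_nat_add)
      then have "int k dvd b * (int ((c + y) mod k) - int (c + y))" by simp
      then show "int k dvd u + b * (int ((c + y) mod k) - int c) - (u + b * int y)"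
        by (simp add: algebra_simps)
    qed
    then show ?thesis by simp
  qed
  finally show ?thesis by simp
qed

text \<open>Substituting y - x for y in the exponent shows that the inverse transpose of a shear
  acts on the frequencies.\<close>

lemma dft_shear_snd:
  assumes k: "k > 0"
  shows "dft k (\<lambda>x y. g x ((x + y) mod k)) a b = dft k g (a - b) b"
  unfolding dft_def using sum_root_char_shift[OF k, of "\<lambda>y. of_real (g _ y)" _ "a * int _" b]
  by (simp add: algebra_simps)

lemma dft_shear_fst:
  assumes k: "k > 0"
  shows "dft k (\<lambda>x y. g ((x + y) mod k) y) a b = dft k g a (b - a)"
  unfolding dft_def
  apply (subst (1 2) sum.swap)
  using sum_root_char_shift[OF k, of "\<lambda>x. of_real (g x _)" _ "b * int _" a]
  by (simp add: algebra_simps)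

lemma dft_shift_snd:
  assumes k: "k > 0"
  shows "dft k (\<lambda>x y. g x ((y + 1) mod k)) a b = root_char k (- b) * dft k g a b"
proof -
  have "root_char k (a * int x + b * (int y - 1)) = root_char k (- b) * root_char k (a * int x + b * int y)" for x y
    by (simp add: algebra_simps flip: root_char_add)
  then show ?thesis
  unfolding dft_def using sum_root_char_shift[OF k, of "\<lambda>y. of_real (g _ y)" 1 "a * int _" b]
    by (simp add: sum_distrib_left mult_ac add_ac)
qed

lemma dft_shift_fst:
  assumes k: "k > 0"
  shows "dft k (\<lambda>x y. g ((x + 1) mod k) y) a b = root_char k (- a) * dft k g a b"
proof -
  have "root_char k (b * int y + a * (int x - 1)) = root_char k (- a) * root_char k (a * int x + b * int y)" for x y
    by (simp add: algebra_simps flip: root_char_add)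
  then show ?thesis
  unfolding dft_def
  apply (subst (1 2) sum.swap)
  using sum_root_char_shift[OF k, of "\<lambda>x. of_real (g x _)" 1 "b * int _" a]
    by (simp add: sum_distrib_left mult_ac add_ac)
qed

lemma cmod_root_char_minus_one_sq: "(cmod (root_char k t - 1))\<^sup>2 = 2 - 2 * cos (2 * pi * real_of_int t / real k)"
proof -
  let ?u = "2 * pi * real_of_int t / real k"
  have "(cmod (root_char k t - 1))\<^sup>2 = (cos ?u - 1)\<^sup>2 + (sin ?u)\<^sup>2"
    unfolding root_char_def by (simp add: cmod_power2)
  then show ?thesis using sin_cos_squared_add[of ?u] by (simp add: power2_eq_square algebra_simps)
qed

text \<open>The angle lies between pi / 2 and pi in absolute value, so its cosine is not
  positive.\<close>

lemma root_char_far_from_one: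
  assumes "int k \<le> 4 * \<bar>t\<bar>" "2 * \<bar>t\<bar> \<le> int k" "k > 0"
  shows "2 \<le> (cmod (root_char k t - 1))\<^sup>2"
proof -
  let ?u = "2 * pi * real_of_int \<bar>t\<bar> / real k"
  have "real k \<le> 4 * real_of_int \<bar>t\<bar>" "2 * real_of_int \<bar>t\<bar> \<le> real k"
    using assms by linarith+
  then have "pi / 2 \<le> ?u" "?u \<le> pi" using assms(3) by (simp_all add: field_simps)
  then have "cos ?u \<le> cos (pi / 2)" by (intro cos_monotone_0_pi_le) auto
  moreover have "cos ?u = cos (2 * pi * real_of_int t / real k)"
    by (cases "t \<ge> 0") (simp_all add: abs_if)
  ultimately show ?thesis by (simp add: cmod_root_char_minus_one_sq)
qed

text \<open>The representatives nearest to 0 of pairs of residues. Only with these do signs and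
  sizes of frequencies make sense, as the ping-pong argument requires.\<close>

definition centred :: "nat \<Rightarrow> (int \<times> int) set" where
  "centred k = {- int (k div 2)..<- int (k div 2) + int k} \<times> {- int (k div 2)..<- int (k div 2) + int k}"

lemma plancherel_centred:
  assumes k: "k > 0"
  shows "(\<Sum>(a, b)\<in>centred k. (cmod (dft k g a b))\<^sup>2) = (real k)\<^sup>2 * (\<Sum>x<k. \<Sum>y<k. (g x y)\<^sup>2)"
proof -
  have "(\<Sum>(a, b)\<in>centred k. (cmod (dft k g a b))\<^sup>2) =
     (\<Sum>a\<in>{- int (k div 2)..<- int (k div 2) + int k}. \<Sum>b\<in>{- int (k div 2)..<- int (k div 2) + int k}. (cmod (dft k g a b))\<^sup>2)"
    by (simp add: centred_def sum.cartesian_product)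
  also have "\<dots> = (\<Sum>a<k. \<Sum>b\<in>{- int (k div 2)..<- int (k div 2) + int k}. (cmod (dft k g (int a) b))\<^sup>2)"
    by (rule sum_periodic_window[OF _ k], intro sum.cong refl)
      (simp add: dft_periodic[OF k, of _ _ b b for b])
  also have "\<dots> = (\<Sum>a<k. \<Sum>b<k. (cmod (dft k g (int a) (int b)))\<^sup>2)"
    by (rule sum.cong[OF refl], rule sum_periodic_window[OF _ k]) (simp add: dft_periodic[OF k, of a a for a])
  finally show ?thesis by (simp add: plancherel_2[OF k])
qed

lemma sum_window_translate:
  fixes p :: "int \<Rightarrow> real"
  assumes per: "\<And>a b. int k dvd a - b \<Longrightarrow> p a = p b" and k: "k > 0"
  shows "(\<Sum>a\<in>{s..<s + int k}. p (a + b)) = (\<Sum>a\<in>{s..<s + int k}. p a)"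
proof -
  have "(\<Sum>a\<in>{s..<s + int k}. p (a + b)) = (\<Sum>a\<in>{s + b..<s + b + int k}. p a)"
    by (rule sum.reindex_bij_witness[where i = "\<lambda>a. a - b" and j = "\<lambda>a. a + b"]) auto
  then show ?thesis using sum_periodic_window[of k p, OF per k] by simp
qed

text \<open>For fixed \<open>b\<close> the sum runs over a full period. Through this a shear and its
  inverse have the same energy on the frequency side.\<close>

lemma centred_translate_fst:
  fixes p :: "int \<Rightarrow> int \<Rightarrow> real"
  assumes per: "\<And>a b c. int k dvd a - b \<Longrightarrow> p a c = p b c" and k: "k > 0"
  shows "(\<Sum>(a, b)\<in>centred k. p (a + b) b) = (\<Sum>(a, b)\<in>centred k. p a b)"
proof -
  have "(\<Sum>(a, b)\<in>centred k. p (a + b) b) =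
     (\<Sum>a\<in>{- int (k div 2)..<- int (k div 2) + int k}. \<Sum>b\<in>{- int (k div 2)..<- int (k div 2) + int k}. p (a + b) b)"
    by (simp add: centred_def sum.cartesian_product)
  also have "\<dots> =  (\<Sum>a\<in>{- int (k div 2)..<- int (k div 2) + int k}. \<Sum>b\<in>{- int (k div 2)..<- int (k div 2) + int k}. p a b)"
    by (subst (1 2) sum.swap, rule sum.cong[OF refl], rule sum_window_translate[OF per k])
  finally show ?thesis by (simp add: centred_def sum.cartesian_product)
qed

lemma centred_translate_snd:
  fixes p :: "int \<Rightarrow> int \<Rightarrow> real"
  assumes per: "\<And>a b c. int k dvd a - b \<Longrightarrow> p c a = p c b" and k: "k > 0"
  shows "(\<Sum>(a, b)\<in>centred k. p a (a + b)) = (\<Sum>(a, b)\<in>centred k. p a b)"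
proof -
  have "(\<Sum>(a, b)\<in>centred k. p a (a + b)) =
     (\<Sum>a\<in>{- int (k div 2)..<- int (k div 2) + int k}. \<Sum>b\<in>{- int (k div 2)..<- int (k div 2) + int k}. p a (b + a))"
    by (simp add: centred_def sum.cartesian_product add.commute)
  also have "\<dots> =  (\<Sum>a\<in>{- int (k div 2)..<- int (k div 2) + int k}. \<Sum>b\<in>{- int (k div 2)..<- int (k div 2) + int k}. p a b)"
    by (rule sum.cong[OF refl], rule sum_window_translate[OF per k])
  finally show ?thesis by (simp add: centred_def sum.cartesian_product)
qed

lemma torus_poincare:
  fixes g :: "nat \<Rightarrow> nat \<Rightarrow> real"
  assumes k: "k > 0" and zero: "(\<Sum>x<k. \<Sum>y<k. g x y) = 0"
  shows "(\<Sum>x<k. \<Sum>y<k. (g x y)\<^sup>2) \<le> 36 * (\<Sum>x<k. \<Sum>y<k. (g ((x + 1) mod k) y - g x y)\<^sup>2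
     + (g x ((y + 1) mod k) - g x y)\<^sup>2 + (g x ((x + y) mod k) - g x y)\<^sup>2 + (g ((x + y) mod k) y - g x y)\<^sup>2)"
proof -
  define \<phi> where "\<phi> = (\<lambda>(a, b). dft k g a b)"
  define V where "V = centred k"
  define B where "B = {(a, b) \<in> V. 4 * \<bar>a\<bar> < int k \<and> 4 * \<bar>b\<bar> < int k}"
  define M where "M = (\<Sum>x\<in>V. (cmod (\<phi> x))\<^sup>2)"
  define tail where "tail = (\<Sum>x\<in>V - B. (cmod (\<phi> x))\<^sup>2)"
  define e1 where "e1 = (\<Sum>x<k. \<Sum>y<k. (g ((x + 1) mod k) y - g x y)\<^sup>2)"
  define e2 where "e2 = (\<Sum>x<k. \<Sum>y<k. (g x ((y + 1) mod k) - g x y)\<^sup>2)"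
  define e3 where "e3 = (\<Sum>x<k. \<Sum>y<k. (g x ((x + y) mod k) - g x y)\<^sup>2)"
  define e4 where "e4 = (\<Sum>x<k. \<Sum>y<k. (g ((x + y) mod k) y - g x y)\<^sup>2)"
  define K where "K = (real k)\<^sup>2"
  have K: "K > 0" using k by (simp add: K_def)
  have fin: "finite V" by (simp add: V_def centred_def)
  have inV: "(a, b) \<in> V \<longleftrightarrow> - int (k div 2) \<le> a \<and> a < int k - int (k div 2) \<and> - int (k div 2) \<le> b \<and> b < int k - int (k div 2)" for a b
    by (auto simp: V_def centred_def)
  have half: "2 * int (k div 2) \<le> int k" "int k \<le> 2 * int (k div 2) + 1" by linarith+
  have Meq: "M = K * (\<Sum>x<k. \<Sum>y<k. (g x y)\<^sup>2)"
    using plancherel_centred[OF k, of g] by (simp add: M_def \<phi>_def V_def K_def case_prod_unfold)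

  have E1: "K * e1 = (\<Sum>(a, b)\<in>V. (cmod (\<phi> (a, b)))\<^sup>2 * (cmod (root_char k (- a) - 1))\<^sup>2)"
    using plancherel_centred[OF k, of "\<lambda>x y. g ((x + 1) mod k) y - g x y"]
    unfolding dft_diff[of k "\<lambda>x y. g ((x + 1) mod k) y" g] dft_shift_fst[OF k]
    by (simp add: K_def e1_def V_def \<phi>_def power_mult_distrib[symmetric] norm_mult[symmetric] left_diff_distrib right_diff_distrib mult.commute)
  have E2: "K * e2 = (\<Sum>(a, b)\<in>V. (cmod (\<phi> (a, b)))\<^sup>2 * (cmod (root_char k (- b) - 1))\<^sup>2)"
    using plancherel_centred[OF k, of "\<lambda>x y. g x ((y + 1) mod k) - g x y"]
    unfolding dft_diff[of k "\<lambda>x y. g x ((y + 1) mod k)" g] dft_shift_snd[OF k]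
    by (simp add: K_def e2_def V_def \<phi>_def power_mult_distrib[symmetric] norm_mult[symmetric] left_diff_distrib right_diff_distrib mult.commute)
  have E3: "K * e3 = (\<Sum>(a, b)\<in>V. (cmod (\<phi> (a - b, b) - \<phi> (a, b)))\<^sup>2)"
    using plancherel_centred[OF k, of "\<lambda>x y. g x ((x + y) mod k) - g x y"]
    unfolding dft_diff[of k "\<lambda>x y. g x ((x + y) mod k)" g] dft_shear_snd[OF k]
    by (simp add: K_def e3_def V_def \<phi>_def)
  have E4: "K * e4 = (\<Sum>(a, b)\<in>V. (cmod (\<phi> (a, b - a) - \<phi> (a, b)))\<^sup>2)"
    using plancherel_centred[OF k, of "\<lambda>x y. g ((x + y) mod k) y - g x y"]
    unfolding dft_diff[of k "\<lambda>x y. g ((x + y) mod k) y" g] dft_shear_fst[OF k]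
    by (simp add: K_def e4_def V_def \<phi>_def)
  \<comment> \<open>The four cones below need both directions of each shear; the energy is the same
    for the inverse.\<close>
  have E3': "K * e3 = (\<Sum>(a, b)\<in>V. (cmod (\<phi> (a + b, b) - \<phi> (a, b)))\<^sup>2)"
  proof -
    have "(\<Sum>(a, b)\<in>centred k. (cmod (\<phi> (a + b, b) - \<phi> (a + b - b, b)))\<^sup>2)
      = (\<Sum>(a, b)\<in>centred k. (cmod (\<phi> (a, b) - \<phi> (a - b, b)))\<^sup>2)"
    proof (rule centred_translate_fst[OF _ k])
      fix a b c assume ab: "int k dvd a - b"
      then have "dft k g a c = dft k g b c" "dft k g (a - c) c = dft k g (b - c) c"
        by (auto intro!: dft_periodic[OF k])
      then show "(cmod (\<phi> (a, c) - \<phi> (a - c, c)))\<^sup>2 = (cmod (\<phi> (b, c) - \<phi> (b - c, c)))\<^sup>2"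
        by (simp add: \<phi>_def)
    qed
    then show ?thesis unfolding E3 V_def by (simp add: norm_minus_commute)
  qed
  have E4': "K * e4 = (\<Sum>(a, b)\<in>V. (cmod (\<phi> (a, a + b) - \<phi> (a, b)))\<^sup>2)"
  proof -
    have "(\<Sum>(a, b)\<in>centred k. (cmod (\<phi> (a, a + b) - \<phi> (a, a + b - a)))\<^sup>2)
      = (\<Sum>(a, b)\<in>centred k. (cmod (\<phi> (a, b) - \<phi> (a, b - a)))\<^sup>2)"
    proof (rule centred_translate_snd[OF _ k])
      fix a b c assume ab: "int k dvd a - b"
      then have "dft k g c a = dft k g c b" "dft k g c (a - c) = dft k g c (b - c)"
        by (auto intro!: dft_periodic[OF k])
      then show "(cmod (\<phi> (c, a) - \<phi> (c, a - c)))\<^sup>2 = (cmod (\<phi> (c, b) - \<phi> (c, b - c)))\<^sup>2"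
        by (simp add: \<phi>_def)
    qed
    then show ?thesis unfolding E4 V_def by (simp add: norm_minus_commute)
  qed

  \<comment> \<open>Outside \<open>B\<close> some coordinate has size at least k / 4, and there the
    phase of the corresponding shift is at squared distance at least 2 from 1.\<close>
  have tail: "2 * tail \<le> K * e1 + K * e2"
  proof -
    have "2 * tail \<le> (\<Sum>x\<in>V - B. (cmod (\<phi> x))\<^sup>2 * (cmod (root_char k (- fst x) - 1))\<^sup>2 + (cmod (\<phi> x))\<^sup>2 * (cmod (root_char k (- snd x) - 1))\<^sup>2)"
      unfolding tail_def sum_distrib_left
    proof (rule sum_mono)
      fix x assume x: "x \<in> V - B"
      obtain a b where ab: "x = (a, b)" by force
      have "2 \<le> (cmod (root_char k (- a) - 1))\<^sup>2 \<or> 2 \<le> (cmod (root_char k (- b) - 1))\<^sup>2"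
      proof (cases "4 * \<bar>a\<bar> < int k")
        case False
        then show ?thesis using x half k unfolding ab by (intro disjI1 root_char_far_from_one) (auto simp: inV)
      next
        case True
        then have "\<not> 4 * \<bar>b\<bar> < int k" using x unfolding ab B_def by auto
        then show ?thesis using x half k unfolding ab by (intro disjI2 root_char_far_from_one) (auto simp: inV)
      qed
      then have "2 \<le> (cmod (root_char k (- a) - 1))\<^sup>2 + (cmod (root_char k (- b) - 1))\<^sup>2"
        by (smt (verit) zero_le_power2)
      from mult_left_mono[OF this, of "(cmod (\<phi> x))\<^sup>2"]
      show "2 * (cmod (\<phi> x))\<^sup>2 \<le> (cmod (\<phi> x))\<^sup>2 * (cmod (root_char k (- fst x) - 1))\<^sup>2 + (cmod (\<phi> x))\<^sup>2 * (cmod (root_char k (- snd x) - 1))\<^sup>2"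
        unfolding ab by (simp add: algebra_simps)
    qed
    also have "\<dots> \<le> (\<Sum>x\<in>V. (cmod (\<phi> x))\<^sup>2 * (cmod (root_char k (- fst x) - 1))\<^sup>2 + (cmod (\<phi> x))\<^sup>2 * (cmod (root_char k (- snd x) - 1))\<^sup>2)"
      by (rule sum_mono2) (use fin in auto)
    also have "\<dots> = K * e1 + K * e2"
      unfolding E1 E2 by (simp add: sum.distrib case_prod_unfold)
    finally show ?thesis .
  qed

  let ?m = "\<lambda>P. (\<Sum>x\<in>P. (cmod (\<phi> x))\<^sup>2)"
  \<comment> \<open>Where the signs agree, one coordinate is added to the other, and where they
    differ it is subtracted. The new coordinate then has size |a| + |b|, which takes the image out
    of the cone. Ties |a| = |b| go to \<open>P2\<close> and \<open>P4\<close>, where both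
    coordinates are nonzero and the growth is strict; the axes lie in \<open>P1\<close> and
    \<open>P3\<close>.\<close>
  define P1 where "P1 = {(a, b) \<in> B. 0 \<le> a * b \<and> \<bar>a\<bar> < \<bar>b\<bar>}"
  define P2 where "P2 = {(a, b) \<in> B. 0 < a * b \<and> \<bar>b\<bar> \<le> \<bar>a\<bar>}"
  define P3 where "P3 = {(a, b) \<in> B. a * b \<le> 0 \<and> \<bar>b\<bar> < \<bar>a\<bar>}"
  define P4 where "P4 = {(a, b) \<in> B. a * b < 0 \<and> \<bar>a\<bar> \<le> \<bar>b\<bar>}"
  have BV: "B \<subseteq> V" by (auto simp: B_def)
  \<comment> \<open>Coordinates below k / 4 have sums and differences below k / 2, so the shears do
    not wrap around on \<open>B\<close>.\<close>
  have inVs: "(a + b, b) \<in> V" "(a - b, b) \<in> V" "(a, a + b) \<in> V" "(a, b - a) \<in> V" if "(a, b) \<in> B" for a b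
    using that half by (auto simp: B_def inV)
  have m1: "?m P1 \<le> M / 8 + tail + 9 * (K * e3)"
  proof -
    let ?S = "{(a, b) \<in> B. 0 \<le> a * b \<and> b \<noteq> 0}" and ?T = "\<lambda>(a, b). (a + b, b)"
    have "inj_on ?T ?S" by (auto simp: inj_on_def)
    moreover have "?T ` ?S \<subseteq> V - P1"
      using inVs by (auto simp: P1_def zero_le_mult_iff mult_le_0_iff zero_less_mult_iff mult_less_0_iff)
    moreover have "?T ` ?S \<inter> B \<subseteq> ?S"
      by (auto simp: zero_le_mult_iff mult_le_0_iff zero_less_mult_iff mult_less_0_iff)
    moreover have "P1 \<subseteq> ?S" by (auto simp: P1_def)
    ultimately show ?thesis
      using ping_pong_mass[OF fin BV, of ?S P1 ?T \<phi>]
      unfolding E3' M_def[symmetric] tail_def[symmetric] by (auto simp: case_prod_unfold)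
  qed
  have m2: "?m P2 \<le> M / 8 + tail + 9 * (K * e4)"
  proof -
    let ?S = "{(a, b) \<in> B. 0 < a * b}" and ?T = "\<lambda>(a, b). (a, a + b)"
    have "inj_on ?T ?S" by (auto simp: inj_on_def)
    moreover have "?T ` ?S \<subseteq> V - P2"
      using inVs by (auto simp: P2_def zero_le_mult_iff mult_le_0_iff zero_less_mult_iff mult_less_0_iff)
    moreover have "?T ` ?S \<inter> B \<subseteq> ?S"
      by (auto simp: zero_le_mult_iff mult_le_0_iff zero_less_mult_iff mult_less_0_iff)
    moreover have "P2 \<subseteq> ?S" by (auto simp: P2_def)
    ultimately show ?thesis
      using ping_pong_mass[OF fin BV, of ?S P2 ?T \<phi>]
      unfolding E4' M_def[symmetric] tail_def[symmetric] by (auto simp: case_prod_unfold)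
  qed
  have m3: "?m P3 \<le> M / 8 + tail + 9 * (K * e4)"
  proof -
    let ?S = "{(a, b) \<in> B. a * b \<le> 0 \<and> a \<noteq> 0}" and ?T = "\<lambda>(a, b). (a, b - a)"
    have "inj_on ?T ?S" by (auto simp: inj_on_def)
    moreover have "?T ` ?S \<subseteq> V - P3"
      using inVs by (auto simp: P3_def zero_le_mult_iff mult_le_0_iff zero_less_mult_iff mult_less_0_iff)
    moreover have "?T ` ?S \<inter> B \<subseteq> ?S"
      by (auto simp: zero_le_mult_iff mult_le_0_iff zero_less_mult_iff mult_less_0_iff)
    moreover have "P3 \<subseteq> ?S" by (auto simp: P3_def)
    ultimately show ?thesis
      using ping_pong_mass[OF fin BV, of ?S P3 ?T \<phi>]
      unfolding E4 M_def[symmetric] tail_def[symmetric] by (auto simp: case_prod_unfold)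
  qed
  have m4: "?m P4 \<le> M / 8 + tail + 9 * (K * e3)"
  proof -
    let ?S = "{(a, b) \<in> B. a * b < 0}" and ?T = "\<lambda>(a, b). (a - b, b)"
    have "inj_on ?T ?S" by (auto simp: inj_on_def)
    moreover have "?T ` ?S \<subseteq> V - P4"
      using inVs by (auto simp: P4_def zero_le_mult_iff mult_le_0_iff zero_less_mult_iff mult_less_0_iff)
    moreover have "?T ` ?S \<inter> B \<subseteq> ?S"
      by (auto simp: zero_le_mult_iff mult_le_0_iff zero_less_mult_iff mult_less_0_iff)
    moreover have "P4 \<subseteq> ?S" by (auto simp: P4_def)
    ultimately show ?thesis
      using ping_pong_mass[OF fin BV, of ?S P4 ?T \<phi>]
      unfolding E3 M_def[symmetric] tail_def[symmetric] by (auto simp: case_prod_unfold)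
  qed
  have \<phi>0: "\<phi> (0, 0) = 0"
    using zero by (simp add: \<phi>_def dft_def flip: of_real_sum)
  have "M = tail + ?m B" unfolding M_def tail_def by (rule sum.subset_diff) (use fin BV in auto)
  moreover have "?m B \<le> ?m P1 + ?m P2 + ?m P3 + ?m P4"
  proof -
    have finB: "finite B" using BV fin finite_subset by blast
    have fins: "finite P1" "finite P2" "finite P3" "finite P4"
      by (auto intro: finite_subset[OF _ finB] simp: P1_def P2_def P3_def P4_def)
    have union_le: "?m (X \<union> Y) \<le> ?m X + ?m Y" if "finite X" "finite Y" for X Y
      using sum.union_inter[OF that, of "\<lambda>x. (cmod (\<phi> x))\<^sup>2"] sum_nonneg[of "X \<inter> Y" "\<lambda>x. (cmod (\<phi> x))\<^sup>2"] by auto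
    have "?m B = ?m (B - {(0, 0)})"
      by (rule sum.mono_neutral_right) (use finB \<phi>0 in auto)
    also have "\<dots> \<le> ?m (P1 \<union> P2 \<union> P3 \<union> P4)"
    proof (rule sum_mono2)
      have "(a, b) \<in> P1 \<union> P2 \<union> P3 \<union> P4" if "(a, b) \<in> B" "(a, b) \<noteq> (0, 0)" for a b
      proof -
        have "\<bar>a\<bar> \<noteq> \<bar>b\<bar>" if "a * b = 0" using that \<open>(a, b) \<noteq> (0, 0)\<close> by auto
        then consider "0 \<le> a * b" "\<bar>a\<bar> < \<bar>b\<bar>" | "0 < a * b" "\<bar>b\<bar> \<le> \<bar>a\<bar>"
          | "a * b \<le> 0" "\<bar>b\<bar> < \<bar>a\<bar>" | "a * b < 0" "\<bar>a\<bar> \<le> \<bar>b\<bar>"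
          by linarith
        then show ?thesis using that(1) unfolding P1_def P2_def P3_def P4_def by cases simp_all
      qed
      then show "B - {(0, 0)} \<subseteq> P1 \<union> P2 \<union> P3 \<union> P4" by auto
    qed (use fins in auto)
    also have "\<dots> \<le> ?m P1 + ?m P2 + ?m P3 + ?m P4"
      using union_le[of "P1 \<union> P2 \<union> P3" P4] union_le[of "P1 \<union> P2" P3] union_le[of P1 P2] fins by simp
    finally show ?thesis .
  qed
  \<comment> \<open>The four bounds add up to M <= 5 tail + M / 2 + 18 (K e3 + K e4). Since tail is
    at most half of K e1 + K e2, the constant 36 covers every term.\<close>
  ultimately have "M \<le> 10 * tail + 36 * (K * e3 + K * e4)" using m1 m2 m3 m4 by argo
  also have "\<dots> \<le> 36 * (K * e1 + K * e2 + K * e3 + K * e4)"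
  proof -
    have "0 \<le> K * e1" "0 \<le> K * e2" using K by (auto simp: e1_def e2_def intro!: mult_nonneg_nonneg sum_nonneg)
    then show ?thesis using tail by argo
  qed
  finally have "K * (\<Sum>x<k. \<Sum>y<k. (g x y)\<^sup>2) \<le> K * (36 * (e1 + e2 + e3 + e4))"
    unfolding Meq by (simp add: algebra_simps)
  then have "(\<Sum>x<k. \<Sum>y<k. (g x y)\<^sup>2) \<le> 36 * (e1 + e2 + e3 + e4)" using K by simp
  then show ?thesis by (simp add: e1_def e2_def e3_def e4_def sum.distrib)
qed

section \<open>The prism graph\<close>

text \<open>An orientation of the graph. With permutations \<open>\<rho> c\<close>, each vertex has
  three outgoing and three incoming arcs: one of each along its ring, around its triangle and
  through the permutations.\<close>

definition prism_arc :: "nat \<Rightarrow> (nat \<Rightarrow> nat \<Rightarrow> nat) \<Rightarrow> nat \<Rightarrow> nat \<Rightarrow> bool" where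
  "prism_arc N \<rho> u v \<longleftrightarrow> u < 3 * N \<and> v < 3 * N \<and>
     (v mod 3 = u mod 3 \<and> v div 3 = (u div 3 + 1) mod N \<or>
      v mod 3 = (u mod 3 + 1) mod 3 \<and> (v div 3 = u div 3 \<or> v div 3 = \<rho> (u mod 3) (u div 3)))"

definition prism_graph :: "nat \<Rightarrow> (nat \<Rightarrow> nat \<Rightarrow> nat) \<Rightarrow> nat \<Rightarrow> nat \<Rightarrow> bool" where
  "prism_graph N \<rho> u v \<longleftrightarrow> prism_arc N \<rho> u v \<or> prism_arc N \<rho> v u"

lemma less_3_mult: "c < 3 \<Longrightarrow> 3 * j + c < 3 * N \<longleftrightarrow> j < (N::nat)"
  by linarith

lemma prism_arc_ring:
  assumes "j < N" "c < 3"
  shows "prism_arc N \<rho> (3 * j + c) (3 * ((j + 1) mod N) + c)"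
proof -
  have "(j + 1) mod N < N" using assms by simp
  then show ?thesis using assms unfolding prism_arc_def by (simp add: less_3_mult)
qed

lemma prism_arc_cross:
  assumes "j < N" "c < 3" "i < N" "i = j \<or> i = \<rho> c j"
  shows "prism_arc N \<rho> (3 * j + c) (3 * i + (c + 1) mod 3)"
proof -
  have "(c + 1) mod 3 < 3" by simp
  then show ?thesis using assms unfolding prism_arc_def by (auto simp: less_3_mult)
qed

text \<open>The two ring neighbours differ because \<open>N \<ge> 3\<close>; the two neighbours in
  each other class differ because the permutations have no fixed points.\<close>

lemma prism_regular:
  assumes N: "N \<ge> 3"
    and bij: "\<And>c. c < 3 \<Longrightarrow> bij_betw (\<rho> c) {..<N} {..<N}"
    and fixfree: "\<And>c j. c < 3 \<Longrightarrow> j < N \<Longrightarrow> \<rho> c j \<noteq> j"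
  shows "regular_graph (3 * N) 6 (prism_graph N \<rho>)"
proof -
  have succ: "(j + 1) mod N = (if j + 1 = N then 0 else j + 1)" if "j < N" for j
    using that by auto
  have succ_lt: "(j + 1) mod N < N" for j using N by simp
  have succ_neq: "(j + 1) mod N \<noteq> j" "((j + 1) mod N + 1) mod N \<noteq> j" if "j < N" for j
    unfolding succ[OF succ_lt] unfolding succ[OF that] using that N by (auto split: if_splits)
  have "simple_graph (3 * N) (prism_graph N \<rho>)"
    unfolding simple_graph_def
  proof (intro conjI allI impI)
    fix u :: nat
    have "(u mod 3 + 1) mod 3 \<noteq> u mod 3" by presburger
    moreover have "u div 3 < N" if "u < 3 * N" using that by linarith
    ultimately show "\<not> prism_graph N \<rho> u u"
      using succ_neq(1)[of "u div 3"] by (auto simp: prism_graph_def prism_arc_def)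
  qed (auto simp: prism_graph_def prism_arc_def)
  moreover have "card (neighbours (prism_graph N \<rho>) u) = 6" if u: "u < 3 * N" for u
  proof -
    define j c where "j = u div 3" and "c = u mod 3"
    have jc: "u = 3 * j + c" "j < N" "c < 3" using u by (auto simp: j_def c_def)
    define c1 c2 where "c1 = (c + 1) mod 3" and "c2 = (c + 2) mod 3"
    have c3: "c = 0 \<or> c = 1 \<or> c = 2" using jc(3) by linarith
    then have c12: "c1 < 3" "c2 < 3" "c \<noteq> c1" "c \<noteq> c2" "c1 \<noteq> c2" "(c2 + 1) mod 3 = c"
      by (elim disjE; simp add: c1_def c2_def)+
    have c2_uniq: "d = c2" if "d < 3" "(d + 1) mod 3 = c" for d
    proof -
      have "d = 0 \<or> d = 1 \<or> d = 2" using that(1) by linarith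
      then show ?thesis unfolding c2_def that(2)[symmetric] by (elim disjE) simp_all
    qed
    define i where "i = inv_into {..<N} (\<rho> c2) j"
    have i: "i < N" "\<rho> c2 i = j"
      using bij_betw_inv_into_right[OF bij[OF c12(2)], of j] inv_into_into[of j "\<rho> c2" "{..<N}"]
        bij_betw_imp_surj_on[OF bij[OF c12(2)]] jc
      by (auto simp: i_def)
    have i_uniq: "x = i" if "x < N" "\<rho> c2 x = j" for x
      using that i bij[OF c12(2)] by (auto simp: bij_betw_def inj_on_def)
    define p where "p = (j + (N - 1)) mod N"
    have p: "p < N" "(p + 1) mod N = j"
    proof -
      show "p < N" using N by (simp add: p_def)
      have "(p + 1) mod N = (j + (N - 1) + 1) mod N" unfolding p_def by (rule mod_add_left_eq)
      also have "j + (N - 1) + 1 = j + N" using N by simp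
      finally show "(p + 1) mod N = j" using jc by simp
    qed
    have p_uniq: "x = p" if "x < N" "(x + 1) mod N = j" for x
      using that(2) p(2) unfolding succ[OF that(1)] succ[OF p(1)] using p(1) that(1) by (auto split: if_splits)
    define s where "s = (j + 1) mod N"
    have s: "s < N" using N by (auto simp: s_def)
    have r: "\<rho> c j < N" using bij[OF jc(3)] jc(2) by (auto simp: bij_betw_def)
    have "neighbours (prism_graph N \<rho>) u =
       {3 * s + c, 3 * p + c, 3 * j + c1, 3 * \<rho> c j + c1, 3 * j + c2, 3 * i + c2}" (is "_ = ?R")
    proof (rule Set.set_eqI, rule iffI)
      fix v assume "v \<in> neighbours (prism_graph N \<rho>) u"
      then have G: "prism_graph N \<rho> u v" by (simp add: neighbours_def)
      then have "v < 3 * N" by (auto simp: prism_graph_def prism_arc_def)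
      then obtain y d where v: "v = 3 * y + d" "y < N" "d < 3"
        by (metis less_mult_imp_div_less mult.commute mod_less_divisor mult_div_mod_eq zero_less_numeral)
      have vd: "v div 3 = y" "v mod 3 = d" using v by auto
      from G[unfolded prism_graph_def] show "v \<in> ?R"
      proof
        assume "prism_arc N \<rho> u v"
        then have "d = c \<and> y = s \<or> d = c1 \<and> (y = j \<or> y = \<rho> c j)"
          unfolding prism_arc_def vd j_def[symmetric] c_def[symmetric] s_def[symmetric] c1_def[symmetric] by blast
        then show ?thesis unfolding v(1) by blast
      next
        assume "prism_arc N \<rho> v u"
        then have "c = d \<and> j = (y + 1) mod N \<or> c = (d + 1) mod 3 \<and> (j = y \<or> j = \<rho> d y)"
          unfolding prism_arc_def vd j_def[symmetric] c_def[symmetric] by blast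
        then have "d = c \<and> y = p \<or> d = c2 \<and> (y = j \<or> y = i)"
          using p_uniq[OF v(2)] i_uniq[OF v(2)] c2_uniq[OF v(3)] by (elim disjE conjE) simp_all
        then show ?thesis unfolding v(1) by blast
      qed
    next
      have arcs: "prism_arc N \<rho> u (3 * s + c)" "prism_arc N \<rho> (3 * p + c) u" "prism_arc N \<rho> u (3 * j + c1)"
        "prism_arc N \<rho> u (3 * \<rho> c j + c1)" "prism_arc N \<rho> (3 * j + c2) u" "prism_arc N \<rho> (3 * i + c2) u"
        using prism_arc_ring[OF jc(2,3), of \<rho>, folded s_def jc(1)] prism_arc_ring[OF p(1) jc(3), of \<rho>, unfolded p(2), folded jc(1)]
          prism_arc_cross[OF jc(2,3) jc(2) disjI1[OF refl], of \<rho>, folded c1_def jc(1)]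
          prism_arc_cross[of j N c "\<rho> c j" \<rho>, OF jc(2,3) r disjI2[OF refl], folded c1_def jc(1)]
          prism_arc_cross[OF jc(2) c12(2) jc(2) disjI1[OF refl], of \<rho>, unfolded c12(6), folded jc(1)]
          prism_arc_cross[of i N c2 j \<rho>, OF i(1) c12(2) jc(2) disjI2[OF i(2)[symmetric]], unfolded c12(6), folded jc(1)]
        by simp_all
      fix v assume "v \<in> ?R"
      then show "v \<in> neighbours (prism_graph N \<rho>) u"
        using arcs by (auto simp: neighbours_def prism_graph_def)
    qed
    moreover have "card ?R = 6"
    proof -
      have neq: "3 * x + d \<noteq> 3 * y + e" if "x \<noteq> y \<or> d \<noteq> e" "d < 3" "e < 3" for x y d e :: nat
        using that by presburger
      have "s \<noteq> p" using succ_neq(2)[OF jc(2)] p(2) by (auto simp: s_def)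
      moreover have "\<rho> c j \<noteq> j" using fixfree jc by auto
      moreover have "i \<noteq> j" using fixfree[of c2 j] c12 jc i by auto
      ultimately show ?thesis using c12 jc neq by (simp add: card_insert_if)
    qed
    ultimately show ?thesis by simp
  qed
  ultimately show ?thesis by (simp add: regular_graph_def)
qed

lemma prism_induced_cycle:
  assumes N: "N \<ge> 3" and c: "c < 3"
  shows "induced_cycle (3 * N) (prism_graph N \<rho>) (map (\<lambda>j. 3 * j + c) [0..<N])"
proof -
  have "(c + 1) mod 3 \<noteq> c" using c by presburger
  then have adj: "prism_graph N \<rho> (3 * i + c) (3 * j + c) \<longleftrightarrow> j = (i + 1) mod N \<or> i = (j + 1) mod N"
    if "i < N" "j < N" for i j
    using that c by (auto simp: prism_graph_def prism_arc_def less_3_mult)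
  have lt: "(i + 1) mod N < N" for i using N by simp
  show ?thesis
    unfolding induced_cycle_def Let_def
  proof (intro conjI allI impI)
    show "set (map (\<lambda>j. 3 * j + c) [0..<N]) \<subseteq> {0..<3 * N}" using c by auto
  qed (use N adj lt in \<open>simp_all add: distinct_map inj_on_def\<close>)
qed

section \<open>Comparing energies on the torus and on the prism graph\<close>

lemma double_sum_ge_matching:
  fixes h :: "nat \<Rightarrow> nat \<Rightarrow> real"
  assumes "finite A" "inj_on q A" "\<And>j. j \<in> A \<Longrightarrow> q j < n \<and> p j < n \<and> G (q j) (p j)"
    and nonneg: "\<And>u v. h u v \<ge> 0"
  shows "(\<Sum>j\<in>A. h (q j) (p j)) \<le> (\<Sum>u<n. \<Sum>v<n. if G u v then h u v else 0)"
proof -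
  have "(\<Sum>j\<in>A. h (q j) (p j)) \<le> (\<Sum>j\<in>A. \<Sum>v<n. if G (q j) v then h (q j) v else 0)"
  proof (rule sum_mono)
    fix j assume "j \<in> A"
    then show "h (q j) (p j) \<le> (\<Sum>v<n. if G (q j) v then h (q j) v else 0)"
      using member_le_sum[of "p j" "{..<n}" "\<lambda>v. if G (q j) v then h (q j) v else 0"] assms(3)[of j] nonneg
      by auto
  qed
  also have "\<dots> = (\<Sum>u\<in>q ` A. \<Sum>v<n. if G u v then h u v else 0)"
    by (simp add: sum.reindex[OF assms(2)])
  also have "\<dots> \<le> (\<Sum>u<n. \<Sum>v<n. if G u v then h u v else 0)"
    by (rule sum_mono2) (use assms in \<open>auto intro!: sum_nonneg\<close>)
  finally show ?thesis .
qed

lemma sum_blocks: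
  fixes h :: "nat \<Rightarrow> 'a::comm_monoid_add"
  shows "(\<Sum>v<k * a. h v) = (\<Sum>x<a. \<Sum>y<k. h (k * x + y))"
proof -
  have "(\<Sum>v<k * a. h v) = (\<Sum>x<a. sum h {x * k..<x * k + k})"
    by (simp add: sum.nat_group mult.commute)
  also have "\<dots> = (\<Sum>x<a. \<Sum>y<k. h (k * x + y))"
  proof (rule sum.cong[OF refl])
    fix x
    show "sum h {x * k..<x * k + k} = (\<Sum>y<k. h (k * x + y))"
      using sum.shift_bounds_nat_ivl[of h 0 "k * x" k]
      by (simp add: atLeast0LessThan add.commute mult.commute)
  qed
  finally show ?thesis .
qed

lemma sum_triples: "(\<Sum>u<3 * N. h (u::nat)) = (\<Sum>j<N. h (3 * j) + h (3 * j + 1) + (h (3 * j + 2) :: real))"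
proof -
  have "(\<Sum>y<3. g y) = g 0 + g 1 + g 2" for g :: "nat \<Rightarrow> real"
    by (simp add: eval_nat_numeral)
  then show ?thesis unfolding sum_blocks by simp
qed

lemma sq_add_le: "(x + y)\<^sup>2 \<le> 2 * x\<^sup>2 + 2 * (y::real)\<^sup>2"
  using zero_le_power2[of "x - y"] by (simp add: power2_eq_square algebra_simps)

lemma sq_add3_le: "(x + y + z)\<^sup>2 \<le> 3 * x\<^sup>2 + 3 * y\<^sup>2 + 3 * (z::real)\<^sup>2"
  using zero_le_power2[of "x - y"] zero_le_power2[of "x - z"] zero_le_power2[of "y - z"]
  by (simp add: power2_eq_square algebra_simps)

text \<open>The coordinates of \<open>v\<close> in the torus \<open>\<int>\<^sub>k \<times> \<int>\<^sub>k\<close> are \<open>v div k\<close> and \<open>v mod k\<close>.\<close>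

definition torus_shift_fst :: "nat \<Rightarrow> nat \<Rightarrow> nat" where
  "torus_shift_fst k v = k * ((v div k + 1) mod k) + v mod k"
definition torus_shift_snd :: "nat \<Rightarrow> nat \<Rightarrow> nat" where
  "torus_shift_snd k v = k * (v div k) + (v mod k + 1) mod k"
definition torus_shear_snd :: "nat \<Rightarrow> nat \<Rightarrow> nat" where
  "torus_shear_snd k v = k * (v div k) + (v div k + v mod k) mod k"
definition torus_shear_fst :: "nat \<Rightarrow> nat \<Rightarrow> nat" where
  "torus_shear_fst k v = k * ((v div k + v mod k) mod k) + v mod k"

lemmas torus_defs = torus_shift_fst_def torus_shift_snd_def torus_shear_snd_def torus_shear_fst_def

lemma bij_betw_lessThanI:
  assumes "inj_on f {..<n}" "\<And>v. v < n \<Longrightarrow> f v < n"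
  shows "bij_betw f {..<n} {..<n::nat}"
proof -
  have "f ` {..<n} = {..<n}" by (rule endo_inj_surj) (use assms in auto)
  then show ?thesis using assms by (simp add: bij_betw_def)
qed

lemma torus_bij:
  assumes k: "k > 0"
  shows "bij_betw (torus_shift_fst k) {..<k * k} {..<k * k}"
    "bij_betw (torus_shift_snd k) {..<k * k} {..<k * k}"
    "bij_betw (torus_shear_fst k) {..<k * k} {..<k * k}"
    "bij_betw (torus_shear_snd k) {..<k * k} {..<k * k}"
proof -
  have enc_less: "k * x + y < k * k" if "x < k" "y < k" for x y
  proof -
    have "k * x + y < k * Suc x" using that by simp
    also have "\<dots> \<le> k * k" using that by (intro mult_left_mono) auto
    finally show ?thesis .
  qed
  have dec: "v div k < k" if "v < k * k" for v using that by (simp add: less_mult_imp_div_less)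
  have enc_inj: "x = x' \<and> y = y'" if "k * x + y = k * x' + y'" "y < k" "y' < k" for x y x' y'
  proof -
    have "(k * x + y) div k = x" "(k * x + y) mod k = y" "(k * x' + y') div k = x'" "(k * x' + y') mod k = y'"
      using that(2,3) by auto
    then show ?thesis using that(1) by metis
  qed
  have eqI: "v = v'" if "v div k = v' div k" "v mod k = v' mod k" for v v'
    using that by (metis mult_div_mod_eq)
  show "bij_betw (torus_shift_fst k) {..<k * k} {..<k * k}"
  proof (rule bij_betw_lessThanI, rule inj_onI)
    fix v v' assume v: "v \<in> {..<k * k}" "v' \<in> {..<k * k}" "torus_shift_fst k v = torus_shift_fst k v'"
    have lt: "v mod k < k" "v' mod k < k" "(x + y) mod k < k" for x y using k by auto
    have "(v div k + 1) mod k = (v' div k + 1) mod k \<and> v mod k = v' mod k"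
      using v(3) enc_inj lt unfolding torus_defs by blast
    moreover have "v div k < k" "v' div k < k" using v dec by auto
    ultimately have "v div k = v' div k" "v mod k = v' mod k"
      using nat_mod_add_cancel[of "1" "v div k" k "v' div k"] by (simp_all add: add.commute)
    then show "v = v'" by (rule eqI)
  qed (use k in \<open>auto simp: torus_defs dec enc_less\<close>)
  show "bij_betw (torus_shift_snd k) {..<k * k} {..<k * k}"
  proof (rule bij_betw_lessThanI, rule inj_onI)
    fix v v' assume v: "v \<in> {..<k * k}" "v' \<in> {..<k * k}" "torus_shift_snd k v = torus_shift_snd k v'"
    have lt: "v mod k < k" "v' mod k < k" "(x + y) mod k < k" for x y using k by auto
    have "v div k = v' div k \<and> (v mod k + 1) mod k = (v' mod k + 1) mod k"
      using v(3) enc_inj lt unfolding torus_defs by blast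
    moreover have "v mod k < k" "v' mod k < k" using lt by auto
    ultimately have "v div k = v' div k" "v mod k = v' mod k"
      using nat_mod_add_cancel[of "1" "v mod k" k "v' mod k"] by (simp_all add: add.commute)
    then show "v = v'" by (rule eqI)
  qed (use k in \<open>auto simp: torus_defs dec enc_less\<close>)
  show "bij_betw (torus_shear_fst k) {..<k * k} {..<k * k}"
  proof (rule bij_betw_lessThanI, rule inj_onI)
    fix v v' assume v: "v \<in> {..<k * k}" "v' \<in> {..<k * k}" "torus_shear_fst k v = torus_shear_fst k v'"
    have lt: "v mod k < k" "v' mod k < k" "(x + y) mod k < k" for x y using k by auto
    have "(v div k + v mod k) mod k = (v' div k + v' mod k) mod k \<and> v mod k = v' mod k"
      using v(3) enc_inj lt unfolding torus_defs by blast
    moreover have "v div k < k" "v' div k < k" using v dec by auto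
    ultimately have "v div k = v' div k" "v mod k = v' mod k"
      using nat_mod_add_cancel[of "v mod k" "v div k" k "v' div k"] by (metis add.commute)+
    then show "v = v'" by (rule eqI)
  qed (use k in \<open>auto simp: torus_defs dec enc_less\<close>)
  show "bij_betw (torus_shear_snd k) {..<k * k} {..<k * k}"
  proof (rule bij_betw_lessThanI, rule inj_onI)
    fix v v' assume v: "v \<in> {..<k * k}" "v' \<in> {..<k * k}" "torus_shear_snd k v = torus_shear_snd k v'"
    have lt: "v mod k < k" "v' mod k < k" "(x + y) mod k < k" for x y using k by auto
    have "v div k = v' div k \<and> (v div k + v mod k) mod k = (v' div k + v' mod k) mod k"
      using v(3) enc_inj lt unfolding torus_defs by blast
    moreover have "v mod k < k" "v' mod k < k" using lt by auto
    ultimately have "v div k = v' div k" "v mod k = v' mod k"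
      using nat_mod_add_cancel[of "v div k" "v mod k" k "v' mod k"] by (metis add.commute)+
    then show "v = v'" by (rule eqI)
  qed (use k in \<open>auto simp: torus_defs dec enc_less\<close>)
qed

lemma torus_poincare_encoded:
  fixes g :: "nat \<Rightarrow> real"
  assumes k: "k > 0" and zero: "(\<Sum>v<k * k. g v) = 0"
  shows "(\<Sum>v<k * k. (g v)\<^sup>2) \<le> 36 * (\<Sum>v<k * k. (g (torus_shift_fst k v) - g v)\<^sup>2
     + (g (torus_shift_snd k v) - g v)\<^sup>2 + (g (torus_shear_snd k v) - g v)\<^sup>2 + (g (torus_shear_fst k v) - g v)\<^sup>2)"
proof -
  have "(\<Sum>x<k. \<Sum>y<k. g (k * x + y)) = 0" using zero by (simp add: sum_blocks)
  from torus_poincare[OF k this] show ?thesis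
    unfolding sum_blocks by (simp add: torus_defs)
qed

text \<open>The pair \<open>2 * v\<close>, \<open>2 * v + 1\<close> stands for the torus point
  \<open>v\<close>. Even indices carry \<open>\<alpha>\<close> and odd ones \<open>\<beta>\<close>,
  so one permutation encodes two moves; as both change the parity, no index below
  \<open>2 * m\<close> is fixed. The last \<open>r\<close> indices rotate among themselves.\<close>

definition block_perm :: "nat \<Rightarrow> nat \<Rightarrow> (nat \<Rightarrow> nat) \<Rightarrow> (nat \<Rightarrow> nat) \<Rightarrow> nat \<Rightarrow> nat" where
  "block_perm m r \<alpha> \<beta> i =
     (if i < 2 * m then (if even i then 2 * \<alpha> (i div 2) + 1 else 2 * \<beta> (i div 2))
      else 2 * m + (i - 2 * m + 1) mod r)"

lemma block_perm_bij:
  assumes \<alpha>: "bij_betw \<alpha> {..<m} {..<m}" and \<beta>: "bij_betw \<beta> {..<m} {..<m}" and r: "r \<ge> 1"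
  shows "bij_betw (block_perm m r \<alpha> \<beta>) {..<2 * m + r} {..<2 * m + r}"
proof -
  let ?p = "block_perm m r \<alpha> \<beta>"
  have lt: "\<alpha> v < m" "\<beta> v < m" if "v < m" for v
    using that \<alpha> \<beta> by (auto simp: bij_betw_def)
  have inj: "\<alpha> v = \<alpha> w \<longleftrightarrow> v = w" "\<beta> v = \<beta> w \<longleftrightarrow> v = w" if "v < m" "w < m" for v w
    using that \<alpha> \<beta> by (auto simp: bij_betw_def inj_on_def)
  have less: "?p i < 2 * m \<longleftrightarrow> i < 2 * m" if "i < 2 * m + r" for i
    using lt[of "i div 2"] by (auto simp: block_perm_def)
  have "inj_on ?p {..<2 * m + r}"
  proof (rule inj_onI)
    fix i j assume ij: "i \<in> {..<2 * m + r}" "j \<in> {..<2 * m + r}" "?p i = ?p j"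
    show "i = j"
    proof (cases "i < 2 * m")
      case True
      then have j: "j < 2 * m" using less[of i] less[of j] ij by auto
      have half: "i div 2 < m" "j div 2 < m" using True j by auto
      have par: "even i = even j"
      proof -
        have "even (?p i) \<longleftrightarrow> odd i" if "i < 2 * m" for i using that by (auto simp: block_perm_def)
        then show ?thesis using ij(3) True j by metis
      qed
      have "i div 2 = j div 2"
        using ij(3) True j par inj[OF half] by (auto simp: block_perm_def split: if_splits)
      then show ?thesis using par by (metis dvd_mult_div_cancel odd_two_times_div_two_succ)
    next
      case False
      then have j: "\<not> j < 2 * m" using less[of i] less[of j] ij by auto
      have "(i - 2 * m + 1) mod r = (j - 2 * m + 1) mod r"
        using ij(3) False j by (auto simp: block_perm_def)
      moreover have "i - 2 * m < r" "j - 2 * m < r" using ij False j by auto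
      ultimately have "i - 2 * m = j - 2 * m" by (auto simp: mod_Suc split: if_splits)
      then show ?thesis using False j by auto
    qed
  qed
  moreover have "?p i < 2 * m + r" if "i < 2 * m + r" for i
  proof (cases "i < 2 * m")
    case True
    then have "i div 2 < m" by (simp add: less_mult_imp_div_less mult.commute)
    then show ?thesis using lt[of "i div 2"] True by (auto simp: block_perm_def)
  qed (use r in \<open>simp add: block_perm_def\<close>)
  ultimately show ?thesis by (rule bij_betw_lessThanI)
qed

lemma block_perm_fixfree:
  assumes r: "r \<ge> 2" and "i < 2 * m + r"
  shows "block_perm m r \<alpha> \<beta> i \<noteq> i"
proof (cases "i < 2 * m")
  case True
  then have "even (block_perm m r \<alpha> \<beta> i) \<noteq> even i" by (auto simp: block_perm_def)
  then show ?thesis by metis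
next
  case False
  then show ?thesis using assms by (auto simp: block_perm_def mod_Suc split: if_splits)
qed

text \<open>For \<open>j < r\<close>, the rotation of the last class sends the left-over index
  \<open>2 * (k * k) + j\<close> to \<open>j\<close>, which ties it to the torus part if
  \<open>r \<le> 2 * (k * k)\<close>.\<close>

definition torus_perms :: "nat \<Rightarrow> nat \<Rightarrow> nat \<Rightarrow> nat \<Rightarrow> nat" where
  "torus_perms k r c =
     (if c = 0 then block_perm (k * k) r (torus_shift_fst k) (torus_shift_snd k)
      else if c = 1 then block_perm (k * k) r (torus_shear_snd k) (torus_shear_fst k)
      else (\<lambda>i. (i + r) mod (2 * (k * k) + r)))"

lemma torus_perms_bij:
  assumes "k > 0" "r \<ge> 1"
  shows "bij_betw (torus_perms k r c) {..<2 * (k * k) + r} {..<2 * (k * k) + r}"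
proof -
  let ?N = "2 * (k * k) + r"
  have "inj_on (\<lambda>i. (i + r) mod ?N) {..<?N}"
  proof (rule inj_onI)
    fix i j assume ij: "i \<in> {..<?N}" "j \<in> {..<?N}" "(i + r) mod ?N = (j + r) mod ?N"
    then show "i = j" using nat_mod_add_cancel[of r i ?N j] by (simp add: add.commute)
  qed
  then have "bij_betw (\<lambda>i. (i + r) mod ?N) {..<?N} {..<?N}"
    by (rule bij_betw_lessThanI) (use assms in simp)
  then show ?thesis
    using torus_bij[OF assms(1)] block_perm_bij assms(2) by (auto simp: torus_perms_def)
qed

lemma rotation_fixfree:
  fixes i r M :: nat
  assumes "0 < r" "r < M" "i < M"
  shows "(i + r) mod M \<noteq> i"
proof (cases "i + r < M")
  case False
  then have "(i + r) mod M = i + r - M" using assms by (simp add: le_mod_geq)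
  then show ?thesis using assms False by linarith
qed (use assms in simp)

lemma torus_perms_fixfree:
  assumes "k > 0" "r \<ge> 2" "i < 2 * (k * k) + r"
  shows "torus_perms k r c i \<noteq> i"
  unfolding torus_perms_def
  using block_perm_fixfree[OF assms(2,3)] rotation_fixfree[OF _ _ assms(3), of r] assms(1,2) by simp

lemma torus_perms_poincare:
  fixes F :: "nat \<Rightarrow> real"
  assumes k: "k > 0" and r: "1 \<le> r" "r \<le> 2 * (k * k)"
  defines "N \<equiv> 2 * (k * k) + r"
  shows "\<exists>a. (\<Sum>j<N. (F j - a)\<^sup>2) \<le> 2600 * ((\<Sum>j<N. (F ((j + 1) mod N) - F j)\<^sup>2)
     + (\<Sum>j<N. (F (torus_perms k r 0 j) - F j)\<^sup>2) + (\<Sum>j<N. (F (torus_perms k r 1 j) - F j)\<^sup>2)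
     + (\<Sum>j<N. (F (torus_perms k r 2 j) - F j)\<^sup>2))"
proof -
  define m where "m = k * k"
  have m: "m > 0" using k by (simp add: m_def)
  have N: "N = 2 * m + r" by (simp add: N_def m_def)
  \<comment> \<open>The mean over the even representatives, so that \<open>F (2 * v) - a\<close> has
    sum zero on the torus.\<close>
  define a where "a = (\<Sum>v<m. F (2 * v)) / m"
  define R where "R = (\<Sum>j<N. (F ((j + 1) mod N) - F j)\<^sup>2)"
  define E where "E = (\<lambda>c. \<Sum>j<N. (F (torus_perms k r c j) - F j)\<^sup>2)"
  define X where "X = (\<Sum>v<m. (F (2 * v) - a)\<^sup>2)"
  have nonneg: "0 \<le> R" "0 \<le> E c" "0 \<le> X" for c by (auto simp: R_def E_def X_def intro!: sum_nonneg)
  have even_le: "(\<Sum>v<m. h (2 * v)) \<le> (\<Sum>j<N. h j)" "(\<Sum>v<m. h (2 * v + 1)) \<le> (\<Sum>j<N. h j)"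
    if "\<And>j. 0 \<le> h j" for h :: "nat \<Rightarrow> real"
  proof -
    have "(\<Sum>v<m. h (2 * v)) = (\<Sum>j\<in>(\<lambda>v. 2 * v) ` {..<m}. h j)"
      by (subst sum.reindex) (auto simp: inj_on_def)
    also have "\<dots> \<le> (\<Sum>j<N. h j)" by (rule sum_mono2) (use that in \<open>auto simp: N\<close>)
    finally show "(\<Sum>v<m. h (2 * v)) \<le> (\<Sum>j<N. h j)" .
    have "(\<Sum>v<m. h (2 * v + 1)) = (\<Sum>j\<in>(\<lambda>v. 2 * v + 1) ` {..<m}. h j)"
      by (subst sum.reindex) (auto simp: inj_on_def)
    also have "\<dots> \<le> (\<Sum>j<N. h j)" by (rule sum_mono2) (use that in \<open>auto simp: N\<close>)
    finally show "(\<Sum>v<m. h (2 * v + 1)) \<le> (\<Sum>j<N. h j)" .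
  qed
  have link: "(\<Sum>v<m. (F (2 * v + 1) - F (2 * v))\<^sup>2) \<le> R"
  proof -
    have "(\<Sum>v<m. (F (2 * v + 1) - F (2 * v))\<^sup>2) = (\<Sum>v<m. (F ((2 * v + 1) mod N) - F (2 * v))\<^sup>2)"
      by (rule sum.cong) (auto simp: N)
    then show ?thesis using even_le(1)[of "\<lambda>j. (F ((j + 1) mod N) - F j)\<^sup>2"] by (simp add: R_def)
  qed
  \<comment> \<open>The move is a permutation edge to \<open>2 * \<gamma> v + 1\<close> followed by
    a ring edge back to \<open>2 * \<gamma> v\<close>. Bijectivity of \<open>\<gamma>\<close> makes
    every ring edge count once.\<close>
  have up: "(\<Sum>v<m. (F (2 * \<gamma> v) - F (2 * v))\<^sup>2) \<le> 2 * E c + 2 * R"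
    if \<gamma>: "bij_betw \<gamma> {..<m} {..<m}" and p: "\<And>v. v < m \<Longrightarrow> torus_perms k r c (2 * v) = 2 * \<gamma> v + 1" for \<gamma> c
  proof -
    have "(\<Sum>v<m. (F (2 * \<gamma> v) - F (2 * v))\<^sup>2)
      \<le> (\<Sum>v<m. 2 * (F (2 * \<gamma> v + 1) - F (2 * v))\<^sup>2 + 2 * (F (2 * \<gamma> v + 1) - F (2 * \<gamma> v))\<^sup>2)"
    proof (rule sum_mono)
      fix v
      show "(F (2 * \<gamma> v) - F (2 * v))\<^sup>2 \<le> 2 * (F (2 * \<gamma> v + 1) - F (2 * v))\<^sup>2 + 2 * (F (2 * \<gamma> v + 1) - F (2 * \<gamma> v))\<^sup>2"
        using sq_add_le[of "F (2 * \<gamma> v + 1) - F (2 * v)" "- (F (2 * \<gamma> v + 1) - F (2 * \<gamma> v))"]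
        by (simp add: power2_commute[of "F (2 * \<gamma> v)" "F (Suc (2 * \<gamma> v))"])
    qed
    also have "\<dots> = 2 * (\<Sum>v<m. (F (torus_perms k r c (2 * v)) - F (2 * v))\<^sup>2) + 2 * (\<Sum>v<m. (F (2 * \<gamma> v + 1) - F (2 * \<gamma> v))\<^sup>2)"
      by (simp add: sum.distrib sum_distrib_left p)
    also have "(\<Sum>v<m. (F (2 * \<gamma> v + 1) - F (2 * \<gamma> v))\<^sup>2) = (\<Sum>v<m. (F (2 * v + 1) - F (2 * v))\<^sup>2)"
      by (rule sum.reindex_bij_betw[OF \<gamma>])
    finally show ?thesis using even_le(1)[of "\<lambda>j. (F (torus_perms k r c j) - F j)\<^sup>2"] link by (simp add: E_def)
  qed
  \<comment> \<open>Here the ring edge comes first, at the pair of \<open>v\<close> itself, and then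
    the permutation edge from \<open>2 * v + 1\<close>.\<close>
  have down: "(\<Sum>v<m. (F (2 * \<gamma> v) - F (2 * v))\<^sup>2) \<le> 2 * E c + 2 * R"
    if p: "\<And>v. v < m \<Longrightarrow> torus_perms k r c (2 * v + 1) = 2 * \<gamma> v" for \<gamma> c
  proof -
    have "(\<Sum>v<m. (F (2 * \<gamma> v) - F (2 * v))\<^sup>2)
      \<le> (\<Sum>v<m. 2 * (F (2 * \<gamma> v) - F (2 * v + 1))\<^sup>2 + 2 * (F (2 * v + 1) - F (2 * v))\<^sup>2)"
    proof (rule sum_mono)
      fix v
      show "(F (2 * \<gamma> v) - F (2 * v))\<^sup>2 \<le> 2 * (F (2 * \<gamma> v) - F (2 * v + 1))\<^sup>2 + 2 * (F (2 * v + 1) - F (2 * v))\<^sup>2"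
        using sq_add_le[of "F (2 * \<gamma> v) - F (2 * v + 1)" "F (2 * v + 1) - F (2 * v)"] by simp
    qed
    also have "\<dots> = 2 * (\<Sum>v<m. (F (torus_perms k r c (2 * v + 1)) - F (2 * v + 1))\<^sup>2) + 2 * (\<Sum>v<m. (F (2 * v + 1) - F (2 * v))\<^sup>2)"
      by (simp add: sum.distrib sum_distrib_left p[simplified])
    finally show ?thesis using even_le(2)[of "\<lambda>j. (F (torus_perms k r c j) - F j)\<^sup>2"] link by (simp add: E_def)
  qed
  note tb = torus_bij[OF k, folded m_def]
  have X: "X \<le> 36 * (4 * E 0 + 4 * E 1 + 8 * R)"
  proof -
    let ?g = "\<lambda>v. F (2 * v) - a"
    have "(\<Sum>v<m. ?g v) = 0" using m by (simp add: sum_subtractf a_def)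
    then have "X \<le> 36 * ((\<Sum>v<m. (F (2 * torus_shift_fst k v) - F (2 * v))\<^sup>2) + (\<Sum>v<m. (F (2 * torus_shift_snd k v) - F (2 * v))\<^sup>2)
        + (\<Sum>v<m. (F (2 * torus_shear_snd k v) - F (2 * v))\<^sup>2) + (\<Sum>v<m. (F (2 * torus_shear_fst k v) - F (2 * v))\<^sup>2))"
      using torus_poincare_encoded[OF k, of ?g] by (simp add: m_def X_def sum.distrib)
    moreover have "(\<Sum>v<m. (F (2 * torus_shift_fst k v) - F (2 * v))\<^sup>2) \<le> 2 * E 0 + 2 * R"
      by (rule up[OF tb(1)]) (simp add: torus_perms_def block_perm_def m_def)
    moreover have "(\<Sum>v<m. (F (2 * torus_shift_snd k v) - F (2 * v))\<^sup>2) \<le> 2 * E 0 + 2 * R"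
      by (rule down) (simp add: torus_perms_def block_perm_def m_def)
    moreover have "(\<Sum>v<m. (F (2 * torus_shear_snd k v) - F (2 * v))\<^sup>2) \<le> 2 * E 1 + 2 * R"
      by (rule up[OF tb(4)]) (simp add: torus_perms_def block_perm_def m_def)
    moreover have "(\<Sum>v<m. (F (2 * torus_shear_fst k v) - F (2 * v))\<^sup>2) \<le> 2 * E 1 + 2 * R"
      by (rule down) (simp add: torus_perms_def block_perm_def m_def)
    ultimately show ?thesis by argo
  qed
  define Y where "Y = (\<Sum>i<2 * m. (F i - a)\<^sup>2)"
  have "Y = (\<Sum>v<m. (F (2 * v) - a)\<^sup>2 + (F (2 * v + 1) - a)\<^sup>2)"
    unfolding Y_def sum_blocks by (simp add: eval_nat_numeral)
  also have "\<dots> \<le> (\<Sum>v<m. 3 * (F (2 * v) - a)\<^sup>2 + 2 * (F (2 * v + 1) - F (2 * v))\<^sup>2)"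
  proof (rule sum_mono)
    fix v show "(F (2 * v) - a)\<^sup>2 + (F (2 * v + 1) - a)\<^sup>2 \<le> 3 * (F (2 * v) - a)\<^sup>2 + 2 * (F (2 * v + 1) - F (2 * v))\<^sup>2"
      using sq_add_le[of "F (2 * v + 1) - F (2 * v)" "F (2 * v) - a"] by simp
  qed
  also have "\<dots> \<le> 3 * X + 2 * R" using link by (simp add: sum.distrib X_def flip: sum_distrib_left)
  finally have Y: "Y \<le> 3 * X + 2 * R" .
  have "(\<Sum>j<r. (F (2 * m + j) - a)\<^sup>2) \<le> (\<Sum>j<r. 2 * (F (torus_perms k r 2 (2 * m + j)) - F (2 * m + j))\<^sup>2 + 2 * (F j - a)\<^sup>2)"
  proof (rule sum_mono)
    fix j assume j: "j \<in> {..<r}"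
    have "torus_perms k r 2 (2 * m + j) = (j + N) mod N" by (simp add: torus_perms_def N m_def add_ac)
    also have "\<dots> = j" using j by (simp add: N)
    finally show "(F (2 * m + j) - a)\<^sup>2 \<le> 2 * (F (torus_perms k r 2 (2 * m + j)) - F (2 * m + j))\<^sup>2 + 2 * (F j - a)\<^sup>2"
      using sq_add_le[of "F (2 * m + j) - F j" "F j - a"] by (simp add: power2_commute)
  qed
  also have "\<dots> = 2 * (\<Sum>j<r. (F (torus_perms k r 2 (2 * m + j)) - F (2 * m + j))\<^sup>2) + 2 * (\<Sum>j<r. (F j - a)\<^sup>2)"
    by (simp add: sum.distrib sum_distrib_left)
  also have "\<dots> \<le> 2 * E 2 + 2 * Y"
  proof -
    have "(\<Sum>j<r. (F j - a)\<^sup>2) \<le> Y" unfolding Y_def by (rule sum_mono2) (use r in \<open>auto simp: m_def\<close>)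
    moreover have "(\<Sum>j<r. (F (torus_perms k r 2 (2 * m + j)) - F (2 * m + j))\<^sup>2) \<le> E 2"
    proof -
      have "(\<Sum>j<r. (F (torus_perms k r 2 (2 * m + j)) - F (2 * m + j))\<^sup>2) =
        (\<Sum>i\<in>(\<lambda>j. 2 * m + j) ` {..<r}. (F (torus_perms k r 2 i) - F i)\<^sup>2)"
        by (subst sum.reindex) (auto simp: inj_on_def)
      also have "\<dots> \<le> E 2" unfolding E_def by (rule sum_mono2) (auto simp: N)
      finally show ?thesis .
    qed
    ultimately show ?thesis by argo
  qed
  finally have tail: "(\<Sum>j<r. (F (2 * m + j) - a)\<^sup>2) \<le> 2 * E 2 + 2 * Y" .
  have "(\<Sum>j<N. (F j - a)\<^sup>2) = Y + (\<Sum>j<r. (F (2 * m + j) - a)\<^sup>2)"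
    unfolding N Y_def by (induction r) simp_all
  \<comment> \<open>The total is at most 3 Y + 2 E 2, and Y <= 3 X + 2 R, where X <= 144 E 0 + 144 E
    1 + 288 R. The largest coefficient is 2598, that of R.\<close>
  then have "(\<Sum>j<N. (F j - a)\<^sup>2) \<le> 2600 * (R + E 0 + E 1 + E 2)"
    using X Y tail nonneg(1) nonneg(2)[of 0] nonneg(2)[of 1] nonneg(2)[of 2] by argo
  then show ?thesis unfolding R_def E_def by blast
qed

lemma prism_energy_ge:
  fixes h :: "nat \<Rightarrow> nat \<Rightarrow> real"
  assumes nonneg: "\<And>u v. h u v \<ge> 0" and c: "c < 3"
    and \<rho>: "\<And>j. j < N \<Longrightarrow> \<rho> c j < N"
  shows "(\<Sum>j<N. h (3 * j + c) (3 * ((j + 1) mod N) + c)) \<le> (\<Sum>u<3 * N. \<Sum>v<3 * N. if prism_graph N \<rho> u v then h u v else 0)"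
    and "(\<Sum>j<N. h (3 * j + c) (3 * j + (c + 1) mod 3)) \<le> (\<Sum>u<3 * N. \<Sum>v<3 * N. if prism_graph N \<rho> u v then h u v else 0)"
    and "(\<Sum>j<N. h (3 * j + c) (3 * \<rho> c j + (c + 1) mod 3)) \<le> (\<Sum>u<3 * N. \<Sum>v<3 * N. if prism_graph N \<rho> u v then h u v else 0)"
proof -
  have inj: "inj_on (\<lambda>j. 3 * j + c) {..<N}" by (auto simp: inj_on_def)
  have arcD: "u < 3 * N \<and> v < 3 * N \<and> prism_graph N \<rho> u v" if "prism_arc N \<rho> u v" for u v
    using that by (auto simp: prism_graph_def prism_arc_def)
  show "(\<Sum>j<N. h (3 * j + c) (3 * ((j + 1) mod N) + c)) \<le> (\<Sum>u<3 * N. \<Sum>v<3 * N. if prism_graph N \<rho> u v then h u v else 0)"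
    using arcD[OF prism_arc_ring[OF _ c]] by (intro double_sum_ge_matching[OF _ inj _ nonneg]) auto
  show "(\<Sum>j<N. h (3 * j + c) (3 * j + (c + 1) mod 3)) \<le> (\<Sum>u<3 * N. \<Sum>v<3 * N. if prism_graph N \<rho> u v then h u v else 0)"
    using arcD[OF prism_arc_cross[of _ N c _ \<rho>, OF _ c _ disjI1[OF refl]]] by (intro double_sum_ge_matching[OF _ inj _ nonneg]) auto
  show "(\<Sum>j<N. h (3 * j + c) (3 * \<rho> c j + (c + 1) mod 3)) \<le> (\<Sum>u<3 * N. \<Sum>v<3 * N. if prism_graph N \<rho> u v then h u v else 0)"
    using arcD[OF prism_arc_cross[of _ N c "\<rho> c _" \<rho>, OF _ c \<rho> disjI2[OF refl]]] by (intro double_sum_ge_matching[OF _ inj _ nonneg]) auto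
qed

lemma sum_sq_le_sum_sq_shift:
  fixes f :: "nat \<Rightarrow> real"
  assumes "(\<Sum>u<n. f u) = 0"
  shows "(\<Sum>u<n. (f u)\<^sup>2) \<le> (\<Sum>u<n. (f u - a)\<^sup>2)"
proof -
  have "(\<Sum>u<n. (f u - a)\<^sup>2) = (\<Sum>u<n. (f u)\<^sup>2 - 2 * a * f u + a\<^sup>2)"
    by (rule sum.cong) (auto simp: power2_eq_square algebra_simps)
  also have "\<dots> = (\<Sum>u<n. (f u)\<^sup>2) - 2 * a * (\<Sum>u<n. f u) + real n * a\<^sup>2"
    by (simp add: sum.distrib sum_subtractf flip: sum_distrib_left)
  finally show ?thesis using assms by simp
qed

lemma prism_poincare:
  fixes f :: "nat \<Rightarrow> real"
  assumes k: "k > 0" and r: "1 \<le> r" "r \<le> 2 * (k * k)" and N: "N = 2 * (k * k) + r"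
    and zero: "(\<Sum>u<3 * N. f u) = 0"
  shows "(\<Sum>u<3 * N. (f u)\<^sup>2) \<le> 364004 * (\<Sum>u<3 * N. \<Sum>v<3 * N. if prism_graph N (torus_perms k r) u v then (f u - f v)\<^sup>2 else 0)"
proof -
  let ?\<rho> = "torus_perms k r"
  define E where "E = (\<Sum>u<3 * N. \<Sum>v<3 * N. if prism_graph N ?\<rho> u v then (f u - f v)\<^sup>2 else 0)"
  define F where "F = (\<lambda>j. f (3 * j))"
  have bij: "bij_betw (?\<rho> c) {..<N} {..<N}" for c using torus_perms_bij[OF k r(1)] by (simp add: N)
  then have lt: "?\<rho> c j < N" if "j < N" for c j using that by (auto simp: bij_betw_def)
  have "E \<ge> 0" by (auto simp: E_def intro!: sum_nonneg)
  note ge = prism_energy_ge[of "\<lambda>u v. (f u - f v)\<^sup>2" _ N ?\<rho>, folded E_def, OF zero_le_power2 _ lt]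
  have ring: "(\<Sum>j<N. (F ((j + 1) mod N) - F j)\<^sup>2) \<le> E"
    using ge(1)[of 0] by (simp add: F_def power2_commute)
  have col: "(\<Sum>j<N. (f (3 * j + c) - F j)\<^sup>2) \<le> E" if "c < 3" for c
  proof -
    have "c = 0 \<or> c = 1 \<or> c = 2" using that by linarith
    then show ?thesis
      using ge(2)[of 0] ge(2)[of 2] \<open>E \<ge> 0\<close> by (elim disjE) (simp_all add: F_def power2_commute)
  qed
  \<comment> \<open>A step of \<open>?\<rho> c\<close> between class-0 vertices is a path of three
    pieces: inside the triangle of \<open>j\<close> to class \<open>c\<close>, along the cross edge,
    and inside the other triangle back to class 0.\<close>
  have cross: "(\<Sum>j<N. (F (?\<rho> c j) - F j)\<^sup>2) \<le> 9 * E" if c: "c < 3" for c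
  proof -
    let ?d = "(c + 1) mod 3"
    have "(\<Sum>j<N. (F (?\<rho> c j) - F j)\<^sup>2) \<le> (\<Sum>j<N. 3 * (f (3 * ?\<rho> c j + ?d) - F (?\<rho> c j))\<^sup>2
       + 3 * (f (3 * j + c) - f (3 * ?\<rho> c j + ?d))\<^sup>2 + 3 * (f (3 * j + c) - F j)\<^sup>2)"
    proof (rule sum_mono)
      fix j
      show "(F (?\<rho> c j) - F j)\<^sup>2 \<le> 3 * (f (3 * ?\<rho> c j + ?d) - F (?\<rho> c j))\<^sup>2
       + 3 * (f (3 * j + c) - f (3 * ?\<rho> c j + ?d))\<^sup>2 + 3 * (f (3 * j + c) - F j)\<^sup>2"
        using sq_add3_le[of "- (f (3 * ?\<rho> c j + ?d) - F (?\<rho> c j))" "- (f (3 * j + c) - f (3 * ?\<rho> c j + ?d))" "f (3 * j + c) - F j"]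
        unfolding power2_minus by simp
    qed
    also have "\<dots> = 3 * (\<Sum>j<N. (f (3 * ?\<rho> c j + ?d) - F (?\<rho> c j))\<^sup>2) + 3 * (\<Sum>j<N. (f (3 * j + c) - f (3 * ?\<rho> c j + ?d))\<^sup>2)
       + 3 * (\<Sum>j<N. (f (3 * j + c) - F j)\<^sup>2)"
      by (simp add: sum.distrib sum_distrib_left)
    also have "(\<Sum>j<N. (f (3 * ?\<rho> c j + ?d) - F (?\<rho> c j))\<^sup>2) = (\<Sum>j<N. (f (3 * j + ?d) - F j)\<^sup>2)"
      by (rule sum.reindex_bij_betw[OF bij])
    finally show ?thesis using col[of ?d] col[OF c] ge(3)[OF c] by simp
  qed
  obtain a where "(\<Sum>j<N. (F j - a)\<^sup>2) \<le> 2600 * ((\<Sum>j<N. (F ((j + 1) mod N) - F j)\<^sup>2)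
     + (\<Sum>j<N. (F (?\<rho> 0 j) - F j)\<^sup>2) + (\<Sum>j<N. (F (?\<rho> 1 j) - F j)\<^sup>2) + (\<Sum>j<N. (F (?\<rho> 2 j) - F j)\<^sup>2))"
    using torus_perms_poincare[OF k r, of F] unfolding N by blast
  \<comment> \<open>72800 = 2600 * (1 + 3 * 9), from the ring and the three permutations.\<close>
  then have Fa: "(\<Sum>j<N. (F j - a)\<^sup>2) \<le> 72800 * E"
    using ring cross[of 0] cross[of 1] cross[of 2] by simp
  \<comment> \<open>Among all constants the mean, here 0, minimizes the sum of squared deviations,
    so the mean of \<open>F\<close> may stand in for it.\<close>
  have "(\<Sum>u<3 * N. (f u)\<^sup>2) \<le> (\<Sum>u<3 * N. (f u - a)\<^sup>2)"
    by (rule sum_sq_le_sum_sq_shift[OF zero])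
  also have "\<dots> \<le> (\<Sum>j<N. 5 * (F j - a)\<^sup>2 + 2 * (f (3 * j + 1) - F j)\<^sup>2 + 2 * (f (3 * j + 2) - F j)\<^sup>2)"
    unfolding sum_triples
  proof (rule sum_mono)
    fix j
    show "(f (3 * j) - a)\<^sup>2 + (f (3 * j + 1) - a)\<^sup>2 + (f (3 * j + 2) - a)\<^sup>2
       \<le> 5 * (F j - a)\<^sup>2 + 2 * (f (3 * j + 1) - F j)\<^sup>2 + 2 * (f (3 * j + 2) - F j)\<^sup>2"
      using sq_add_le[of "f (3 * j + 1) - F j" "F j - a"] sq_add_le[of "f (3 * j + 2) - F j" "F j - a"]
      by (simp add: F_def)
  qed
  also have "\<dots> = 5 * (\<Sum>j<N. (F j - a)\<^sup>2) + 2 * (\<Sum>j<N. (f (3 * j + 1) - F j)\<^sup>2) + 2 * (\<Sum>j<N. (f (3 * j + 2) - F j)\<^sup>2)"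
    by (simp add: sum.distrib sum_distrib_left)
  also have "\<dots> \<le> 364004 * E" using Fa col[of 1] col[of 2] by simp
  finally show ?thesis by (simp add: E_def)
qed

text \<open>Triangles are odd cycles, so no nonzero function alternates on them: (x + y) - (y + z) +
  (z + x) = 2 x bounds every value by the three edge sums.\<close>

lemma prism_triangle_bound:
  fixes f :: "nat \<Rightarrow> real"
  assumes lt: "\<And>c j. j < N \<Longrightarrow> \<rho> c j < N"
  shows "(\<Sum>u<3 * N. (f u)\<^sup>2) \<le> 27 / 4 * (\<Sum>u<3 * N. \<Sum>v<3 * N. if prism_graph N \<rho> u v then (f u + f v)\<^sup>2 else 0)"
proof -
  define E where "E = (\<Sum>u<3 * N. \<Sum>v<3 * N. if prism_graph N \<rho> u v then (f u + f v)\<^sup>2 else 0)"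
  note ge = prism_energy_ge(2)[of "\<lambda>u v. (f u + f v)\<^sup>2" _ N \<rho>, folded E_def, OF zero_le_power2 _ lt]
  have odd: "4 * x\<^sup>2 \<le> 3 * ((x + y)\<^sup>2 + (y + z)\<^sup>2 + (z + x)\<^sup>2)" for x y z :: real
  proof -
    have "x + y + - (y + z) + (z + x) = 2 * x" by simp
    then show ?thesis
      using sq_add3_le[of "x + y" "- (y + z)" "z + x"] unfolding power2_minus by (simp add: power_mult_distrib)
  qed
  have "4 * (\<Sum>u<3 * N. (f u)\<^sup>2) \<le> (\<Sum>j<N. 9 * (f (3 * j) + f (3 * j + 1))\<^sup>2 + 9 * (f (3 * j + 1) + f (3 * j + 2))\<^sup>2
        + 9 * (f (3 * j + 2) + f (3 * j))\<^sup>2)"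
    unfolding sum_triples sum_distrib_left
  proof (rule sum_mono)
    fix j
    show "4 * ((f (3 * j))\<^sup>2 + (f (3 * j + 1))\<^sup>2 + (f (3 * j + 2))\<^sup>2) \<le> 9 * (f (3 * j) + f (3 * j + 1))\<^sup>2
       + 9 * (f (3 * j + 1) + f (3 * j + 2))\<^sup>2 + 9 * (f (3 * j + 2) + f (3 * j))\<^sup>2"
      using odd[of "f (3 * j)" "f (3 * j + 1)" "f (3 * j + 2)"] odd[of "f (3 * j + 1)" "f (3 * j + 2)" "f (3 * j)"]
       odd[of "f (3 * j + 2)" "f (3 * j)" "f (3 * j + 1)"] by argo
  qed
  also have "\<dots> = 9 * (\<Sum>j<N. (f (3 * j) + f (3 * j + 1))\<^sup>2) + 9 * (\<Sum>j<N. (f (3 * j + 1) + f (3 * j + 2))\<^sup>2)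
     + 9 * (\<Sum>j<N. (f (3 * j + 2) + f (3 * j))\<^sup>2)"
    by (simp add: sum.distrib sum_distrib_left)
  also have "\<dots> \<le> 27 * E" using ge[of 0] ge[of 1] ge[of 2] by simp
  finally show ?thesis by (simp add: E_def)
qed

section \<open>Quadratic forms of the averaging operator\<close>

definition nb_avg :: "nat \<Rightarrow> nat \<Rightarrow> (nat \<Rightarrow> nat \<Rightarrow> bool) \<Rightarrow> (nat \<Rightarrow> real) \<Rightarrow> nat \<Rightarrow> real" where
  "nb_avg n d G f u = (\<Sum>v<n. if G u v then f v else 0) / real d"

lemma regular_graph_sum:
  assumes "regular_graph n d G" "u < n"
  shows "(\<Sum>v<n. if G u v then (c::real) else 0) = real d * c"
proof -
  have "{v \<in> {..<n}. G u v} = neighbours G u"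
    using assms by (auto simp: neighbours_def regular_graph_def simple_graph_def)
  then show ?thesis using assms by (simp add: sum.If_cases regular_graph_def Int_def)
qed

text \<open>The sign -1 gives the Laplacian and the sign 1 the signless Laplacian. Lower bounds for
  them bound the form of the averaging operator from above and from below.\<close>

lemma regular_graph_quadratic:
  assumes G: "regular_graph n d G" and d: "d > 0" and s: "s\<^sup>2 = (1::real)"
  shows "(\<Sum>u<n. \<Sum>v<n. if G u v then (f u + s * f v)\<^sup>2 else 0) =
     2 * d * (\<Sum>u<n. (f u)\<^sup>2) + 2 * d * s * (\<Sum>u<n. f u * nb_avg n d G f u)"
proof -
  have sym: "G u v = G v u" for u v using G by (auto simp: regular_graph_def simple_graph_def)
  have "(if G u v then (f u + s * f v)\<^sup>2 else 0) =
     (if G u v then (f u)\<^sup>2 else 0) + (if G v u then (f v)\<^sup>2 else 0) + 2 * s * (f u * (if G u v then f v else 0))" for u v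
    using s by (auto simp: sym[of v u] power2_eq_square algebra_simps)
  then have "(\<Sum>u<n. \<Sum>v<n. if G u v then (f u + s * f v)\<^sup>2 else 0) =
     (\<Sum>u<n. \<Sum>v<n. if G u v then (f u)\<^sup>2 else 0) + (\<Sum>u<n. \<Sum>v<n. if G v u then (f v)\<^sup>2 else 0)
      + 2 * s * (\<Sum>u<n. f u * (\<Sum>v<n. if G u v then f v else 0))"
    by (simp add: sum.distrib sum_distrib_left)
  also have "(\<Sum>u<n. \<Sum>v<n. if G v u then (f v)\<^sup>2 else 0) = (\<Sum>u<n. \<Sum>v<n. if G u v then (f u)\<^sup>2 else 0)"
    by (rule sum.swap)
  also have "(\<Sum>u<n. \<Sum>v<n. if G u v then (f u)\<^sup>2 else 0) = d * (\<Sum>u<n. (f u)\<^sup>2)"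
    unfolding sum_distrib_left by (intro sum.cong refl) (simp add: regular_graph_sum[OF G])
  also have "(\<Sum>u<n. f u * (\<Sum>v<n. if G u v then f v else 0)) = d * (\<Sum>u<n. f u * nb_avg n d G f u)"
    unfolding sum_distrib_left[of "real d"] using d by (intro sum.cong refl) (simp add: nb_avg_def)
  finally show ?thesis by (simp add: algebra_simps)
qed

text \<open>4368048 = 12 * 364004, where 12 is twice the degree. The triangle bound gives the better
  constant 1 - 1 / 81 on the negative side.\<close>

lemma prism_spectral_form:
  fixes f :: "nat \<Rightarrow> real"
  assumes k: "k > 0" and r: "2 \<le> r" "r \<le> 2 * (k * k)" and N: "N = 2 * (k * k) + r"
    and zero: "(\<Sum>u<3 * N. f u) = 0"
  shows "\<bar>\<Sum>u<3 * N. f u * nb_avg (3 * N) 6 (prism_graph N (torus_perms k r)) f u\<bar> \<le> (1 - 1 / 4368048) * (\<Sum>u<3 * N. (f u)\<^sup>2)"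
proof -
  let ?G = "prism_graph N (torus_perms k r)"
  have bij: "bij_betw (torus_perms k r c) {..<N} {..<N}" for c using torus_perms_bij[OF k, of r] r by (simp add: N)
  then have lt: "torus_perms k r c j < N" if "j < N" for c j using that by (auto simp: bij_betw_def)
  have "1 \<le> k * k" using k by simp
  then have G: "regular_graph (3 * N) 6 ?G"
    using r k by (intro prism_regular bij torus_perms_fixfree) (auto simp: N)
  have "(\<Sum>u<3 * N. (f u)\<^sup>2) \<le> 364004 * (12 * (\<Sum>u<3 * N. (f u)\<^sup>2) - 12 * (\<Sum>u<3 * N. f u * nb_avg (3 * N) 6 ?G f u))"
    using prism_poincare[OF k _ r(2) N zero] r(1) regular_graph_quadratic[OF G _ , of "-1" f] by (simp cong: if_cong)
  moreover have "(\<Sum>u<3 * N. (f u)\<^sup>2) \<le> 27/4 * (12 * (\<Sum>u<3 * N. (f u)\<^sup>2) + 12 * (\<Sum>u<3 * N. f u * nb_avg (3 * N) 6 ?G f u))"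
    using prism_triangle_bound[of N "torus_perms k r" f, OF lt] regular_graph_quadratic[OF G _ , of "1" f] by (simp cong: if_cong)
  moreover have "0 \<le> (\<Sum>u<3 * N. (f u)\<^sup>2)" by (intro sum_nonneg) auto
  ultimately show ?thesis by argo
qed

section \<open>Eigenvalues\<close>

text \<open>The matrix of \<open>a\<close> on the quotient by the constant vectors, an eigenvector of \<open>a\<close> when all rows sum to 1.\<close>

definition deflated :: "nat \<Rightarrow> (nat \<Rightarrow> nat \<Rightarrow> 'a) \<Rightarrow> 'a::field mat" where
  "deflated m a = mat m m (\<lambda>(i, j). a (Suc i) (Suc j) - a 0 (Suc j))"

text \<open>The transpose acts on the dual of the quotient by the constants, that is, on vectors of
  sum zero. An eigenvector of it is completed by the coordinate that makes the sum vanish, and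
  symmetry of \<open>a\<close> removes the transpose.\<close>

lemma deflated_eigenvector:
  fixes a :: "nat \<Rightarrow> nat \<Rightarrow> 'a::field"
  assumes sym: "\<And>i j. i \<le> m \<Longrightarrow> j \<le> m \<Longrightarrow> a i j = a j i"
    and row: "\<And>i. i \<le> m \<Longrightarrow> (\<Sum>j\<le>m. a i j) = 1"
    and root: "poly (char_poly (deflated m a)) \<mu> = 0"
  shows "\<exists>w. (\<exists>i\<le>m. w i \<noteq> 0) \<and> (\<Sum>i\<le>m. w i) = 0 \<and> (\<forall>i\<le>m. (\<Sum>j\<le>m. a i j * w j) = \<mu> * w i)"
proof -
  let ?M = "deflated m a"
  have M: "?M \<in> carrier_mat m m" by (simp add: deflated_def)
  then have MT: "?M\<^sup>T \<in> carrier_mat m m" by simp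
  have "eigenvalue ?M\<^sup>T \<mu>"
    using root by (simp add: eigenvalue_root_char_poly[OF MT] char_poly_transpose_mat[OF M])
  then obtain v where v: "v \<in> carrier_vec m" "v \<noteq> 0\<^sub>v m" and Mv: "?M\<^sup>T *\<^sub>v v = \<mu> \<cdot>\<^sub>v v"
    using MT by (auto simp: eigenvalue_def eigenvector_def)
  define w where "w = case_nat (- (\<Sum>i<m. v $ i)) (\<lambda>i. v $ i)"
  have sums: "(\<Sum>i\<le>m. h i) = h 0 + (\<Sum>i<m. h (Suc i))" for h :: "nat \<Rightarrow> 'a"
    by (simp add: sum.atMost_shift lessThan_Suc_atMost)
  have w0: "(\<Sum>i\<le>m. w i) = 0" unfolding sums by (simp add: w_def)
  obtain i where "i < m" "v $ i \<noteq> 0" using v by force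
  then have nz: "\<exists>i\<le>m. w i \<noteq> 0" by (intro exI[of _ "Suc i"]) (simp add: w_def)
  have ev_Suc: "(\<Sum>j\<le>m. a (Suc i) j * w j) = \<mu> * w (Suc i)" if "i < m" for i
  proof -
    have "(?M\<^sup>T *\<^sub>v v) $ i = (\<Sum>j<m. (a (Suc j) (Suc i) - a 0 (Suc i)) * v $ j)"
      using that v(1) by (simp add: scalar_prod_def deflated_def lessThan_atLeast0)
    then have "(\<Sum>j<m. (a (Suc j) (Suc i) - a 0 (Suc i)) * v $ j) = \<mu> * v $ i"
      unfolding Mv using that v(1) by simp
    moreover have "(\<Sum>j\<le>m. a (Suc i) j * w j) = (\<Sum>j<m. (a (Suc j) (Suc i) - a 0 (Suc i)) * v $ j)"
      unfolding sums using that
      by (simp add: w_def left_diff_distrib sum_subtractf sum_distrib_left sym[of "Suc i"])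
    ultimately show ?thesis by (simp add: w_def)
  qed
  \<comment> \<open>All coordinates of the image add up to 0 because the columns sum to 1, so the
    equation in coordinate 0 follows from the others.\<close>
  have "(\<Sum>i\<le>m. \<Sum>j\<le>m. a i j * w j) = (\<Sum>j\<le>m. (\<Sum>i\<le>m. a j i) * w j)"
    by (subst sum.swap) (auto simp: sum_distrib_right sym intro!: sum.cong)
  also have "\<dots> = 0" using w0 by (simp add: row)
  finally have "(\<Sum>j\<le>m. a 0 j * w j) + (\<Sum>i<m. \<mu> * w (Suc i)) = 0"
    unfolding sums[of "\<lambda>i. \<Sum>j\<le>m. a i j * w j"] using ev_Suc by simp
  then have "(\<Sum>j\<le>m. a 0 j * w j) = \<mu> * w 0"
    by (simp add: w_def flip: sum_distrib_left) (simp add: eq_neg_iff_add_eq_0)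
  then show ?thesis using w0 nz ev_Suc
    by (metis Suc_le_eq not0_implies_Suc)
qed

text \<open>Conjugation by \<open>S\<close>, whose first column is the all-ones eigenvector, makes
  the matrix block triangular with diagonal blocks 1 and \<open>deflated m a\<close>. One factor is
  split off, whatever the multiplicity of the root 1.\<close>

lemma char_poly_deflate:
  fixes a :: "nat \<Rightarrow> nat \<Rightarrow> 'a::field"
  assumes row: "\<And>i. i \<le> m \<Longrightarrow> (\<Sum>j\<le>m. a i j) = 1"
  shows "char_poly (mat (Suc m) (Suc m) (\<lambda>(i, j). a i j)) = [:-1, 1:] * char_poly (deflated m a)"
proof -
  let ?A = "mat (Suc m) (Suc m) (\<lambda>(i, j). a i j)"
  define u where "u = mat m (Suc 0) (\<lambda>_. 1 :: 'a)"
  define A2 where "A2 = mat (Suc 0) m (\<lambda>(i, j). a 0 (Suc j))"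
  let ?M = "deflated m a"
  have dims [simp]: "dim_row ?M = m" "dim_col ?M = m" by (simp_all add: deflated_def)
  define B where "B = four_block_mat (1\<^sub>m (Suc 0)) A2 (0\<^sub>m m (Suc 0)) ?M"
  define S where "S = four_block_mat (1\<^sub>m (Suc 0)) (0\<^sub>m (Suc 0) m) u (1\<^sub>m m)"
  define S' where "S' = four_block_mat (1\<^sub>m (Suc 0)) (0\<^sub>m (Suc 0) m) (- u) (1\<^sub>m m)"
  have c [simp]: "u \<in> carrier_mat m (Suc 0)" "A2 \<in> carrier_mat (Suc 0) m" "?M \<in> carrier_mat m m"
     "- u \<in> carrier_mat m (Suc 0)"
    by (simp_all add: u_def A2_def deflated_def)
  have sums: "(\<Sum>i\<le>m. h i) = h 0 + (\<Sum>i<m. h (Suc i))" for h :: "nat \<Rightarrow> 'a"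
    by (simp add: sum.atMost_shift lessThan_Suc_atMost)
  have one: "four_block_mat (1\<^sub>m (Suc 0)) (0\<^sub>m (Suc 0) m) (0\<^sub>m m (Suc 0)) (1\<^sub>m m) = (1\<^sub>m (Suc m) :: 'a mat)"
    by simp
  have SS': "S * S' = 1\<^sub>m (Suc m)"
    unfolding S_def S'_def one[symmetric]
    by (subst mult_four_block_mat[where ?n1.0 = "Suc 0" and ?n2.0 = m and ?nr1.0 = "Suc 0" and ?nr2.0 = m and ?nc1.0 = "Suc 0" and ?nc2.0 = m])
      (auto simp: u_def intro!: eq_matI)
  have S'S: "S' * S = 1\<^sub>m (Suc m)"
    unfolding S_def S'_def one[symmetric]
    by (subst mult_four_block_mat[where ?n1.0 = "Suc 0" and ?n2.0 = m and ?nr1.0 = "Suc 0" and ?nr2.0 = m and ?nc1.0 = "Suc 0" and ?nc2.0 = m])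
      (auto simp: u_def intro!: eq_matI)
  have SB: "S * B = four_block_mat (1\<^sub>m (Suc 0)) A2 u (u * A2 + ?M)"
    unfolding S_def B_def
    by (subst mult_four_block_mat[where ?n1.0 = "Suc 0" and ?n2.0 = m and ?nr1.0 = "Suc 0" and ?nr2.0 = m and ?nc1.0 = "Suc 0" and ?nc2.0 = m])
      (auto simp: u_def A2_def intro!: cong_four_block_mat)
  have "S * B * S' = four_block_mat (1\<^sub>m (Suc 0) + A2 * (- u)) A2 (u + (u * A2 + ?M) * (- u)) (u * A2 + ?M)"
    unfolding SB S'_def
    by (subst mult_four_block_mat[where ?n1.0 = "Suc 0" and ?n2.0 = m and ?nr1.0 = "Suc 0" and ?nr2.0 = m and ?nc1.0 = "Suc 0" and ?nc2.0 = m])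
      (auto simp: u_def A2_def intro!: cong_four_block_mat)
  also have "\<dots> = ?A"
  proof (rule eq_matI)
    fix i j assume "i < dim_row ?A" "j < dim_col ?A"
    then have ij: "i < Suc m" "j < Suc m" by auto
    have first: "1 - (\<Sum>j<m. a i (Suc j)) = a i 0" if "i \<le> m" for i
      using row[OF that] unfolding sums by (simp add: algebra_simps)
    show "four_block_mat (1\<^sub>m (Suc 0) + A2 * (- u)) A2 (u + (u * A2 + ?M) * (- u)) (u * A2 + ?M) $$ (i, j) = ?A $$ (i, j)"
      using ij first[of 0] first[of i]
      by (cases i; cases j) (auto simp: A2_def u_def deflated_def scalar_prod_def lessThan_atLeast0 sum_negf)
  qed (auto simp: A2_def u_def)
  finally have "?A = S * B * S'" by (rule sym)
  then have "similar_mat_wit ?A B S S'"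
    using SS' S'S by (intro similar_mat_witI[of _ _ "Suc m"]) (auto simp: S_def S'_def B_def u_def)
  then have "char_poly ?A = char_poly B" by (intro char_poly_similar) (auto simp: similar_mat_def)
  also have "\<dots> = char_poly (1\<^sub>m (Suc 0)) * char_poly ?M"
    unfolding B_def by (rule char_poly_four_block_zeros_col[unfolded One_nat_def]) auto
  also have "char_poly (1\<^sub>m (Suc 0) :: 'a mat) = [:-1, 1:]"
    by (simp add: char_poly_defs det_single)
  finally show ?thesis .
qed

text \<open>This keeps the set under \<open>Max\<close> nonempty. A complex root exists because the
  degree \<open>m\<close> is positive, and it is real because the Hermitian form of a real symmetric
  matrix is real.\<close>

lemma deflated_real_root:
  fixes a :: "nat \<Rightarrow> nat \<Rightarrow> real"
  assumes m: "m \<ge> 1" and sym: "\<And>i j. i \<le> m \<Longrightarrow> j \<le> m \<Longrightarrow> a i j = a j i"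
    and row: "\<And>i. i \<le> m \<Longrightarrow> (\<Sum>j\<le>m. a i j) = 1"
  shows "\<exists>\<mu>. poly (char_poly (deflated m a)) \<mu> = 0"
proof -
  let ?c = "\<lambda>i j. complex_of_real (a i j)"
  have M: "deflated m a \<in> carrier_mat m m" and Mc: "deflated m ?c \<in> carrier_mat m m"
    by (simp_all add: deflated_def)
  have map: "deflated m ?c = map_mat complex_of_real (deflated m a)"
    by (auto simp: deflated_def)

  have cp: "char_poly (deflated m ?c) = map_poly complex_of_real (char_poly (deflated m a))"
    unfolding map by (rule of_real_hom.char_poly_hom[OF M])
  have "\<not> constant (poly (char_poly (deflated m ?c)))"
    using degree_monic_char_poly[OF Mc] m by (simp add: constant_degree)
  then obtain \<mu> where \<mu>: "poly (char_poly (deflated m ?c)) \<mu> = 0"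
    using fundamental_theorem_of_algebra by blast
  have "(\<Sum>j\<le>m. ?c i j) = 1" if "i \<le> m" for i using row[OF that] by (simp flip: of_real_sum)
  then obtain w where w: "\<exists>i\<le>m. w i \<noteq> 0" and ev: "\<And>i. i \<le> m \<Longrightarrow> (\<Sum>j\<le>m. ?c i j * w j) = \<mu> * w i"
    using deflated_eigenvector[of m ?c \<mu>] \<mu> sym by auto
  define s where "s = (\<Sum>i\<le>m. (cmod (w i))\<^sup>2)"
  have "s > 0" unfolding s_def using w by (auto intro!: sum_pos2)
  define q where "q = (\<Sum>i\<le>m. \<Sum>j\<le>m. cnj (w i) * ?c i j * w j)"
  have "q = (\<Sum>i\<le>m. cnj (w i) * (\<mu> * w i))"
    unfolding q_def using ev by (simp add: mult.assoc flip: sum_distrib_left)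
  also have "\<dots> = \<mu> * complex_of_real s"
    unfolding s_def of_real_sum sum_distrib_left by (intro sum.cong refl) (simp add: complex_norm_square mult_ac del: of_real_power)
  finally have q: "q = \<mu> * complex_of_real s" .
  have "cnj q = (\<Sum>i\<le>m. \<Sum>j\<le>m. w i * ?c i j * cnj (w j))"
    by (simp add: q_def cnj_sum)
  also have "\<dots> = q" unfolding q_def
    by (subst sum.swap) (auto intro!: sum.cong simp: sym mult_ac)
  finally have "cnj \<mu> * complex_of_real s = \<mu> * complex_of_real s" unfolding q by simp
  then have "cnj \<mu> = \<mu>" using \<open>s > 0\<close> by simp
  then obtain x where x: "\<mu> = complex_of_real x"
    by (metis Reals_cases Reals_cnj_iff)
  have "poly (char_poly (deflated m a)) x = 0"
    using \<mu> unfolding cp x by (simp add: of_real_hom.poly_map_poly)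
  then show ?thesis by blast
qed

text \<open>Every root of the deflated factor is at most \<open>lam < 1\<close>. The split-off root
  1 therefore heads the descending list, and \<open>tl\<close> removes exactly this entry.\<close>

lemma second_eigenvalue_bound:
  fixes a :: "nat \<Rightarrow> nat \<Rightarrow> real"
  assumes m: "m \<ge> 1" and sym: "\<And>i j. i \<le> m \<Longrightarrow> j \<le> m \<Longrightarrow> a i j = a j i"
    and row: "\<And>i. i \<le> m \<Longrightarrow> (\<Sum>j\<le>m. a i j) = 1"
    and form: "\<And>w. (\<Sum>i\<le>m. w i) = 0 \<Longrightarrow> \<bar>\<Sum>i\<le>m. w i * (\<Sum>j\<le>m. a i j * w j)\<bar> \<le> lam * (\<Sum>i\<le>m. (w i)\<^sup>2)"
    and lam: "lam < 1"
  shows "Max (abs ` set (tl (eigenvalues_desc (mat (Suc m) (Suc m) (\<lambda>(i, j). a i j))))) \<le> lam"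
proof -
  let ?p = "char_poly (deflated m a)"
  have M: "deflated m a \<in> carrier_mat m m" by (simp add: deflated_def)
  have p0: "?p \<noteq> 0" using degree_monic_char_poly[OF M] by auto
  have roots: "proots (char_poly (mat (Suc m) (Suc m) (\<lambda>(i, j). a i j))) = {#1#} + proots ?p"
    using p0 by (simp add: char_poly_deflate[of m a, OF row] proots_mult del: mult_pCons_left)
  have bound: "\<bar>\<mu>\<bar> \<le> lam" if root: "\<mu> \<in># proots ?p" for \<mu>
  proof -
    have "poly ?p \<mu> = 0" using root p0 by simp
    then obtain w where w: "\<exists>i\<le>m. w i \<noteq> 0" "(\<Sum>i\<le>m. w i) = 0"
      and ev: "\<And>i. i \<le> m \<Longrightarrow> (\<Sum>j\<le>m. a i j * w j) = \<mu> * w i"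
      using deflated_eigenvector[of m a \<mu>] sym row by blast
    have pos: "(\<Sum>i\<le>m. (w i)\<^sup>2) > 0" using w(1) by (auto intro!: sum_pos2)
    have "(\<Sum>i\<le>m. w i * (\<Sum>j\<le>m. a i j * w j)) = \<mu> * (\<Sum>i\<le>m. (w i)\<^sup>2)"
      using ev by (simp add: sum_distrib_left power2_eq_square mult_ac)
    then have "\<bar>\<mu>\<bar> * (\<Sum>i\<le>m. (w i)\<^sup>2) \<le> lam * (\<Sum>i\<le>m. (w i)\<^sup>2)"
      using form[OF w(2)] pos by (simp add: abs_mult)
    then show ?thesis using pos by simp
  qed
  let ?L = "sorted_list_of_multiset (proots ?p)"
  have "sorted_list_of_multiset ({#1#} + proots ?p) = insort 1 ?L"
    by simp
  also have "\<dots> = ?L @ [1]"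
  proof (rule sorted_insort_is_snoc)
    show "sorted ?L" by simp
    show "\<forall>x\<in>set ?L. x \<le> 1" using bound lam by fastforce
  qed
  finally have "eigenvalues_desc (mat (Suc m) (Suc m) (\<lambda>(i, j). a i j)) = 1 # rev ?L"
    unfolding eigenvalues_desc_def roots by simp
  then have tl: "set (tl (eigenvalues_desc (mat (Suc m) (Suc m) (\<lambda>(i, j). a i j)))) = set_mset (proots ?p)"
    by simp
  obtain \<mu> where "poly ?p \<mu> = 0" using deflated_real_root[OF m sym row] by blast
  then have "\<mu> \<in># proots ?p" using p0 by simp
  then show ?thesis unfolding tl using bound by (subst Max_le_iff) auto
qed

section \<open>Hitting potentials\<close>

text \<open>A maximal separated set dominates: each element of \<open>V\<close> is related to a
  member, so the neighbourhoods of the members cover \<open>V\<close>.\<close>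

lemma ex_separated_subset:
  fixes V :: "nat set" and rel :: "nat \<Rightarrow> nat \<Rightarrow> bool"
  assumes fin: "finite V" and sym: "\<And>i j. rel i j = rel j i" and refl: "\<And>i. i \<in> V \<Longrightarrow> rel i i"
    and deg: "\<And>j. j \<in> V \<Longrightarrow> card {i \<in> V. rel i j} \<le> D"
  shows "\<exists>S\<subseteq>V. (\<forall>i\<in>S. \<forall>j\<in>S. i \<noteq> j \<longrightarrow> \<not> rel i j) \<and> card V \<le> D * card S"
proof -
  define \<S> where "\<S> = {S. S \<subseteq> V \<and> (\<forall>i\<in>S. \<forall>j\<in>S. i \<noteq> j \<longrightarrow> \<not> rel i j)}"
  have "finite \<S>" by (rule finite_subset[of _ "Pow V"]) (auto simp: \<S>_def fin)
  moreover have "{} \<in> \<S>" by (simp add: \<S>_def)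
  ultimately obtain S where S: "S \<in> \<S>" and max: "\<And>S'. S' \<in> \<S> \<Longrightarrow> S \<subseteq> S' \<Longrightarrow> S = S'"
    using finite_has_maximal[of \<S>] by blast
  have sub: "S \<subseteq> V" and sep: "\<forall>i\<in>S. \<forall>j\<in>S. i \<noteq> j \<longrightarrow> \<not> rel i j" using S by (auto simp: \<S>_def)
  have "V \<subseteq> (\<Union>j\<in>S. {i \<in> V. rel i j})"
  proof
    fix v assume v: "v \<in> V"
    show "v \<in> (\<Union>j\<in>S. {i \<in> V. rel i j})"
    proof (cases "v \<in> S")
      case True
      then show ?thesis using v refl by blast
    next
      case False
      then have "insert v S \<notin> \<S>" using max[of "insert v S"] by blast
      then obtain j where "j \<in> S" "rel v j" using v sub sep sym unfolding \<S>_def by blast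
      then show ?thesis using v by blast
    qed
  qed
  then have "card V \<le> card (\<Union>j\<in>S. {i \<in> V. rel i j})"
    by (intro card_mono) (use fin sub in \<open>auto intro: finite_subset\<close>)
  also have "\<dots> \<le> (\<Sum>j\<in>S. card {i \<in> V. rel i j})"
    by (intro card_UN_le finite_subset[OF sub fin])
  also have "\<dots> \<le> (\<Sum>j\<in>S. D)" by (intro sum_mono deg) (use sub in auto)
  finally show ?thesis using sub sep by (auto simp: mult.commute)
qed

section \<open>Iterates of the averaging operator under a spectral gap\<close>

locale spectral_gap_graph =
  fixes n d :: nat and G :: "nat \<Rightarrow> nat \<Rightarrow> bool" and lam :: real
  assumes regular: "regular_graph n d G" and d_pos: "d > 0"
    and lam: "0 < lam" "lam < 1"
    and form: "\<And>f. (\<Sum>u<n. f u) = 0 \<Longrightarrow> \<bar>\<Sum>u<n. f u * nb_avg n d G f u\<bar> \<le> lam * (\<Sum>u<n. (f u)\<^sup>2)"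
begin

abbreviation P :: "(nat \<Rightarrow> real) \<Rightarrow> nat \<Rightarrow> real" where "P \<equiv> nb_avg n d G"

lemma G_sym: "G u v = G v u" and G_less: "G u v \<Longrightarrow> u < n \<and> v < n"
  using regular by (auto simp: regular_graph_def simple_graph_def)

lemma P_cong: "(\<And>v. v < n \<Longrightarrow> f v = g v) \<Longrightarrow> P f u = P g u"
  unfolding nb_avg_def by (intro arg_cong2[of _ _ _ _ "(/)"] sum.cong refl) auto

lemma P_const: "u < n \<Longrightarrow> P (\<lambda>_. c) u = c"
  unfolding nb_avg_def using regular_graph_sum[OF regular] d_pos by simp

lemma P_add: "P (\<lambda>v. f v + g v) u = P f u + P g u"
proof -
  have "(\<Sum>v<n. if G u v then f v + g v else 0) = (\<Sum>v<n. (if G u v then f v else 0) + (if G u v then g v else 0))"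
    by (intro sum.cong) auto
  then show ?thesis by (simp add: nb_avg_def sum.distrib add_divide_distrib)
qed

lemma P_scale: "P (\<lambda>v. c * f v) u = c * P f u"
proof -
  have "(\<Sum>v<n. if G u v then c * f v else 0) = c * (\<Sum>v<n. if G u v then f v else 0)"
    unfolding sum_distrib_left by (intro sum.cong) auto
  then show ?thesis by (simp add: nb_avg_def)
qed

lemma P_sum: "P (\<lambda>v. \<Sum>t\<in>A. f t v) u = (\<Sum>t\<in>A. P (f t) u)"
proof (induction A rule: infinite_finite_induct)
  case (insert x F)
  then show ?case by (simp add: P_add)
qed (simp_all add: nb_avg_def)

lemma P_nonneg: "(\<And>v. v < n \<Longrightarrow> 0 \<le> f v) \<Longrightarrow> 0 \<le> P f u"
  unfolding nb_avg_def by (intro divide_nonneg_nonneg sum_nonneg) auto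

lemma P_adjoint: "(\<Sum>u<n. g u * P f u) = (\<Sum>u<n. P g u * f u)"
proof -
  have "(\<Sum>u<n. g u * P f u) = (\<Sum>u<n. \<Sum>v<n. if G u v then g u * f v / d else 0)"
    unfolding nb_avg_def sum_divide_distrib sum_distrib_left by (intro sum.cong refl) auto
  also have "\<dots> = (\<Sum>v<n. \<Sum>u<n. if G u v then g u * f v / d else 0)" by (rule sum.swap)
  also have "\<dots> = (\<Sum>u<n. P g u * f u)"
    unfolding nb_avg_def sum_divide_distrib sum_distrib_right by (intro sum.cong refl) (auto simp: G_sym)
  finally show ?thesis .
qed

lemma P_preserves_sum: "(\<Sum>u<n. P f u) = (\<Sum>u<n. f u)"
proof -
  have "(\<Sum>u<n. P (\<lambda>_. 1) u * f u) = (\<Sum>u<n. f u)" by (intro sum.cong) (simp_all add: P_const)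
  then show ?thesis using P_adjoint[of "\<lambda>_. 1" f] by simp
qed

text \<open>The operator norm of a self-adjoint map equals its numerical radius, by polarization
  applied to \<open>f \<plusminus> P f / lam\<close>.\<close>

lemma P_contraction:
  assumes zero: "(\<Sum>u<n. f u) = 0"
  shows "(\<Sum>u<n. (P f u)\<^sup>2) \<le> lam\<^sup>2 * (\<Sum>u<n. (f u)\<^sup>2)"
proof -
  define w where "w = P f"
  define s t where "s = (\<Sum>u<n. (f u)\<^sup>2)" and "t = (\<Sum>u<n. (w u)\<^sup>2)"
  define c where "c = 1 / lam"
  have c: "c > 0" "lam * c = 1" using lam by (auto simp: c_def)
  have w0: "(\<Sum>u<n. w u) = 0" using zero by (simp add: w_def P_preserves_sum)
  define a where "a = (\<Sum>u<n. f u * P f u)"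
  define b where "b = (\<Sum>u<n. w u * P w u)"
  have fw: "(\<Sum>u<n. w u * P f u) = t" "(\<Sum>u<n. f u * P w u) = t"
    using P_adjoint[of f w] by (auto simp: t_def w_def power2_eq_square)
  have expand: "(\<Sum>u<n. (f u + e * w u) * P (\<lambda>u. f u + e * w u) u) = a + 2 * e * t + e\<^sup>2 * b" for e
  proof -
    have "(\<Sum>u<n. (f u + e * w u) * P (\<lambda>u. f u + e * w u) u) =
      (\<Sum>u<n. f u * P f u + e * (f u * P w u) + e * (w u * P f u) + e\<^sup>2 * (w u * P w u))"
      by (intro sum.cong refl) (simp add: P_add P_scale power2_eq_square algebra_simps)
    also have "\<dots> = a + e * t + e * t + e\<^sup>2 * b"
      by (simp add: sum.distrib a_def b_def fw flip: sum_distrib_left)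
    finally show ?thesis by simp
  qed
  have norms: "(\<Sum>u<n. (f u + e * w u)\<^sup>2) = s + 2 * e * (\<Sum>u<n. f u * w u) + e\<^sup>2 * t" for e
  proof -
    have "(\<Sum>u<n. (f u + e * w u)\<^sup>2) = (\<Sum>u<n. (f u)\<^sup>2 + 2 * e * (f u * w u) + e\<^sup>2 * (w u)\<^sup>2)"
      by (intro sum.cong refl) (simp add: power2_eq_square algebra_simps)
    then show ?thesis by (simp add: sum.distrib s_def t_def flip: sum_distrib_left)
  qed
  have zero': "(\<Sum>u<n. f u + e * w u) = 0" for e
    using zero w0 by (simp add: sum.distrib flip: sum_distrib_left)
  have "4 * c * t \<le> lam * (2 * s + 2 * c\<^sup>2 * t)"
    using abs_le_D1[OF form[OF zero'[of c]]] abs_le_D2[OF form[OF zero'[of "- c"]]]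
    unfolding expand norms by (simp add: algebra_simps)
  also have "\<dots> = 2 * lam * s + 2 * c * t"
    using c(2) by (simp add: power2_eq_square algebra_simps)
  finally have "lam * (c * t) \<le> lam * (lam * s)" using lam by (intro mult_left_mono) auto
  also have "lam * (c * t) = t" using c(2) by (simp flip: mult.assoc)
  finally show ?thesis by (simp add: s_def t_def w_def power2_eq_square)
qed

lemma Pt_sum_zero:
  assumes "(\<Sum>u<n. f u) = 0"
  shows "(\<Sum>u<n. (P ^^ t) f u) = 0"
  by (induction t) (use assms in \<open>simp_all add: P_preserves_sum\<close>)

lemma Pt_contraction:
  assumes zero: "(\<Sum>u<n. f u) = 0"
  shows "(\<Sum>u<n. ((P ^^ t) f u)\<^sup>2) \<le> (lam ^ t)\<^sup>2 * (\<Sum>u<n. (f u)\<^sup>2)"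
proof (induction t)
  case (Suc t)
  have "(\<Sum>u<n. ((P ^^ Suc t) f u)\<^sup>2) \<le> lam\<^sup>2 * (\<Sum>u<n. ((P ^^ t) f u)\<^sup>2)"
    using P_contraction[OF Pt_sum_zero[OF zero]] by simp
  also have "\<dots> \<le> lam\<^sup>2 * ((lam ^ t)\<^sup>2 * (\<Sum>u<n. (f u)\<^sup>2))"
    by (intro mult_left_mono Suc.IH) auto
  finally show ?case by (simp add: power_mult_distrib)
qed simp

lemma Pt_pointwise:
  assumes zero: "(\<Sum>u<n. f u) = 0" and "u < n" and s: "(\<Sum>u<n. (f u)\<^sup>2) \<le> s\<^sup>2" "0 \<le> s"
  shows "\<bar>(P ^^ t) f u\<bar> \<le> lam ^ t * s"
proof -
  have "((P ^^ t) f u)\<^sup>2 \<le> (\<Sum>u<n. ((P ^^ t) f u)\<^sup>2)"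
    using assms by (intro member_le_sum[of u "{..<n}" "\<lambda>u. ((P ^^ t) f u)\<^sup>2"]) auto
  also have "\<dots> \<le> (lam ^ t)\<^sup>2 * (\<Sum>u<n. (f u)\<^sup>2)" by (rule Pt_contraction[OF zero])
  also have "\<dots> \<le> (lam ^ t)\<^sup>2 * s\<^sup>2" by (intro mult_left_mono s) auto
  finally have "((P ^^ t) f u)\<^sup>2 \<le> (lam ^ t * s)\<^sup>2" by (simp add: power_mult_distrib)
  then show ?thesis using s lam by (simp add: abs_le_square_iff[symmetric] abs_mult)
qed

lemma Pt_nonneg: "(\<And>v. 0 \<le> f v) \<Longrightarrow> 0 \<le> (P ^^ t) f u"
  by (induction t arbitrary: u) (auto intro: P_nonneg)

lemma Pt_diff_const: "u < n \<Longrightarrow> (P ^^ t) (\<lambda>v. f v - c) u = (P ^^ t) f u - c"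
proof (induction t arbitrary: u)
  case (Suc t)
  have "P ((P ^^ t) (\<lambda>v. f v - c)) u = P (\<lambda>v. (P ^^ t) f v + (- c)) u"
    by (rule P_cong) (simp add: Suc.IH)
  also have "\<dots> = P ((P ^^ t) f) u + P (\<lambda>_. - c) u" by (rule P_add)
  finally show ?case using P_const[OF Suc.prems, of "- c"] by simp
qed simp

lemma Pt_adjoint: "(\<Sum>u<n. g u * (P ^^ t) f u) = (\<Sum>u<n. (P ^^ t) g u * f u)"
proof (induction t arbitrary: f)
  case (Suc t)
  have "(\<Sum>u<n. g u * (P ^^ Suc t) f u) = (\<Sum>u<n. g u * (P ^^ t) (P f) u)"
    by (simp add: funpow_swap1)
  also have "\<dots> = (\<Sum>u<n. (P ^^ t) g u * P f u)" by (rule Suc.IH)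
  also have "\<dots> = (\<Sum>u<n. (P ^^ Suc t) g u * f u)" by (simp add: P_adjoint)
  finally show ?case .
qed simp

text \<open>One averaging step enlarges a support at most by the factor \<open>d\<close>. This
  bounds the number of triangles near a given one independently of \<open>n\<close>.\<close>

lemma Pt_support:
  assumes "card {x. x < n \<and> f x \<noteq> 0} \<le> s"
  shows "card {x. x < n \<and> (P ^^ t) f x \<noteq> 0} \<le> d ^ t * s"
proof (induction t)
  case (Suc t)
  let ?A = "{x. x < n \<and> (P ^^ t) f x \<noteq> 0}"
  have nb: "finite (neighbours G v)" "card (neighbours G v) = d" if "v < n" for v
  proof -
    show "card (neighbours G v) = d" using that regular by (simp add: regular_graph_def)
    then show "finite (neighbours G v)" using d_pos by (intro card_ge_0_finite) simp
  qed
  have "{x. x < n \<and> (P ^^ Suc t) f x \<noteq> 0} \<subseteq> (\<Union>v\<in>?A. neighbours G v)"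
  proof
    fix x assume x: "x \<in> {x. x < n \<and> (P ^^ Suc t) f x \<noteq> 0}"
    then have "(\<Sum>v<n. if G x v then (P ^^ t) f v else 0) \<noteq> 0"
      by (cases "(\<Sum>v<n. if G x v then (P ^^ t) f v else 0) = 0") (simp_all add: nb_avg_def)
    from sum.not_neutral_contains_not_neutral[OF this] obtain v
      where "v < n" "(if G x v then (P ^^ t) f v else 0) \<noteq> 0" by blast
    then have "G x v" "(P ^^ t) f v \<noteq> 0" by presburger+
    then have "x \<in> neighbours G v" using G_sym[of x v] by (simp add: neighbours_def)
    then show "x \<in> (\<Union>v\<in>?A. neighbours G v)" using \<open>v < n\<close> \<open>(P ^^ t) f v \<noteq> 0\<close> by blast
  qed
  then have "card {x. x < n \<and> (P ^^ Suc t) f x \<noteq> 0} \<le> card (\<Union>v\<in>?A. neighbours G v)"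
    by (intro card_mono finite_UN_I nb(1)) auto
  also have "\<dots> \<le> (\<Sum>v\<in>?A. card (neighbours G v))" by (intro card_UN_le) auto
  also have "\<dots> = (\<Sum>v\<in>?A. d)" using nb(2) by (intro sum.cong refl) blast
  also have "\<dots> = d * card ?A" by simp
  also have "\<dots> \<le> d * (d ^ t * s)" by (intro mult_left_mono Suc.IH) simp
  finally show ?case by simp
qed (use assms in simp)

text \<open>Up to an affine map, \<open>f\<close> is the truncated Green function \<open>\<Sum>\<^sub>t P\<^sup>t (1\<^sub>T - 3/n)\<close>,
  which approximates the expected hitting time of \<open>T\<close>.\<close>

lemma hitting_potential:
  assumes T: "T \<subseteq> {..<n}" "card T = 3"
    and L: "8 * lam ^ L \<le> 1 - lam" "12 * L \<le> n" "1 \<le> L"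
  defines "ind \<equiv> \<lambda>x. of_bool (x \<in> T) :: real"
  shows "\<exists>f. (\<forall>x\<in>T. f x \<le> 0) \<and> (\<forall>x<n. x \<notin> T \<longrightarrow> f x - 1 \<le> P f x)
     \<and> (\<forall>x<n. (\<forall>t<L. (P ^^ t) ind x = 0) \<longrightarrow> real n / 24 \<le> f x)"
proof -
  have n: "n > 0" using L by auto
  define u where "u = (\<lambda>x. ind x - 3 / real n)"
  have card: "(\<Sum>x<n. ind x) = 3"
    using T by (simp add: ind_def sum.If_cases of_bool_def Int_absorb1)
  have u0: "(\<Sum>x<n. u x) = 0" using n by (simp add: u_def sum_subtractf card)
  have "(\<Sum>x<n. (u x)\<^sup>2) = (\<Sum>x<n. ind x - 2 * (3 / real n) * ind x + (3 / real n)\<^sup>2)"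
    by (intro sum.cong refl) (auto simp: u_def ind_def power2_eq_square algebra_simps)
  also have "\<dots> = 3 - 2 * (3 / real n) * 3 + real n * (3 / real n)\<^sup>2"
    by (simp only: sum.distrib sum_subtractf sum_distrib_left[symmetric] card) simp
  also have "real n * (3 / real n)\<^sup>2 = 9 / real n" using n by (simp add: power2_eq_square)
  also have "3 - 2 * (3 / real n) * 3 + 9 / real n \<le> 2\<^sup>2"
  proof -
    have "0 \<le> 9 / real n" by simp
    then have "- 1 \<le> 9 / real n" by linarith
    then show ?thesis by simp
  qed
  finally have u2: "(\<Sum>x<n. (u x)\<^sup>2) \<le> 2\<^sup>2" .
  define a where "a = (\<lambda>t. (P ^^ t) u)"
  have a_bound: "\<bar>a t x\<bar> \<le> 2 * lam ^ t" if "x < n" for t x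
    using Pt_pointwise[OF u0 that u2, of t] by (simp add: a_def mult.commute)
  have a_ind: "a t x = (P ^^ t) ind x - 3 / real n" if "x < n" for t x
    using Pt_diff_const[OF that, of t ind "3 / real n"] by (simp add: a_def u_def)
  have ind_nonneg: "0 \<le> (P ^^ t) ind x" for t x by (rule Pt_nonneg) (simp add: ind_def)
  \<comment> \<open>Truncating at \<open>M\<close> leaves the remainder \<open>a M\<close>, of size
    at most 3 / n, the same as the constant subtracted in \<open>u\<close>. Adding \<open>L\<close>
    ensures that the sum can be split at \<open>L\<close>.\<close>
  obtain M0 where M0: "lam ^ M0 < 3 / (2 * real n)"
    using real_arch_pow_inv[of "3 / (2 * real n)" lam] lam n by auto
  define M where "M = M0 + L"
  have "lam ^ M \<le> lam ^ M0" using lam by (intro power_decreasing) (auto simp: M_def)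
  then have "lam ^ M \<le> 3 / (2 * real n)" using M0 by linarith
  then have M: "2 * lam ^ M \<le> 3 / real n" by simp
  define g where "g = (\<lambda>x. \<Sum>t<M. a t x)"
  have tail: "\<bar>\<Sum>t\<in>{L..<M}. a t x\<bar> \<le> 1 / 4" if "x < n" for x
  proof -
    have "\<bar>\<Sum>t\<in>{L..<M}. a t x\<bar> \<le> (\<Sum>t\<in>{L..<M}. 2 * lam ^ t)"
      by (rule order_trans[OF sum_abs]) (intro sum_mono a_bound that)
    also have "\<dots> = 2 * lam ^ L * (\<Sum>t<M0. lam ^ t)"
      using sum.shift_bounds_nat_ivl[of "\<lambda>t. 2 * lam ^ t" 0 L M0]
      by (simp add: M_def sum_distrib_left power_add mult_ac lessThan_atLeast0)
    also have "\<dots> \<le> 2 * lam ^ L * (1 / (1 - lam))"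
      using lam by (intro mult_left_mono) (auto simp: sum_gp_strict divide_right_mono)
    also have "\<dots> \<le> 1 / 4" using L lam by (simp add: field_simps)
    finally show ?thesis .
  qed
  have split: "g x = (\<Sum>t<L. a t x) + (\<Sum>t\<in>{L..<M}. a t x)" for x
    unfolding g_def M_def by (simp add: sum.atLeastLessThan_concat lessThan_atLeast0)
  \<comment> \<open>On \<open>T\<close> the first \<open>L\<close> terms of \<open>g\<close> give at
    least 1 - 1/4 and the tail at least -1/4, so \<open>g\<close> is at least 1/2; far from
    \<open>T\<close> it is at most 1/4. Off \<open>T\<close>, \<open>g - P g\<close> is at least -6
    / n, which the factor n / 6 normalizes to -1.\<close>
  define f where "f = (\<lambda>x. real n / 6 * (1 / 2 - g x))"
  have f1: "f x \<le> 0" if x: "x \<in> T" for x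
  proof -
    have xn: "x < n" using x T by auto
    have "(\<Sum>t<L. of_bool (t = 0) - 3 / real n) \<le> (\<Sum>t<L. a t x)"
      by (rule sum_mono) (use x ind_nonneg[of _ x] in \<open>auto simp: a_ind[OF xn] ind_def\<close>)
    moreover have "(\<Sum>t<L. of_bool (t = 0) - 3 / real n) = 1 - L * (3 / real n)"
      using L by (simp add: sum_subtractf of_bool_def)
    moreover have "L * (3 / real n) \<le> 1 / 4"
    proof -
      have "12 * real L \<le> real n" using L(2) by linarith
      then show ?thesis using n by (simp add: field_simps)
    qed
    ultimately have "1 / 2 \<le> g x" using tail[OF xn] unfolding split by linarith
    then show ?thesis unfolding f_def using n by (intro mult_nonneg_nonpos) auto
  qed
  have f2: "f x - 1 \<le> P f x" if x: "x < n" "x \<notin> T" for x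
  proof -
    have "P g x = (\<Sum>t<M. a (Suc t) x)" unfolding g_def P_sum by (simp add: a_def)
    then have "g x - P g x = (\<Sum>t<M. a t x - a (Suc t) x)" by (simp add: g_def sum_subtractf)
    also have "\<dots> = a 0 x - a M x" by (rule sum_lessThan_telescope')
    also have "a 0 x = - 3 / real n" using x by (simp add: a_def u_def ind_def)
    finally have "- 6 / real n \<le> g x - P g x" using a_bound[OF x(1), of M] M by (simp add: abs_le_iff)
    then have "real n / 6 * (- 6 / real n) \<le> real n / 6 * (g x - P g x)" by (intro mult_left_mono) auto
    moreover have "P f x = real n / 12 - real n / 6 * P g x"
    proof -
      have "P f x = P (\<lambda>v. real n / 12 + (- real n / 6) * g v) x" by (rule P_cong) (simp add: f_def algebra_simps)
      also have "\<dots> = P (\<lambda>_. real n / 12) x + (- real n / 6) * P g x" by (simp only: P_add P_scale)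
      finally show ?thesis using P_const[OF x(1), of "real n / 12"] by simp
    qed
    ultimately show ?thesis using n by (simp add: f_def algebra_simps)
  qed
  have f3: "real n / 24 \<le> f x" if x: "x < n" "\<forall>t<L. (P ^^ t) ind x = 0" for x
  proof -
    have "(\<Sum>t<L. a t x) \<le> 0" using x by (intro sum_nonpos) (simp add: a_ind)
    then have "g x \<le> 1 / 4" using tail[OF x(1)] unfolding split by linarith
    then have "real n / 6 * (1 / 4) \<le> f x" unfolding f_def by (intro mult_left_mono) auto
    then show ?thesis by simp
  qed
  show ?thesis by (intro exI[of _ f] conjI ballI allI impI) (rule f1 f2 f3; assumption)+
qed

text \<open>Triangles are called near if a walk of fewer than \<open>L\<close> steps can join them.\<close>

lemma separated_potentials:
  assumes n: "n = 3 * N" and L: "8 * lam ^ L \<le> 1 - lam" "12 * L \<le> n" "1 \<le> L"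
  shows "\<exists>S\<subseteq>{..<N}. N \<le> (\<Sum>t<L. d ^ t * 3) * card S \<and> (\<forall>j\<in>S. \<exists>f.
     (\<forall>x<n. x div 3 = j \<longrightarrow> f x \<le> 0) \<and> (\<forall>x<n. x div 3 \<noteq> j \<longrightarrow> f x - 1 \<le> P f x) \<and>
     (\<forall>x<n. x div 3 \<in> S \<and> x div 3 \<noteq> j \<longrightarrow> real n / 24 \<le> f x))"
proof -
  define ind where "ind = (\<lambda>j x. of_bool (x \<in> {x. x < n \<and> x div 3 = j}) :: real)"
  define near where "near = (\<lambda>i j. \<exists>t<L. \<exists>x<n. x div 3 = i \<and> (P ^^ t) (ind j) x \<noteq> 0)"
  have tri: "{x. x < n \<and> x div 3 = j} = {3 * j, 3 * j + 1, 3 * j + 2}" if "j < N" for j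
  proof -
    have "x div 3 = j \<longleftrightarrow> x = 3 * j \<or> x = 3 * j + 1 \<or> x = 3 * j + 2" for x by presburger
    then show ?thesis using that n by auto
  qed
  have ind_nonneg: "0 \<le> (P ^^ t) (ind j) x" for t j x by (rule Pt_nonneg) (simp add: ind_def)
  have ind_apply: "ind i x = (if x < n \<and> x div 3 = i then 1 else 0)" for i x by (simp add: ind_def)
  \<comment> \<open>All terms are nonnegative, so an inner product detects nearness;
    self-adjointness of \<open>P\<close> then makes the relation symmetric.\<close>
  have near_iff: "near i j \<longleftrightarrow> (\<exists>t<L. (\<Sum>x<n. ind i x * (P ^^ t) (ind j) x) \<noteq> 0)" for i j
  proof -
    have "(\<Sum>x<n. ind i x * (P ^^ t) (ind j) x) = 0 \<longleftrightarrow> (\<forall>x<n. x div 3 = i \<longrightarrow> (P ^^ t) (ind j) x = 0)" for t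
      by (subst sum_nonneg_eq_0_iff) (auto simp: ind_nonneg ind_apply)
    then show ?thesis unfolding near_def by blast
  qed
  have near_sym: "near i j = near j i" for i j
    unfolding near_iff using Pt_adjoint[of "ind i" _ "ind j"] by (simp add: mult.commute)
  have near_refl: "near i i" if "i < N" for i
    unfolding near_def using L(3) that by (intro exI[of _ 0] exI[of _ "3 * i"] conjI) (auto simp: ind_def n)
  have deg: "card {i \<in> {..<N}. near i j} \<le> (\<Sum>t<L. d ^ t * 3)" if j: "j < N" for j
  proof -
    have "card {x. x < n \<and> ind j x \<noteq> 0} \<le> 3"
    proof -
      have "{x. x < n \<and> ind j x \<noteq> 0} = {3 * j, 3 * j + 1, 3 * j + 2}"
        unfolding tri[OF j, symmetric] by (auto simp: ind_def)
      then show ?thesis by (simp add: card_insert_if)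
    qed
    then have supp: "card {x. x < n \<and> (P ^^ t) (ind j) x \<noteq> 0} \<le> d ^ t * 3" for t by (rule Pt_support)
    have "{i \<in> {..<N}. near i j} \<subseteq> (\<Union>t<L. (\<lambda>x. x div 3) ` {x. x < n \<and> (P ^^ t) (ind j) x \<noteq> 0})"
      unfolding near_def by blast
    then have "card {i \<in> {..<N}. near i j} \<le> card (\<Union>t<L. (\<lambda>x. x div 3) ` {x. x < n \<and> (P ^^ t) (ind j) x \<noteq> 0})"
      by (intro card_mono) auto
    also have "\<dots> \<le> (\<Sum>t<L. card ((\<lambda>x. x div 3) ` {x. x < n \<and> (P ^^ t) (ind j) x \<noteq> 0}))"
      by (intro card_UN_le) auto
    also have "\<dots> \<le> (\<Sum>t<L. d ^ t * 3)"
      by (intro sum_mono order_trans[OF card_image_le supp]) auto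
    finally show ?thesis .
  qed
  obtain S where S: "S \<subseteq> {..<N}" "\<forall>i\<in>S. \<forall>j\<in>S. i \<noteq> j \<longrightarrow> \<not> near i j" "card {..<N} \<le> (\<Sum>t<L. d ^ t * 3) * card S"
    using ex_separated_subset[of "{..<N}" near "\<Sum>t<L. d ^ t * 3"] near_sym near_refl deg by auto
  have "\<exists>f. (\<forall>x<n. x div 3 = j \<longrightarrow> f x \<le> 0) \<and> (\<forall>x<n. x div 3 \<noteq> j \<longrightarrow> f x - 1 \<le> P f x) \<and>
     (\<forall>x<n. x div 3 \<in> S \<and> x div 3 \<noteq> j \<longrightarrow> real n / 24 \<le> f x)" if j: "j \<in> S" for j
  proof -
    let ?T = "{x. x < n \<and> x div 3 = j}"
    have jN: "j < N" using j S(1) by blast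
    have T: "?T \<subseteq> {..<n}" "card ?T = 3" unfolding tri[OF jN] using jN n by auto
    obtain f where f: "\<And>x. x \<in> ?T \<Longrightarrow> f x \<le> 0" "\<And>x. x < n \<Longrightarrow> x \<notin> ?T \<Longrightarrow> f x - 1 \<le> P f x"
      "\<And>x. x < n \<Longrightarrow> (\<And>t. t < L \<Longrightarrow> (P ^^ t) (ind j) x = 0) \<Longrightarrow> real n / 24 \<le> f x"
      using hitting_potential[OF T L] unfolding ind_def by blast
    have "real n / 24 \<le> f x" if "x < n" "x div 3 \<in> S" "x div 3 \<noteq> j" for x
    proof (rule f(3)[OF that(1)])
      fix t assume "t < L"
      moreover have "\<not> near (x div 3) j" using S(2) that j by blast
      ultimately show "(P ^^ t) (ind j) x = 0" using that(1) unfolding near_def by blast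
    qed
    moreover have "f x \<le> 0" if "x < n" "x div 3 = j" for x using f(1) that by blast
    moreover have "f x - 1 \<le> P f x" if "x < n" "x div 3 \<noteq> j" for x using f(2) that by blast
    ultimately show ?thesis by (intro exI[of _ f] conjI allI impI) auto
  qed
  then have "\<forall>j\<in>S. \<exists>f. (\<forall>x<n. x div 3 = j \<longrightarrow> f x \<le> 0) \<and> (\<forall>x<n. x div 3 \<noteq> j \<longrightarrow> f x - 1 \<le> P f x) \<and>
     (\<forall>x<n. x div 3 \<in> S \<and> x div 3 \<noteq> j \<longrightarrow> real n / 24 \<le> f x)" by (rule ballI)
  moreover have "N \<le> (\<Sum>t<L. d ^ t * 3) * card S" using S(3) by (simp only: card_lessThan)
  ultimately show ?thesis using S(1) by (intro exI[of _ S] conjI)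
qed

end

section \<open>The greedy random walk\<close>

text \<open>The history is reversed so that the newest vertex comes first. The test looks at the
  history before the last step: the anchor moves exactly when that step was random.\<close>

fun anchor_rev :: "(nat \<Rightarrow> nat \<Rightarrow> bool) \<Rightarrow> nat list \<Rightarrow> nat" where
  "anchor_rev G [] = 0"
| "anchor_rev G [x] = x"
| "anchor_rev G (w # y # ys) = (if unused_edges G (rev (y # ys)) \<noteq> {} then anchor_rev G (y # ys) else w)"

text \<open>The anchors of all prefixes, hence the range of the underlying simple random walk.
  Vertices merely crossed in greedy phases are left out.\<close>

fun visited_rev :: "(nat \<Rightarrow> nat \<Rightarrow> bool) \<Rightarrow> nat list \<Rightarrow> nat set" where
  "visited_rev G [] = {}"
| "visited_rev G (w # ys) = insert (anchor_rev G (w # ys)) (visited_rev G ys)"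

text \<open>The anchor of a history is the vertex at which its current greedy phase started.
  Observed at its random steps, the walk of the anchors is a simple random walk.\<close>

definition anchor :: "(nat \<Rightarrow> nat \<Rightarrow> bool) \<Rightarrow> nat list \<Rightarrow> nat" where
  "anchor G h = anchor_rev G (rev h)"

definition visited :: "(nat \<Rightarrow> nat \<Rightarrow> bool) \<Rightarrow> nat list \<Rightarrow> nat set" where
  "visited G h = visited_rev G (rev h)"

lemma anchor_single [simp]: "anchor G [x] = x"
  by (simp add: anchor_def)

lemma anchor_snoc:
  assumes "h \<noteq> []"
  shows "anchor G (h @ [w]) = (if unused_edges G h \<noteq> {} then anchor G h else w)"
proof -
  obtain y ys where y: "rev h = y # ys" using assms by (metis list.exhaust rev_is_Nil_conv)
  then have h: "rev (y # ys) = h" by (metis rev_rev_ident)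
  have "anchor G (h @ [w]) = anchor_rev G (w # y # ys)" by (simp add: anchor_def y)
  also have "\<dots> = (if unused_edges G (rev (y # ys)) \<noteq> {} then anchor_rev G (y # ys) else w)"
    by (rule anchor_rev.simps)
  finally show ?thesis unfolding h unfolding anchor_def y .
qed

lemma visited_single [simp]: "visited G [x] = {x}"
  by (simp add: visited_def)

lemma visited_snoc: "visited G (h @ [w]) = insert (anchor G (h @ [w])) (visited G h)"
  by (simp add: visited_def anchor_def)

lemma hist_edges_single [simp]: "hist_edges [x] = {}"
  by (auto simp: hist_edges_def)

lemma hist_edges_snoc:
  assumes "h \<noteq> []"
  shows "hist_edges (h @ [w]) = insert {last h, w} (hist_edges h)"
proof -
  have L: "length h > 0" using assms by simp
  show ?thesis
  proof (rule Set.set_eqI, rule iffI)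
    fix e assume "e \<in> hist_edges (h @ [w])"
    then obtain s where s: "e = {(h @ [w]) ! (s - 1), (h @ [w]) ! s}" "0 < s" "s < length h + 1"
      by (auto simp: hist_edges_def)
    show "e \<in> insert {last h, w} (hist_edges h)"
    proof (cases "s = length h")
      case True
      then show ?thesis using s L assms by (simp add: nth_append last_conv_nth)
    next
      case False
      then have "s - 1 < length h" "s < length h" using s by simp_all
      then have "e = {h ! (s - 1), h ! s}" "s < length h" using s(1) by (simp_all add: nth_append)
      then show ?thesis using s(2) unfolding hist_edges_def by blast
    qed
  next
    fix e assume "e \<in> insert {last h, w} (hist_edges h)"
    then consider "e = {last h, w}" | s where "e = {h ! (s - 1), h ! s}" "0 < s" "s < length h"
      by (auto simp: hist_edges_def)
    then show "e \<in> hist_edges (h @ [w])"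
    proof cases
      case 1
      then have "e = {(h @ [w]) ! (length h - 1), (h @ [w]) ! length h}"
        using L assms by (simp add: nth_append last_conv_nth)
      then show ?thesis using L unfolding hist_edges_def by force
    next
      case 2
      then have "s - 1 < length h" by simp
      then have "e = {(h @ [w]) ! (s - 1), (h @ [w]) ! s}" using 2 by (simp add: nth_append)
      then show ?thesis using 2 unfolding hist_edges_def by force
    qed
  qed
qed

definition unused_degree :: "nat set set \<Rightarrow> nat list \<Rightarrow> nat \<Rightarrow> nat" where
  "unused_degree F h v = card {e \<in> F. v \<in> e \<and> e \<notin> hist_edges h}"

lemma unused_degree_snoc_same:
  assumes "h \<noteq> []" "{last h, w} \<notin> F \<or> {last h, w} \<in> hist_edges h"
  shows "unused_degree F (h @ [w]) v = unused_degree F h v"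
  unfolding unused_degree_def hist_edges_snoc[OF assms(1)]
  using assms(2) by (intro arg_cong[of _ _ card]) blast

lemma unused_degree_snoc_flip:
  assumes "finite F" "h \<noteq> []" "{last h, w} \<in> F" "{last h, w} \<notin> hist_edges h"
  shows "odd (unused_degree F (h @ [w]) v) = (odd (unused_degree F h v) \<noteq> (v = last h \<or> v = w))"
proof (cases "v = last h \<or> v = w")
  case True
  let ?A = "{e \<in> F. v \<in> e \<and> e \<notin> hist_edges h}"
  have "{e \<in> F. v \<in> e \<and> e \<notin> hist_edges (h @ [w])} = ?A - {{last h, w}}"
    unfolding hist_edges_snoc[OF assms(2)] by blast
  moreover have "card ?A = Suc (card (?A - {{last h, w}}))"
    by (rule card.remove) (use True assms in auto)
  ultimately have "unused_degree F h v = Suc (unused_degree F (h @ [w]) v)"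
    unfolding unused_degree_def by (simp only:)
  then show ?thesis using True by simp
next
  case False
  then have "{e \<in> F. v \<in> e \<and> e \<notin> hist_edges (h @ [w])} = {e \<in> F. v \<in> e \<and> e \<notin> hist_edges h}"
    unfolding hist_edges_snoc[OF assms(2)] by blast
  then show ?thesis using False by (simp add: unused_degree_def)
qed

definition odd_ends :: "nat set set \<Rightarrow> nat list \<Rightarrow> nat \<Rightarrow> nat \<Rightarrow> bool" where
  "odd_ends F h x y \<longleftrightarrow> (\<forall>v. odd (unused_degree F h v) = ((v = x) \<noteq> (v = y)))"

lemma odd_endsD: "odd_ends F h x y \<Longrightarrow> odd (unused_degree F h v) = ((v = x) \<noteq> (v = y))"
  unfolding odd_ends_def by (rule spec)

lemma odd_endsI: "(\<And>v. odd (unused_degree F h v) = ((v = x) \<noteq> (v = y))) \<Longrightarrow> odd_ends F h x y"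
  unfolding odd_ends_def by (rule allI)

text \<open>A trail can only get stuck where it is closed, because 0 is even.\<close>

lemma odd_ends_zero:
  assumes "odd_ends F h x y" "unused_degree F h x = 0"
  shows "x = y"
proof -
  have "\<not> odd (unused_degree F h x)" unfolding assms(2) by simp
  then have "\<not> ((x = x) \<noteq> (x = y))" unfolding odd_endsD[OF assms(1)] .
  then show ?thesis by simp
qed

lemma odd_ends_snoc_same:
  assumes "odd_ends F h x y" "h \<noteq> []" "{last h, w} \<notin> F \<or> {last h, w} \<in> hist_edges h"
  shows "odd_ends F (h @ [w]) x y"
  using assms(1) unfolding odd_ends_def unused_degree_snoc_same[OF assms(2,3)] .

lemma odd_ends_snoc_fst:
  assumes "odd_ends F h (last h) y" "finite F" "h \<noteq> []" "{last h, w} \<in> F" "{last h, w} \<notin> hist_edges h" "w \<noteq> last h"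
  shows "odd_ends F (h @ [w]) w y"
proof (rule odd_endsI)
  fix v
  show "odd (unused_degree F (h @ [w]) v) = ((v = w) \<noteq> (v = y))"
    unfolding unused_degree_snoc_flip[OF assms(2-5)] odd_endsD[OF assms(1)] using assms(6) by metis
qed

text \<open>A closed trail leaves no odd vertex, so its base point can be moved anywhere.\<close>

lemma odd_ends_refl:
  assumes "odd_ends F h x x" shows "odd_ends F h y y"
  using assms unfolding odd_ends_def by simp

section \<open>The rule that saves triangle edges for last\<close>

definition tri_edges :: "(nat \<Rightarrow> nat \<Rightarrow> bool) \<Rightarrow> nat set set" where
  "tri_edges G = {{u, v} | u v. G u v \<and> u div 3 = v div 3}"

definition lazy_rule :: "(nat \<Rightarrow> nat \<Rightarrow> bool) \<Rightarrow> nat list \<Rightarrow> nat pmf" where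
  "lazy_rule G h = return_pmf
     (if \<exists>w. {last h, w} \<in> unused_edges G h - tri_edges G then SOME w. {last h, w} \<in> unused_edges G h - tri_edges G
      else SOME w. {last h, w} \<in> unused_edges G h)"

lemma unused_edges_obtain:
  assumes "unused_edges G h \<noteq> {}"
  obtains w where "{last h, w} \<in> unused_edges G h"
proof -
  obtain e where e: "e \<in> unused_edges G h" using assms by blast
  then obtain u v where "e = {u, v}" "last h \<in> e" by (auto simp: unused_edges_def edge_set_def)
  then have "e = {last h, u} \<or> e = {last h, v}" by blast
  then show ?thesis using e that by blast
qed

lemma lazy_rule_choice:
  assumes "unused_edges G h \<noteq> {}"
  obtains w where "lazy_rule G h = return_pmf w" "{last h, w} \<in> unused_edges G h"
    "{last h, w} \<in> tri_edges G \<Longrightarrow> (\<forall>w'. {last h, w'} \<in> unused_edges G h \<longrightarrow> {last h, w'} \<in> tri_edges G)"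
proof (cases "\<exists>w. {last h, w} \<in> unused_edges G h - tri_edges G")
  case True
  define w where "w = (SOME w. {last h, w} \<in> unused_edges G h - tri_edges G)"
  have "{last h, w} \<in> unused_edges G h - tri_edges G" unfolding w_def using True by (rule someI_ex)
  moreover have "lazy_rule G h = return_pmf w" using True by (simp only: lazy_rule_def if_True w_def)
  ultimately show ?thesis using that[of w] by blast
next
  case False
  define w where "w = (SOME w. {last h, w} \<in> unused_edges G h)"
  obtain w' where "{last h, w'} \<in> unused_edges G h" using unused_edges_obtain[OF assms] .
  then have "{last h, w} \<in> unused_edges G h" unfolding w_def by (rule someI)
  moreover have "lazy_rule G h = return_pmf w" using False by (simp only: lazy_rule_def if_False w_def)
  ultimately show ?thesis using that[of w] False by blast
qed

lemma lazy_rule_valid: "valid_rule G (lazy_rule G)"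
  unfolding valid_rule_def
proof (intro allI impI)
  fix h assume "h \<noteq> []" "unused_edges G h \<noteq> {}"
  then show "set_pmf (lazy_rule G h) \<subseteq> {w. {last h, w} \<in> unused_edges G h}"
    by (elim lazy_rule_choice) simp
qed

section \<open>The invariant of the greedy walk\<close>

locale triangle_graph =
  fixes n d N :: nat and G :: "nat \<Rightarrow> nat \<Rightarrow> bool"
  assumes regular: "regular_graph n d G" and d: "even d" "d > 0" and n: "n = 3 * N"
    and triangles: "\<And>u v. u < n \<Longrightarrow> v < n \<Longrightarrow> u \<noteq> v \<Longrightarrow> u div 3 = v div 3 \<Longrightarrow> G u v"
begin

lemma G_sym: "G u v \<Longrightarrow> G v u" and G_irrefl: "\<not> G u u" and G_less: "G u v \<Longrightarrow> u < n \<and> v < n"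
  using regular by (auto simp: regular_graph_def simple_graph_def)

lemma edge_iff: "{u, v} \<in> edge_set G \<longleftrightarrow> G u v"
  unfolding edge_set_def by (auto simp: doubleton_eq_iff intro: G_sym)

lemma tri_edge_iff: "{u, v} \<in> tri_edges G \<longleftrightarrow> G u v \<and> u div 3 = v div 3"
  unfolding tri_edges_def by (auto simp: doubleton_eq_iff intro: G_sym)

lemma tri_edges_sub: "tri_edges G \<subseteq> edge_set G"
  by (auto simp: tri_edges_def edge_set_def)

lemma finite_edges: "finite (edge_set G)" "finite (tri_edges G)"
proof -
  have "edge_set G \<subseteq> Pow {..<n}" using G_less by (auto simp: edge_set_def)
  then show "finite (edge_set G)" by (rule finite_subset) simp
  then show "finite (tri_edges G)" using tri_edges_sub finite_subset by blast
qed

lemma card_edges_at: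
  "card {e \<in> {{u, v} | u v. G u v \<and> Q u v}. x \<in> e} = card {y. G x y \<and> Q x y}"
  if sym: "\<And>u v. Q u v \<Longrightarrow> Q v u"
proof -
  have "{e \<in> {{u, v} | u v. G u v \<and> Q u v}. x \<in> e} = (\<lambda>y. {x, y}) ` {y. G x y \<and> Q x y}"
    using sym G_sym by (auto simp: image_iff)
  moreover have "inj_on (\<lambda>y. {x, y}) {y. G x y \<and> Q x y}"
    by (auto simp: inj_on_def doubleton_eq_iff)
  ultimately show ?thesis by (simp add: card_image)
qed

lemma card_edge_set_at: "x < n \<Longrightarrow> card {e \<in> edge_set G. x \<in> e} = d"
  using card_edges_at[of "\<lambda>_ _. True" x] regular
  by (simp add: edge_set_def regular_graph_def neighbours_def)

lemma card_tri_edges_at: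
  assumes "x < n"
  shows "card {e \<in> tri_edges G. x \<in> e} = 2"
proof -
  define j where "j = x div 3"
  have "j < N" using assms n by (simp add: j_def)
  then have j: "3 * j + 2 < n" using n by linarith
  have div_iff: "y div 3 = j \<longleftrightarrow> y = 3 * j \<or> y = 3 * j + 1 \<or> y = 3 * j + 2" for y by presburger
  have "{y. G x y \<and> x div 3 = y div 3} = {y. y div 3 = j} - {x}"
  proof (rule Set.set_eqI, rule iffI)
    fix y assume "y \<in> {y. G x y \<and> x div 3 = y div 3}"
    then have "G x y" "x div 3 = y div 3" by simp_all
    then have "y div 3 = j" "y \<noteq> x" using G_irrefl[of x] by (auto simp only: j_def)
    then show "y \<in> {y. y div 3 = j} - {x}" by simp
  next
    fix y assume y: "y \<in> {y. y div 3 = j} - {x}"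
    then have "y div 3 = j" "x \<noteq> y" by auto
    moreover then have "y < n" using div_iff[of y] j by linarith
    ultimately show "y \<in> {y. G x y \<and> x div 3 = y div 3}" using triangles[OF assms, of y] j_def by simp
  qed
  also have "{y. y div 3 = j} = {3 * j, 3 * j + 1, 3 * j + 2}" using div_iff by blast
  finally have eq: "{y. G x y \<and> x div 3 = y div 3} = {3 * j, 3 * j + 1, 3 * j + 2} - {x}" .
  have "x \<in> {3 * j, 3 * j + 1, 3 * j + 2}" using div_iff[of x] j_def by blast
  then have "card {y. G x y \<and> x div 3 = y div 3} = 2" unfolding eq by (subst card_Diff_singleton) simp_all
  then show ?thesis using card_edges_at[of "\<lambda>u v. u div 3 = v div 3" x] by (simp add: tri_edges_def)
qed

text \<open>The used edges outside the triangles form closed trails and a trail from \<open>z\<close> to \<open>last h\<close>; the used triangle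
  edges form closed trails and a trail from the anchor to \<open>z\<close>. The unused degrees record this through their parity.\<close>

definition walk_ends :: "nat list \<Rightarrow> nat \<Rightarrow> bool" where
  "walk_ends h z \<longleftrightarrow> z div 3 = anchor G h div 3 \<and> odd_ends (edge_set G - tri_edges G) h (last h) z \<and>
     odd_ends (tri_edges G) h z (anchor G h)"

text \<open>This links edges to anchors: once all edges are used, every triangle contains an
  anchor.\<close>

definition tri_visited :: "nat list \<Rightarrow> bool" where
  "tri_visited h \<longleftrightarrow> (\<forall>e \<in> tri_edges G. e \<in> hist_edges h \<longrightarrow> (\<exists>v\<in>visited G h. \<forall>u\<in>e. u div 3 = v div 3))"

definition walk_inv :: "nat list \<Rightarrow> bool" where
  "walk_inv h \<longleftrightarrow> h \<noteq> [] \<and> last h < n \<and> anchor G h \<in> visited G h \<and> visited G h \<subseteq> {..<n} \<and>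
     (\<exists>z. walk_ends h z) \<and> tri_visited h"

lemma walk_invI:
  assumes "h \<noteq> []" "last h < n" "anchor G h \<in> visited G h" "visited G h \<subseteq> {..<n}"
    and "z div 3 = anchor G h div 3" "odd_ends (edge_set G - tri_edges G) h (last h) z" "odd_ends (tri_edges G) h z (anchor G h)"
    and "tri_visited h"
  shows "walk_inv h"
  unfolding walk_inv_def walk_ends_def by (intro conjI exI[of _ z] assms)

text \<open>Every vertex has degree 2 in the triangles and \<open>d - 2\<close> in the other edges.
  Both are even, so both trails start closed at \<open>v0\<close>.\<close>

lemma walk_inv_init:
  assumes "v0 < n" shows "walk_inv [v0]"
proof -
  have lt: "x < n" if "e \<in> edge_set G" "x \<in> e" for e x
  proof -
    have "\<exists>u v. e = {u, v} \<and> G u v" using that(1) by (simp add: edge_set_def)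
    then obtain u v where "e = {u, v}" "G u v" by (elim exE conjE)
    then show ?thesis using that(2) G_less[of u v] by auto
  qed
  have tri: "even (unused_degree (tri_edges G) [v0] v)" for v
  proof (cases "v < n")
    case True
    show ?thesis unfolding unused_degree_def hist_edges_single using card_tri_edges_at[OF True] by simp
  next
    case False
    then have "{e \<in> tri_edges G. v \<in> e \<and> e \<notin> hist_edges [v0]} = {}" using lt tri_edges_sub by blast
    then show ?thesis unfolding unused_degree_def by (simp only: card.empty even_zero)
  qed
  have "even (unused_degree (edge_set G - tri_edges G) [v0] v)" for v
  proof (cases "v < n")
    case True
    have eq: "{e \<in> edge_set G - tri_edges G. v \<in> e} = {e \<in> edge_set G. v \<in> e} - {e \<in> tri_edges G. v \<in> e}" by blast
    have "card {e \<in> edge_set G - tri_edges G. v \<in> e} = card {e \<in> edge_set G. v \<in> e} - card {e \<in> tri_edges G. v \<in> e}"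
      unfolding eq
    proof (rule card_Diff_subset)
      show "finite {e \<in> tri_edges G. v \<in> e}" using finite_edges(2) by simp
      show "{e \<in> tri_edges G. v \<in> e} \<subseteq> {e \<in> edge_set G. v \<in> e}" using tri_edges_sub by blast
    qed
    also have "\<dots> = d - 2" unfolding card_edge_set_at[OF True] card_tri_edges_at[OF True] ..
    finally have "card {e \<in> edge_set G - tri_edges G. v \<in> e} = d - 2" .
    moreover have "even (d - 2)" using d(1) by simp
    ultimately show ?thesis unfolding unused_degree_def hist_edges_single by simp
  next
    case False
    then have "{e \<in> edge_set G - tri_edges G. v \<in> e \<and> e \<notin> hist_edges [v0]} = {}" using lt by blast
    then show ?thesis unfolding unused_degree_def by (simp only: card.empty even_zero)
  qed
  then have other: "odd_ends (edge_set G - tri_edges G) [v0] v0 v0" unfolding odd_ends_def by simp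
  have tri': "odd_ends (tri_edges G) [v0] v0 v0" using tri unfolding odd_ends_def by simp
  show ?thesis
    by (rule walk_invI[where z = v0]) (use assms other tri' in \<open>simp_all add: tri_visited_def\<close>)
qed

lemma unused_degree_last_zero:
  assumes "unused_edges G h = {}" "F \<subseteq> edge_set G"
  shows "unused_degree F h (last h) = 0"
proof -
  have "{e \<in> F. last h \<in> e \<and> e \<notin> hist_edges h} \<subseteq> unused_edges G h"
    using assms(2) unfolding unused_edges_def by (intro subsetI CollectI) (simp add: subset_iff)
  then have "{e \<in> F. last h \<in> e \<and> e \<notin> hist_edges h} = {}" unfolding assms(1) by (rule subset_empty[THEN iffD1])
  then show ?thesis unfolding unused_degree_def by (simp only: card.empty)
qed

text \<open>Parity is used twice: the trail outside the triangles is stuck at \<open>last h\<close>,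
  so it closes at \<open>z\<close>; then the triangle trail is stuck at \<open>z\<close>, so it
  closes at the anchor.\<close>

lemma walk_inv_no_unused:
  assumes inv: "walk_inv h" and none: "unused_edges G h = {}"
  shows "last h = anchor G h"
proof -
  obtain z where z: "walk_ends h z" using inv unfolding walk_inv_def by (elim conjE exE)
  have "last h = z"
    by (rule odd_ends_zero[OF _ unused_degree_last_zero[OF none Diff_subset]])
      (use z in \<open>unfold walk_ends_def, elim conjE\<close>)
  moreover from this have "unused_degree (tri_edges G) h z = 0"
    using unused_degree_last_zero[OF none tri_edges_sub] by (simp only:)
  then have "z = anchor G h"
    by (rule odd_ends_zero[rotated]) (use z in \<open>unfold walk_ends_def, elim conjE\<close>)
  ultimately show ?thesis by (rule trans)
qed

lemma neighbours_finite: "v < n \<Longrightarrow> finite (neighbours G v) \<and> neighbours G v \<noteq> {}"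
  using regular d(2) card_gt_0_iff[of "neighbours G v"] by (simp add: regular_graph_def)

lemma walk_inv_step:
  assumes inv: "walk_inv h" and w: "w \<in> set_pmf (grw_step G (lazy_rule G) h)"
  shows "walk_inv (h @ [w])"
proof -
  let ?H = "edge_set G - tri_edges G"
  have fin: "finite ?H" "finite (tri_edges G)" using finite_edges by auto
  have h: "h \<noteq> []" "last h < n" "anchor G h \<in> visited G h" "visited G h \<subseteq> {..<n}" "tri_visited h"
    using inv unfolding walk_inv_def by simp_all
  obtain z where "walk_ends h z" using inv unfolding walk_inv_def by (elim conjE exE)
  then have z: "z div 3 = anchor G h div 3" and H: "odd_ends ?H h (last h) z" and T: "odd_ends (tri_edges G) h z (anchor G h)"
    unfolding walk_ends_def by simp_all
  show ?thesis
  proof (cases "unused_edges G h = {}")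
    case False
    then obtain w' where w': "lazy_rule G h = return_pmf w'" "{last h, w'} \<in> unused_edges G h"
      "{last h, w'} \<in> tri_edges G \<Longrightarrow> (\<forall>w''. {last h, w''} \<in> unused_edges G h \<longrightarrow> {last h, w''} \<in> tri_edges G)"
      using lazy_rule_choice[OF False] by blast
    have "w = w'" using w False w'(1) by (simp add: grw_step_def)
    note w' = w'(2,3)[folded this]
    have edge: "{last h, w} \<in> edge_set G" "{last h, w} \<notin> hist_edges h" using w'(1) by (auto simp: unused_edges_def)
    then have G: "G (last h) w" by (simp add: edge_iff)
    have wn: "w < n" using G_less[OF G] by simp
    have neq: "w \<noteq> last h" using G G_irrefl[of w] by (metis)
    have anc: "anchor G (h @ [w]) = anchor G h" using False h(1) by (simp add: anchor_snoc)
    have vis: "visited G (h @ [w]) = visited G h" using h(3) anc by (simp add: visited_snoc insert_absorb)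
    have basic: "h @ [w] \<noteq> []" "last (h @ [w]) < n" "anchor G (h @ [w]) \<in> visited G (h @ [w])" "visited G (h @ [w]) \<subseteq> {..<n}"
      unfolding anc vis using h(3,4) wn by simp_all
    show ?thesis
    proof (cases "{last h, w} \<in> tri_edges G")
      case False
      \<comment> \<open>Only the free end of the trail outside the triangles moves.\<close>
      have "odd_ends ?H (h @ [w]) w z"
        by (rule odd_ends_snoc_fst[OF H fin(1) h(1) DiffI[OF edge(1) False] edge(2) neq])
      moreover have "odd_ends (tri_edges G) (h @ [w]) z (anchor G h)"
        by (rule odd_ends_snoc_same[OF T h(1) disjI1[OF False]])
      moreover have "tri_visited (h @ [w])"
        using h(5) False unfolding tri_visited_def vis hist_edges_snoc[OF h(1)] by blast
      ultimately show ?thesis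
        using basic z by (intro walk_invI[where z = z]) (simp_all only: anc last_snoc not_False_eq_True)
    next
      case True
      \<comment> \<open>The rule takes a triangle edge only after the other edges at
        \<open>last h\<close> are exhausted. The outer trail has then closed at \<open>z\<close>, so
        the walk is in the triangle of the anchor, and the closed trail can be re-based at
        \<open>w\<close>.\<close>
      have "{e \<in> ?H. last h \<in> e \<and> e \<notin> hist_edges h} = {}"
      proof (rule ccontr)
        assume "{e \<in> ?H. last h \<in> e \<and> e \<notin> hist_edges h} \<noteq> {}"
        then obtain e where e: "e \<in> unused_edges G h" "e \<notin> tri_edges G" "last h \<in> e"
          by (auto simp: unused_edges_def)
        then obtain a b where "e = {a, b}" by (auto simp: unused_edges_def edge_set_def)
        then have "e = {last h, a} \<or> e = {last h, b}" using e(3) by blast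
        then show False using w'(2)[OF True] e(1,2) by blast
      qed
      then have "unused_degree ?H h (last h) = 0" unfolding unused_degree_def by (simp only: card.empty)
      then have xz: "last h = z" by (rule odd_ends_zero[OF H])
      have "{last h, w} \<notin> ?H" using True by blast
      then have "odd_ends ?H (h @ [w]) (last h) (last h)"
        by (intro odd_ends_snoc_same[OF H[folded xz] h(1)] disjI1)
      then have "odd_ends ?H (h @ [w]) w w" by (rule odd_ends_refl)
      moreover have "odd_ends (tri_edges G) (h @ [w]) w (anchor G h)"
        by (rule odd_ends_snoc_fst[OF T[folded xz] fin(2) h(1) True edge(2) neq])
      moreover have same': "last h div 3 = anchor G h div 3" using z unfolding xz .
      have "last h div 3 = w div 3" using True unfolding tri_edge_iff by (rule conjunct2)
      then have same: "w div 3 = anchor G h div 3" using same' by (simp only:)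
      have "tri_visited (h @ [w])"
        unfolding tri_visited_def vis hist_edges_snoc[OF h(1)]
      proof (intro ballI impI)
        fix e assume e: "e \<in> tri_edges G" "e \<in> insert {last h, w} (hist_edges h)"
        show "\<exists>v\<in>visited G h. \<forall>u\<in>e. u div 3 = v div 3"
        proof (cases "e \<in> hist_edges h")
          case True
          then show ?thesis by (rule h(5)[unfolded tri_visited_def, rule_format, OF e(1)])
        next
          case False
          then have "e = {last h, w}" using e(2) by simp
          then show ?thesis using h(3) same same' by (intro bexI[of _ "anchor G h"]) simp_all
        qed
      qed
      ultimately show ?thesis
        using basic same by (intro walk_invI[where z = w]) (simp_all only: anc last_snoc not_False_eq_True)
    qed
  next
    case True
    have xy: "last h = anchor G h" by (rule walk_inv_no_unused[OF inv True])
    have nb: "w \<in> neighbours G (last h)"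
      using w True neighbours_finite[OF h(2)] by (simp add: grw_step_def)
    then have G: "G (last h) w" by (simp add: neighbours_def)
    \<comment> \<open>A random step runs along a used edge and changes no parity. Both trails are
      closed at \<open>last h\<close>, so both can be re-based at the new anchor
      \<open>w\<close>.\<close>
    have used_edge: "{last h, w} \<in> hist_edges h"
      using True G edge_iff[of "last h" w] unfolding unused_edges_def by blast
    have hist: "hist_edges (h @ [w]) = hist_edges h"
      using hist_edges_snoc[OF h(1), of w] used_edge by (simp add: insert_absorb)
    have anc: "anchor G (h @ [w]) = w" using True h(1) by (simp add: anchor_snoc)
    have vis: "visited G (h @ [w]) = insert w (visited G h)" using anc by (simp add: visited_snoc)
    have xz: "last h = z"
      by (rule odd_ends_zero[OF H unused_degree_last_zero[OF True Diff_subset]])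
    have "odd_ends ?H (h @ [w]) (last h) (last h)"
      by (rule odd_ends_snoc_same[OF H[folded xz] h(1) disjI2[OF used_edge]])
    then have H': "odd_ends ?H (h @ [w]) w w" by (rule odd_ends_refl)
    have "odd_ends (tri_edges G) (h @ [w]) (last h) (last h)"
      by (rule odd_ends_snoc_same[OF T[folded xz xy] h(1) disjI2[OF used_edge]])
    then have T': "odd_ends (tri_edges G) (h @ [w]) w w" by (rule odd_ends_refl)
    have "tri_visited (h @ [w])"
      using h(5) unfolding tri_visited_def vis hist by blast
    then show ?thesis using H' T' h(4) G_less[OF G]
      by (intro walk_invI[where z = w]) (simp_all add: anc vis)
  qed
qed

lemma walk_inv_covered:
  assumes inv: "walk_inv h" and cov: "hist_edges h = edge_set G" and j: "j < N"
  shows "\<exists>v\<in>visited G h. v div 3 = j"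
proof -
  have "G (3 * j) (3 * j + 1)" by (rule triangles) (use j n in auto)
  then have "{3 * j, 3 * j + 1} \<in> tri_edges G" unfolding tri_edge_iff by simp
  moreover have "{3 * j, 3 * j + 1} \<in> hist_edges h" unfolding cov using calculation tri_edges_sub by blast
  moreover have "tri_visited h" using inv unfolding walk_inv_def by simp
  ultimately obtain v where "v \<in> visited G h" "\<forall>u\<in>{3 * j, 3 * j + 1}. u div 3 = v div 3"
    unfolding tri_visited_def by blast
  then show ?thesis by (intro bexI[of _ v]) auto
qed

end

text \<open>The function \<open>f j\<close> bounds the expected hitting time of triangle
  \<open>j\<close> from below: nonpositive on the target, with mean loss at most 1 per random step
  elsewhere. Hence \<open>hit\<close> bounds the hitting times between different targets.\<close>

locale target_walk = triangle_graph +
  fixes S0 :: "nat set" and f :: "nat \<Rightarrow> nat \<Rightarrow> real" and v0 :: nat and hit :: real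
  assumes S0: "S0 \<subseteq> {..<N}" and v0: "v0 < n" and hit: "hit \<ge> 0"
    and f_target: "\<And>j x. j \<in> S0 \<Longrightarrow> x < n \<Longrightarrow> x div 3 = j \<Longrightarrow> f j x \<le> 0"
    and f_drift: "\<And>j x. j \<in> S0 \<Longrightarrow> x < n \<Longrightarrow> x div 3 \<noteq> j \<Longrightarrow> f j x - 1 \<le> nb_avg n d G (f j) x"
    and f_other: "\<And>i j x. i \<in> S0 \<Longrightarrow> j \<in> S0 \<Longrightarrow> i \<noteq> j \<Longrightarrow> x < n \<Longrightarrow> x div 3 = i \<Longrightarrow> hit \<le> f j x"
begin

abbreviation walk :: "nat \<Rightarrow> nat list pmf" where
  "walk t \<equiv> grw_hist G (lazy_rule G) v0 t"

abbreviation step :: "nat list \<Rightarrow> nat pmf" where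
  "step h \<equiv> grw_step G (lazy_rule G) h"

lemma walk_inv_walk: "h \<in> set_pmf (walk t) \<Longrightarrow> walk_inv h"
proof (induction t arbitrary: h)
  case 0
  then show ?case using walk_inv_init[OF v0] by simp
next
  case (Suc t)
  then obtain h' w where "h' \<in> set_pmf (walk t)" "w \<in> set_pmf (step h')" "h = h' @ [w]" by auto
  then show ?case using walk_inv_step[of h' w] Suc.IH[of h'] by simp
qed

lemma finite_step:
  assumes "walk_inv h" shows "finite (set_pmf (step h))"
proof (cases "unused_edges G h = {}")
  case True
  have "last h < n" using assms by (simp add: walk_inv_def)
  then show ?thesis using neighbours_finite[of "last h"] True by (simp add: grw_step_def)
next
  case False
  then show ?thesis by (simp add: grw_step_def lazy_rule_def)
qed

lemma finite_walk: "finite (set_pmf (walk t))"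
proof (induction t)
  case (Suc t)
  have "finite (\<Union>h\<in>set_pmf (walk t). (\<lambda>w. h @ [w]) ` set_pmf (step h))"
    using Suc.IH finite_step walk_inv_walk by (intro finite_UN_I finite_imageI) auto
  then show ?case by simp
qed simp

text \<open>Each history has finitely many successors, so expectations are finite sums and raise no
  integrability questions.\<close>

definition mean :: "nat \<Rightarrow> (nat list \<Rightarrow> real) \<Rightarrow> real" where
  "mean t \<phi> = (\<Sum>h\<in>set_pmf (walk t). pmf (walk t) h * \<phi> h)"

lemma mean_0: "mean 0 \<phi> = \<phi> [v0]"
  by (simp add: mean_def)

lemma mean_eq_expectation: "mean t \<phi> = measure_pmf.expectation (walk t) \<phi>"
  unfolding mean_def by (subst integral_measure_pmf[OF finite_walk]) auto

lemma mean_Suc: "mean (Suc t) \<phi> = mean t (\<lambda>h. measure_pmf.expectation (step h) (\<lambda>w. \<phi> (h @ [w])))"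
proof -
  have "mean (Suc t) \<phi> = measure_pmf.expectation (bind_pmf (walk t) (\<lambda>h. map_pmf (\<lambda>w. h @ [w]) (step h))) \<phi>"
    by (simp add: mean_eq_expectation)
  also have "\<dots> = (\<Sum>h\<in>set_pmf (walk t). pmf (walk t) h *\<^sub>R measure_pmf.expectation (map_pmf (\<lambda>w. h @ [w]) (step h)) \<phi>)"
    by (rule pmf_expectation_bind[OF finite_walk]) (use finite_step walk_inv_walk in auto)
  finally show ?thesis by (simp add: mean_def)
qed

lemma mean_mono: "(\<And>h. walk_inv h \<Longrightarrow> \<phi> h \<le> \<psi> h) \<Longrightarrow> mean t \<phi> \<le> mean t \<psi>"
  unfolding mean_def using walk_inv_walk by (intro sum_mono mult_left_mono) auto

lemma mean_cong: "(\<And>h. walk_inv h \<Longrightarrow> \<phi> h = \<psi> h) \<Longrightarrow> mean t \<phi> = mean t \<psi>"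
  unfolding mean_def using walk_inv_walk by (intro sum.cong) auto

lemma mean_add: "mean t (\<lambda>h. \<phi> h + \<psi> h) = mean t \<phi> + mean t \<psi>"
  unfolding mean_def by (simp add: distrib_left sum.distrib)

lemma mean_diff: "mean t (\<lambda>h. \<phi> h - \<psi> h) = mean t \<phi> - mean t \<psi>"
  unfolding mean_def by (simp add: right_diff_distrib sum_subtractf)

lemma mean_scale: "mean t (\<lambda>h. c * \<phi> h) = c * mean t \<phi>"
  unfolding mean_def by (simp add: sum_distrib_left mult_ac)

lemma mean_sum: "mean t (\<lambda>h. \<Sum>i\<in>A. \<phi> i h) = (\<Sum>i\<in>A. mean t (\<phi> i))"
  unfolding mean_def by (simp add: sum_distrib_left) (rule sum.swap)

lemma mean_one: "mean t (\<lambda>_. 1) = 1"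
  unfolding mean_eq_expectation by simp

lemma mean_nonneg: "(\<And>h. 0 \<le> \<phi> h) \<Longrightarrow> 0 \<le> mean t \<phi>"
  unfolding mean_def by (intro sum_nonneg mult_nonneg_nonneg) auto

lemma mean_prob: "measure_pmf.prob (walk t) A = mean t (\<lambda>h. of_bool (h \<in> A))"
  unfolding mean_eq_expectation by (simp flip: indicator_def)

section \<open>Unvisited targets and Matthews' recursion\<close>

definition remaining :: "nat set \<Rightarrow> nat list \<Rightarrow> nat set" where
  "remaining S h = {j \<in> S. \<forall>v\<in>visited G h. v div 3 \<noteq> j}"

lemma remaining_sub: "remaining S h \<subseteq> S"
  by (auto simp: remaining_def)

lemma remaining_delete: "remaining (S - {i}) h = remaining S h - {i}"
  by (auto simp: remaining_def)

lemma finite_remaining: "S \<subseteq> S0 \<Longrightarrow> finite S \<and> finite (remaining S h)"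
  using S0 remaining_sub[of S h] by (meson finite_lessThan finite_subset subset_trans)

definition last_target :: "nat set \<Rightarrow> nat list \<Rightarrow> real" where
  "last_target S h = (\<Sum>j\<in>S. if remaining S h = {j} then f j (anchor G h) else 0)"

text \<open>It is 0 while two or more targets remain, at least 0 in expectation terms when the last
  one is singled out at another target, and \<open>- hit\<close> once all are visited. The drop by
  \<open>hit\<close> must be paid for during the time with exactly one target left.\<close>

definition potential :: "nat set \<Rightarrow> nat list \<Rightarrow> real" where
  "potential S h = last_target S h - hit * of_bool (card (remaining S h) \<le> 1)"

lemma last_target_single:
  assumes "S \<subseteq> S0" "remaining S h = {i}"
  shows "last_target S h = f i (anchor G h)"
proof -
  have "i \<in> S" using assms(2) remaining_sub[of S h] by blast
  moreover have "finite S" using finite_remaining[OF assms(1)] by simp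
  moreover have "(if remaining S h = {j} then f j (anchor G h) else 0) = (if i = j then f i (anchor G h) else 0)" for j
    unfolding assms(2) by simp
  ultimately show ?thesis unfolding last_target_def by simp
qed

lemma last_target_none:
  assumes "card (remaining S h) \<noteq> 1"
  shows "last_target S h = 0"
proof -
  have "remaining S h \<noteq> {j}" for j using assms by auto
  then show ?thesis unfolding last_target_def by simp
qed

lemma potential_drift_random:
  assumes S: "S \<subseteq> S0" and inv: "walk_inv h" and none: "unused_edges G h = {}"
    and w: "w \<in> neighbours G (anchor G h)"
  shows "remaining S h = {i} \<Longrightarrow> f i w - hit \<le> potential S (h @ [w])"
    and "remaining S h = {} \<Longrightarrow> - hit \<le> potential S (h @ [w])"
    and "2 \<le> card (remaining S h) \<Longrightarrow> 0 \<le> potential S (h @ [w])"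
proof -
  have h: "h \<noteq> []" using inv by (simp add: walk_inv_def)
  have wn: "w < n" using w G_less by (auto simp: neighbours_def)
  have anc: "anchor G (h @ [w]) = w" using none h by (simp add: anchor_snoc)
  have rem: "remaining S (h @ [w]) = remaining S h - {w div 3}"
    unfolding remaining_def visited_snoc anc by auto
  note fin = finite_remaining[OF S]
  show "f i w - hit \<le> potential S (h @ [w])" if r: "remaining S h = {i}"
  proof (cases "w div 3 = i")
    case True
    then have "remaining S (h @ [w]) = {}" unfolding rem r by simp
    moreover then have "last_target S (h @ [w]) = 0" by (intro last_target_none) simp
    moreover have "i \<in> S0" using r remaining_sub[of S h] S by blast
    then have "f i w \<le> 0" using f_target[OF _ wn True] by simp
    ultimately show ?thesis by (simp add: potential_def)
  next
    case False
    then have "remaining S (h @ [w]) = {i}" unfolding rem r by simp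
    then show ?thesis using last_target_single[OF S, of "h @ [w]" i] by (simp add: potential_def anc)
  qed
  show "- hit \<le> potential S (h @ [w])" if r: "remaining S h = {}"
  proof -
    have "remaining S (h @ [w]) = {}" unfolding rem r by simp
    moreover then have "last_target S (h @ [w]) = 0" by (intro last_target_none) simp
    ultimately show ?thesis by (simp add: potential_def)
  qed
  show "0 \<le> potential S (h @ [w])" if r: "2 \<le> card (remaining S h)"
  proof (cases "card (remaining S (h @ [w])) \<le> 1")
    case False
    then have "last_target S (h @ [w]) = 0" by (intro last_target_none) simp
    then show ?thesis using False by (simp add: potential_def)
  next
    case True
    \<comment> \<open>The number of remaining targets falls from two to one only by entering one of
      them, so \<open>w\<close> lies in a target other than the last one and \<open>f_other\<close>
      applies.\<close>
    have ne: "w div 3 \<in> remaining S h"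
    proof (rule ccontr)
      assume "w div 3 \<notin> remaining S h"
      then have "remaining S (h @ [w]) = remaining S h" unfolding rem by simp
      then show False using True r by simp
    qed
    then have "card (remaining S (h @ [w])) = card (remaining S h) - 1"
      unfolding rem using fin by (simp add: card_Diff_singleton)
    then have "card (remaining S (h @ [w])) = 1" using True r by simp
    then obtain i where i: "remaining S (h @ [w]) = {i}" by (rule card_1_singletonE)
    then have "i \<in> remaining S h" "i \<noteq> w div 3" using rem by auto
    then have "hit \<le> f i w" using f_other[of "w div 3" i w] ne wn remaining_sub[of S h] S by blast
    then show ?thesis using last_target_single[OF S i] i by (simp add: potential_def anc)
  qed
qed

lemma expectation_neighbours:
  assumes "x < n"
  shows "measure_pmf.expectation (pmf_of_set (neighbours G x)) \<phi> = (\<Sum>w\<in>neighbours G x. \<phi> w) / d"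
    and "nb_avg n d G \<phi> x = (\<Sum>w\<in>neighbours G x. \<phi> w) / d"
proof -
  have card: "card (neighbours G x) = d" using regular assms by (simp add: regular_graph_def)
  show "measure_pmf.expectation (pmf_of_set (neighbours G x)) \<phi> = (\<Sum>w\<in>neighbours G x. \<phi> w) / d"
    using neighbours_finite[OF assms] card by (subst integral_pmf_of_set) auto
  have "neighbours G x = {w \<in> {..<n}. G x w}" using G_less by (auto simp: neighbours_def)
  then show "nb_avg n d G \<phi> x = (\<Sum>w\<in>neighbours G x. \<phi> w) / d"
    unfolding nb_avg_def by (simp only: sum.inter_filter finite_lessThan)
qed

text \<open>Greedy steps keep the anchor and the potential, so they can only add time. A random step
  starts at the anchor and moves it to a uniform neighbour, where \<open>f_drift\<close> limits the
  loss to 1.\<close>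

lemma potential_drift:
  assumes S: "S \<subseteq> S0" and inv: "walk_inv h"
  shows "potential S h - of_bool (card (remaining S h) = 1) \<le> measure_pmf.expectation (step h) (\<lambda>w. potential S (h @ [w]))"
proof (cases "unused_edges G h = {}")
  case False
  have h: "h \<noteq> []" "anchor G h \<in> visited G h" using inv by (simp_all add: walk_inv_def)
  have "potential S (h @ [w]) = potential S h" for w
  proof -
    have anc: "anchor G (h @ [w]) = anchor G h" using False h by (simp add: anchor_snoc)
    have "visited G (h @ [w]) = visited G h" unfolding visited_snoc anc using h(2) by (rule insert_absorb)
    then show ?thesis unfolding potential_def last_target_def remaining_def anc by (simp only:)
  qed
  then show ?thesis by simp
next
  case True
  define x where "x = anchor G h"
  have x: "last h = x" "x < n" "x \<in> visited G h"
    using walk_inv_no_unused[OF inv True] inv by (auto simp: x_def walk_inv_def)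
  have nb: "finite (neighbours G x)" "card (neighbours G x) = d"
    using neighbours_finite[OF x(2)] regular x(2) by (simp_all add: regular_graph_def)
  have exp: "measure_pmf.expectation (step h) (\<lambda>w. potential S (h @ [w])) = (\<Sum>w\<in>neighbours G x. potential S (h @ [w])) / d"
    using expectation_neighbours(1)[OF x(2)] True by (simp add: grw_step_def x(1))
  have const_le: "c \<le> (\<Sum>w\<in>neighbours G x. \<phi> w) / d" if "\<And>w. w \<in> neighbours G x \<Longrightarrow> c \<le> \<phi> w" for c :: real and \<phi>
  proof -
    have "(\<Sum>w\<in>neighbours G x. c) \<le> (\<Sum>w\<in>neighbours G x. \<phi> w)" by (rule sum_mono) (rule that)
    then have "real d * c \<le> (\<Sum>w\<in>neighbours G x. \<phi> w)" using nb by simp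
    then show ?thesis using d(2) by (simp add: pos_le_divide_eq mult.commute)
  qed
  note drift = potential_drift_random[OF S inv True, folded x_def]
  consider "remaining S h = {}" | i where "remaining S h = {i}" | "2 \<le> card (remaining S h)"
  proof -
    have "finite (remaining S h)" using finite_remaining[OF S] by simp
    moreover have "card (remaining S h) = 0 \<or> card (remaining S h) = 1 \<or> 2 \<le> card (remaining S h)" by linarith
    ultimately show ?thesis using that by (metis card_0_eq card_1_singletonE)
  qed
  then show ?thesis
  proof cases
    case 1
    then have "potential S h = - hit" unfolding potential_def by (subst last_target_none) simp_all
    moreover have "- hit \<le> (\<Sum>w\<in>neighbours G x. potential S (h @ [w])) / d"
      by (rule const_le) (rule drift(2)[OF _ 1])
    ultimately show ?thesis unfolding exp using 1 by simp
  next
    case (2 i)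
    have i: "i \<in> S0" "x div 3 \<noteq> i"
      using 2 remaining_sub[of S h] S x(3) by (auto simp: remaining_def)
    have "potential S h = f i x - hit" using last_target_single[OF S 2] 2 by (simp add: potential_def x_def)
    then have "potential S h - of_bool (card (remaining S h) = 1) = f i x - 1 - hit" using 2 by simp
    also have "\<dots> \<le> nb_avg n d G (f i) x - hit" using f_drift[OF i(1) x(2) i(2)] by simp
    also have "\<dots> = (\<Sum>w\<in>neighbours G x. f i w - hit) / d"
      unfolding expectation_neighbours(2)[OF x(2)] using nb d(2) by (simp add: sum_subtractf diff_divide_distrib)
    also have "\<dots> \<le> (\<Sum>w\<in>neighbours G x. potential S (h @ [w])) / d"
      by (intro divide_right_mono sum_mono drift(1) 2) auto
    finally show ?thesis unfolding exp .
  next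
    case 3
    then have "potential S h = 0" unfolding potential_def by (subst last_target_none) simp_all
    moreover have "0 \<le> (\<Sum>w\<in>neighbours G x. potential S (h @ [w])) / d"
      by (rule const_le) (rule drift(3)[OF _ 3])
    ultimately show ?thesis unfolding exp by simp
  qed
qed

definition single_prob :: "nat set \<Rightarrow> nat \<Rightarrow> real" where
  "single_prob S t = mean t (\<lambda>h. of_bool (card (remaining S h) = 1))"

definition uncovered_prob :: "nat set \<Rightarrow> nat \<Rightarrow> real" where
  "uncovered_prob S t = mean t (\<lambda>h. of_bool (remaining S h \<noteq> {}))"

text \<open>The start may already lie in one target; with three targets at least two remain, so the
  potential starts at 0.\<close>

lemma mean_potential_ge:
  assumes S: "S \<subseteq> S0" and card: "card S \<ge> 3"
  shows "- (\<Sum>s<t. single_prob S s) \<le> mean t (potential S)"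
proof (induction t)
  case 0
  have "remaining S [v0] = S - {v0 div 3}" by (auto simp: remaining_def)
  moreover have "card S - 1 \<le> card (S - {v0 div 3})"
    using finite_remaining[OF S] by (simp add: card_Diff_singleton_if)
  ultimately have "2 \<le> card (remaining S [v0])" using card by simp
  then have "potential S [v0] = 0" unfolding potential_def by (subst last_target_none) simp_all
  then show ?case by (simp add: mean_0)
next
  case (Suc t)
  have "mean t (\<lambda>h. potential S h - of_bool (card (remaining S h) = 1)) \<le> mean (Suc t) (potential S)"
    unfolding mean_Suc by (rule mean_mono) (rule potential_drift[OF S])
  then have "mean t (potential S) - single_prob S t \<le> mean (Suc t) (potential S)"
    by (simp add: mean_diff single_prob_def)
  then show ?case using Suc.IH by simp
qed

text \<open>The crude constant \<open>C\<close> depends on \<open>n\<close> but not on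
  \<open>t\<close>. That is enough, since it multiplies a probability that tends to 0 in the limit
  below.\<close>

lemma mean_potential_le:
  assumes S: "S \<subseteq> S0"
  defines "C \<equiv> \<Sum>j\<in>S0. \<Sum>x<n. \<bar>f j x\<bar>"
  shows "mean t (potential S) \<le> C * single_prob S t - hit * (1 - uncovered_prob S t)"
proof -
  have finS0: "finite S0" using S0 finite_subset by blast
  have bound: "f j x \<le> C" if "j \<in> S0" "x < n" for j x
  proof -
    have "f j x \<le> (\<Sum>x<n. \<bar>f j x\<bar>)"
      using member_le_sum[of x "{..<n}" "\<lambda>x. \<bar>f j x\<bar>"] that(2) by simp
    also have "\<dots> \<le> C"
      unfolding C_def using that(1) finS0
      by (intro member_le_sum[of j S0 "\<lambda>j. \<Sum>x<n. \<bar>f j x\<bar>"] sum_nonneg) auto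
    finally show ?thesis .
  qed
  have "potential S h \<le> C * of_bool (card (remaining S h) = 1) - hit * (1 - of_bool (remaining S h \<noteq> {}))"
    if inv: "walk_inv h" for h
  proof -
    have "last_target S h \<le> C * of_bool (card (remaining S h) = 1)"
    proof (cases "card (remaining S h) = 1")
      case True
      then obtain i where i: "remaining S h = {i}" by (rule card_1_singletonE)
      have "anchor G h < n" using inv unfolding walk_inv_def by blast
      moreover have "i \<in> S0" using i remaining_sub[of S h] S by blast
      ultimately show ?thesis using bound[of i "anchor G h"] True by (simp add: last_target_single[OF S i])
    next
      case False
      then show ?thesis by (simp add: last_target_none)
    qed
    moreover have "hit * (1 - of_bool (remaining S h \<noteq> {})) \<le> hit * of_bool (card (remaining S h) \<le> 1)"
      using hit by (intro mult_left_mono) auto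
    ultimately show ?thesis by (simp only: potential_def)
  qed
  then have "mean t (potential S) \<le> mean t (\<lambda>h. C * of_bool (card (remaining S h) = 1) - hit * (1 - of_bool (remaining S h \<noteq> {})))"
    by (rule mean_mono)
  also have "\<dots> = C * single_prob S t - hit * (1 - uncovered_prob S t)"
    unfolding mean_diff mean_scale mean_one single_prob_def uncovered_prob_def ..
  finally show ?thesis .
qed

lemma uncovered_prob_nonneg: "0 \<le> uncovered_prob S t" and single_prob_nonneg: "0 \<le> single_prob S t"
  unfolding uncovered_prob_def single_prob_def by (intro mean_nonneg; simp)+

lemma uncovered_prob_mono: "S \<subseteq> S' \<Longrightarrow> uncovered_prob S t \<le> uncovered_prob S' t"
  unfolding uncovered_prob_def by (intro mean_mono) (auto simp: remaining_def)

lemma single_prob_le: "single_prob S t \<le> uncovered_prob S t"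
  unfolding uncovered_prob_def single_prob_def by (intro mean_mono) auto

text \<open>The identity holds for every history: deleting \<open>i\<close> changes whether some
  target remains exactly when \<open>i\<close> is the only one left.\<close>

lemma uncovered_prob_delete:
  assumes S: "S \<subseteq> S0" "S \<noteq> {}"
  shows "card S * uncovered_prob S t = (\<Sum>i\<in>S. uncovered_prob (S - {i}) t) + single_prob S t"
proof -
  have fin: "finite S" using finite_remaining[OF S(1)] by simp
  have pos: "card S > 0" using fin S(2) by (simp add: card_gt_0_iff)
  have "real (card S) * of_bool (remaining S h \<noteq> {}) =
     (\<Sum>i\<in>S. of_bool (remaining (S - {i}) h \<noteq> {})) + of_bool (card (remaining S h) = 1)" for h
  proof -
    have finr: "finite (remaining S h)" using finite_remaining[OF S(1)] by simp
    consider "remaining S h = {}" | a where "remaining S h = {a}" | "2 \<le> card (remaining S h)"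
    proof -
      have "card (remaining S h) = 0 \<or> card (remaining S h) = 1 \<or> 2 \<le> card (remaining S h)" by linarith
      then show ?thesis using that finr by (metis card_0_eq card_1_singletonE)
    qed
    then show ?thesis
    proof cases
      case 1
      then show ?thesis by (simp add: remaining_delete)
    next
      case (2 a)
      then have a: "a \<in> S" using remaining_sub[of S h] by blast
      have "(\<Sum>i\<in>S. of_bool (remaining (S - {i}) h \<noteq> {})) = (\<Sum>i\<in>S. 1 - (if i = a then 1 else 0 :: real))"
        unfolding remaining_delete 2 by (intro sum.cong refl) auto
      also have "\<dots> = real (card S) - 1" using fin a by (simp add: sum_subtractf)
      finally show ?thesis using 2 by simp
    next
      case 3
      have "remaining S h - {i} \<noteq> {}" for i
      proof
        assume "remaining S h - {i} = {}"
        then have "card (remaining S h) \<le> card {i}" by (intro card_mono) auto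
        then show False using 3 by simp
      qed
      moreover have "remaining S h \<noteq> {}" using 3 by auto
      ultimately show ?thesis using 3 by (simp add: remaining_delete)
    qed
  qed
  then have "mean t (\<lambda>h. real (card S) * of_bool (remaining S h \<noteq> {})) =
    mean t (\<lambda>h. (\<Sum>i\<in>S. of_bool (remaining (S - {i}) h \<noteq> {})) + of_bool (card (remaining S h) = 1))"
    by (intro mean_cong) simp
  then show ?thesis unfolding mean_scale mean_add mean_sum uncovered_prob_def single_prob_def .
qed

text \<open>Matthews' bound without a random ordering: averaging over the target that is covered last
  bounds the cover time of \<open>S\<close> by those of its subsets \<open>S - {i}\<close>.\<close>

lemma matthews_lower_bound:
  assumes summ: "summable (uncovered_prob S0)"
  shows "S \<subseteq> S0 \<Longrightarrow> card S = k + 2 \<Longrightarrow> hit * (\<Sum>i<k. 1 / (real i + 3)) \<le> (\<Sum>t. uncovered_prob S t)"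
proof (induction k arbitrary: S)
  case 0
  have "summable (uncovered_prob S)"
    by (rule summable_comparison_test'[OF summ, of 0]) (simp add: uncovered_prob_nonneg uncovered_prob_mono[OF 0(1)])
  then show ?case by (simp add: suminf_nonneg uncovered_prob_nonneg)
next
  case (Suc k)
  have Q: "summable (uncovered_prob S')" if "S' \<subseteq> S0" for S'
    by (rule summable_comparison_test'[OF summ, of 0]) (simp add: uncovered_prob_nonneg uncovered_prob_mono[OF that])
  have p: "summable (single_prob S)"
    by (rule summable_comparison_test'[OF Q[OF Suc.prems(1)], of 0]) (simp add: single_prob_nonneg single_prob_le)
  have fin: "finite S" using finite_remaining[OF Suc.prems(1)] by simp
  have sub: "S - {i} \<subseteq> S0" for i using Suc.prems(1) by blast
  define C where "C = (\<Sum>j\<in>S0. \<Sum>x<n. \<bar>f j x\<bar>)"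
  \<comment> \<open>Letting \<open>t\<close> grow in the two bounds on the mean potential:
    summability sends both probabilities to 0, and \<open>hit\<close> bounds the expected time with
    one target left.\<close>
  have "hit * (1 - 0) - C * 0 \<le> (\<Sum>t. single_prob S t)"
  proof (rule tendsto_upperbound)
    show "(\<lambda>t. hit * (1 - uncovered_prob S t) - C * single_prob S t) \<longlonglongrightarrow> hit * (1 - 0) - C * 0"
      by (intro tendsto_intros summable_LIMSEQ_zero p Q Suc.prems(1))
    have "hit * (1 - uncovered_prob S t) - C * single_prob S t \<le> (\<Sum>t. single_prob S t)" for t
    proof -
      have "hit * (1 - uncovered_prob S t) - C * single_prob S t \<le> (\<Sum>s<t. single_prob S s)"
        using mean_potential_le[OF Suc.prems(1), of t] mean_potential_ge[OF Suc.prems(1), of t] Suc.prems(2)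
        unfolding C_def by linarith
      also have "\<dots> \<le> (\<Sum>t. single_prob S t)" by (intro sum_le_suminf p) (auto simp: single_prob_nonneg)
      finally show ?thesis .
    qed
    then show "\<forall>\<^sub>F t in sequentially. hit * (1 - uncovered_prob S t) - C * single_prob S t \<le> (\<Sum>t. single_prob S t)"
      by simp
  qed simp
  then have hit_le: "hit \<le> (\<Sum>t. single_prob S t)" by simp
  define H where "H = (\<Sum>i<k. 1 / (real i + 3))"
  have IH: "hit * H \<le> (\<Sum>t. uncovered_prob (S - {i}) t)" if "i \<in> S" for i
    unfolding H_def by (rule Suc.IH[OF sub]) (use that fin Suc.prems(2) in \<open>simp add: card_Diff_singleton\<close>)
  have ne: "S \<noteq> {}" using Suc.prems(2) by auto
  have "(real k + 3) * (\<Sum>t. uncovered_prob S t) = (\<Sum>t. real (card S) * uncovered_prob S t)"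
    using suminf_mult[OF Q[OF Suc.prems(1)], of "real (card S)"] Suc.prems(2) by (simp add: algebra_simps)
  also have "\<dots> = (\<Sum>t. (\<Sum>i\<in>S. uncovered_prob (S - {i}) t) + single_prob S t)"
    by (simp only: uncovered_prob_delete[OF Suc.prems(1) ne])
  also have "\<dots> = (\<Sum>t. \<Sum>i\<in>S. uncovered_prob (S - {i}) t) + (\<Sum>t. single_prob S t)"
    by (rule suminf_add[symmetric]) (intro summable_sum Q sub p)+
  also have "(\<Sum>t. \<Sum>i\<in>S. uncovered_prob (S - {i}) t) = (\<Sum>i\<in>S. \<Sum>t. uncovered_prob (S - {i}) t)"
    by (rule suminf_sum) (rule Q[OF sub])
  finally have "(real k + 3) * (\<Sum>t. uncovered_prob S t) = (\<Sum>i\<in>S. \<Sum>t. uncovered_prob (S - {i}) t) + (\<Sum>t. single_prob S t)" .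
  moreover have "(\<Sum>i\<in>S. hit * H) \<le> (\<Sum>i\<in>S. \<Sum>t. uncovered_prob (S - {i}) t)" by (rule sum_mono) (rule IH)
  moreover have "(\<Sum>i\<in>S. hit * H) = (real k + 3) * (hit * H)" using Suc.prems(2) by simp
  \<comment> \<open>Here \<open>card S = k + 3\<close>; dividing by it turns the gain
    \<open>hit\<close> into the next harmonic term.\<close>
  ultimately have "(real k + 3) * (hit * H) + hit \<le> (real k + 3) * (\<Sum>t. uncovered_prob S t)" using hit_le by linarith
  then have "(real k + 3) * (hit * H + hit / (real k + 3)) \<le> (real k + 3) * (\<Sum>t. uncovered_prob S t)"
    by (simp add: distrib_left)
  then have "hit * H + hit / (real k + 3) \<le> (\<Sum>t. uncovered_prob S t)"
    by (rule mult_left_le_imp_le) simp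
  then show ?case by (simp add: H_def distrib_left)
qed

text \<open>When all edges are used no target remains, so the uncovered probabilities bound the
  tails. If they are not summable, the expected cover time is infinite and nothing is left to
  show.\<close>

lemma cover_time_lower_bound:
  assumes "card S0 = k + 2"
  shows "ennreal (hit * (\<Sum>i<k. 1 / (real i + 3))) \<le> expected_edge_cover_time G (lazy_rule G) v0"
proof -
  have "(\<Sum>t. ennreal (uncovered_prob S0 t)) \<le> expected_edge_cover_time G (lazy_rule G) v0"
    unfolding expected_edge_cover_time_def
  proof (intro suminf_le summableI ennreal_leI)
    fix t
    have "of_bool (remaining S0 h \<noteq> {}) \<le> (of_bool (h \<in> {h. hist_edges h \<noteq> edge_set G}) :: real)" if "walk_inv h" for h
    proof (cases "hist_edges h = edge_set G")
      case True
      have "\<exists>v\<in>visited G h. v div 3 = j" if "j \<in> S0" for j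
        by (rule walk_inv_covered[OF \<open>walk_inv h\<close> True]) (use that S0 in auto)
      then have "remaining S0 h = {}" unfolding remaining_def by blast
      then show ?thesis by simp
    qed simp
    then show "uncovered_prob S0 t \<le> measure_pmf.prob (walk t) {h. hist_edges h \<noteq> edge_set G}"
      unfolding mean_prob uncovered_prob_def by (rule mean_mono)
  qed
  moreover have "ennreal (hit * (\<Sum>i<k. 1 / (real i + 3))) \<le> (\<Sum>t. ennreal (uncovered_prob S0 t))"
  proof (cases "summable (uncovered_prob S0)")
    case True
    have "hit * (\<Sum>i<k. 1 / (real i + 3)) \<le> (\<Sum>t. uncovered_prob S0 t)"
      by (rule matthews_lower_bound[OF True order_refl assms])
    then show ?thesis using suminf_ennreal2[OF uncovered_prob_nonneg True] by (simp add: ennreal_leI)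
  next
    case False
    then have "(\<Sum>t. ennreal (uncovered_prob S0 t)) = \<infinity>"
      using summable_suminf_not_top[of "uncovered_prob S0"] uncovered_prob_nonneg unfolding infinity_ennreal_def by blast
    then show ?thesis by simp
  qed
  ultimately show ?thesis by (rule order_trans[rotated])
qed

end

section \<open>The main theorem\<close>

lemma spectral_lambda_le:
  assumes G: "regular_graph n d G" and d: "d > 0" and n: "n \<ge> 2" and lam: "lam < 1"
    and form: "\<And>f. (\<Sum>u<n. f u) = 0 \<Longrightarrow> \<bar>\<Sum>u<n. f u * nb_avg n d G f u\<bar> \<le> lam * (\<Sum>u<n. (f u)\<^sup>2)"
  shows "spectral_lambda n d G \<le> lam"
proof -
  obtain m where m: "n = Suc m" "m \<ge> 1" using n by (cases n) auto
  define a where "a = (\<lambda>i j. if G i j then 1 / real d else 0)"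
  have sum_le: "(\<Sum>j\<le>m. h j) = (\<Sum>j<n. h j)" for h :: "nat \<Rightarrow> real"
    unfolding m by (simp only: lessThan_Suc_atMost)
  have avg: "(\<Sum>j\<le>m. a i j * w j) = nb_avg n d G w i" for i w
    unfolding sum_le nb_avg_def sum_divide_distrib by (intro sum.cong refl) (simp add: a_def)
  have "Max (abs ` set (tl (eigenvalues_desc (mat (Suc m) (Suc m) (\<lambda>(i, j). a i j))))) \<le> lam"
  proof (rule second_eigenvalue_bound[OF m(2) _ _ _ lam])
    show "a i j = a j i" for i j
      using G by (auto simp: a_def regular_graph_def simple_graph_def)
    show "(\<Sum>j\<le>m. a i j) = 1" if "i \<le> m" for i
      using regular_graph_sum[OF G, of i "1 / real d"] that d unfolding sum_le a_def m by simp
    show "\<bar>\<Sum>i\<le>m. w i * (\<Sum>j\<le>m. a i j * w j)\<bar> \<le> lam * (\<Sum>i\<le>m. (w i)\<^sup>2)" if "(\<Sum>i\<le>m. w i) = 0" for w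
      using form[of w] that unfolding avg sum_le by simp
  qed
  then show ?thesis by (simp add: spectral_lambda_def norm_adj_def a_def m)
qed

lemma nat_sqrt_exists: "\<exists>k. k * k \<le> m \<and> m < Suc k * Suc k"
proof (induction m)
  case (Suc m)
  then obtain k where k: "k * k \<le> m" "m < Suc k * Suc k" by blast
  show ?case
  proof (cases "Suc m < Suc k * Suc k")
    case True
    then show ?thesis using k by (intro exI[of _ k]) simp
  next
    case False
    then have "Suc m = Suc k * Suc k" using k by linarith
    then show ?thesis by (intro exI[of _ "Suc k"]) simp
  qed
qed simp

text \<open>Here \<open>k\<close> is the integer square root of \<open>(N - 2) div 2\<close>, which
  leaves \<open>r \<ge> 2\<close>. From \<open>N \<ge> 20\<close> follows \<open>k \<ge> 3\<close>,
  and then 2 k^2 + 4 k + 3 <= 4 k^2 gives the upper bound on \<open>r\<close>.\<close>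

lemma size_split:
  fixes N :: nat
  assumes "N \<ge> 20"
  obtains k r :: nat where "k > 0" "2 \<le> r" "r \<le> 2 * (k * k)" "N = 2 * (k * k) + r"
proof -
  obtain k where k: "k * k \<le> (N - 2) div 2" "(N - 2) div 2 < Suc k * Suc k" using nat_sqrt_exists by blast
  have "k \<ge> 3"
  proof (rule ccontr)
    assume "\<not> 3 \<le> k"
    then have "Suc k * Suc k \<le> 3 * 3" by (intro mult_mono) auto
    then show False using k(2) assms by linarith
  qed
  then have "3 * k \<le> k * k" by simp
  moreover have "Suc k * Suc k = k * k + 2 * k + 1" by simp
  ultimately have "2 * (k * k) + 2 \<le> N" "N \<le> 4 * (k * k)"
    using k assms \<open>k \<ge> 3\<close> by linarith+
  then show ?thesis using \<open>k \<ge> 3\<close> by (intro that[of k "N - 2 * (k * k)"]) auto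
qed

lemma prism_triangles:
  assumes "u < 3 * N" "v < 3 * N" "u \<noteq> v" "u div 3 = v div 3"
  shows "prism_graph N \<rho> u v"
proof -
  define j c e where "j = u div 3" and "c = u mod 3" and "e = v mod 3"
  have uv: "u = 3 * j + c" "v = 3 * j + e" "c < 3" "e < 3"
  proof -
    show "u = 3 * j + c" unfolding j_def c_def by simp
    show "v = 3 * j + e" unfolding j_def assms(4) e_def by simp
  qed (simp_all add: c_def e_def)
  have "j < N" using assms(1) by (simp add: j_def)
  have "c \<noteq> e" using assms(3) uv(1,2) by blast
  moreover have "c = 0 \<or> c = 1 \<or> c = 2" "e = 0 \<or> e = 1 \<or> e = 2" using uv(3,4) by linarith+
  ultimately have "e = (c + 1) mod 3 \<or> c = (e + 1) mod 3" by (elim disjE) simp_all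
  then show ?thesis
    using prism_arc_cross[OF \<open>j < N\<close> uv(3) \<open>j < N\<close> disjI1[OF refl], of \<rho>]
      prism_arc_cross[OF \<open>j < N\<close> uv(4) \<open>j < N\<close> disjI1[OF refl], of \<rho>]
    unfolding prism_graph_def uv(1,2) by (elim disjE) (simp_all only: disj_not1 simp_thms)
qed

text \<open>The sum is a harmonic number without its first two terms, whose total is 3 / 2.\<close>

lemma harmonic_tail_ge:
  "ln (real k + 3) - 3 / 2 \<le> (\<Sum>i<k. 1 / (real i + 3))"
proof -
  have "harm (k + 2) = 3 / 2 + (\<Sum>i<k. 1 / (real i + 3))"
    by (induction k) (simp_all add: harm_Suc harm_expand inverse_eq_divide add_ac)
  moreover have "ln (real (k + 2) + 1) \<le> harm (k + 2)" by (rule ln_le_harm)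
  ultimately show ?thesis by (simp add: add_ac)
qed

lemma prism_cover_time:
  fixes lam :: real
  assumes regular: "regular_graph (3 * N) 6 (prism_graph N \<rho>)" and lam: "0 < lam" "lam < 1"
    and form: "\<And>f. (\<Sum>u<3 * N. f u) = 0 \<Longrightarrow>
      \<bar>\<Sum>u<3 * N. f u * nb_avg (3 * N) 6 (prism_graph N \<rho>) f u\<bar> \<le> lam * (\<Sum>u<3 * N. (f u)\<^sup>2)"
    and L: "8 * lam ^ L \<le> 1 - lam" "12 * L \<le> 3 * N" "1 \<le> L"
    and D: "D = (\<Sum>t<L. 6 ^ t * 3)" and large: "2 * D \<le> N"
  shows "ennreal (real (3 * N) / 24 * (ln (real (3 * N)) - ln (3 * real D) - 3 / 2))
     \<le> expected_edge_cover_time (prism_graph N \<rho>) (lazy_rule (prism_graph N \<rho>)) 0"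
proof -
  let ?G = "prism_graph N \<rho>"
  interpret spectral_gap_graph "3 * N" 6 ?G lam
    by unfold_locales (use regular lam form in auto)
  obtain S f where S: "S \<subseteq> {..<N}" "N \<le> D * card S"
    and f: "\<And>j x. j \<in> S \<Longrightarrow> x < 3 * N \<Longrightarrow> x div 3 = j \<Longrightarrow> f j x \<le> 0"
      "\<And>j x. j \<in> S \<Longrightarrow> x < 3 * N \<Longrightarrow> x div 3 \<noteq> j \<Longrightarrow> f j x - 1 \<le> nb_avg (3 * N) 6 ?G (f j) x"
      "\<And>j x. j \<in> S \<Longrightarrow> x < 3 * N \<Longrightarrow> x div 3 \<in> S \<Longrightarrow> x div 3 \<noteq> j \<Longrightarrow> real (3 * N) / 24 \<le> f j x"
  proof -
    obtain S where S: "S \<subseteq> {..<N}" "N \<le> D * card S" and ex: "\<forall>j\<in>S. \<exists>f.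
     (\<forall>x<3 * N. x div 3 = j \<longrightarrow> f x \<le> 0) \<and> (\<forall>x<3 * N. x div 3 \<noteq> j \<longrightarrow> f x - 1 \<le> nb_avg (3 * N) 6 ?G f x) \<and>
     (\<forall>x<3 * N. x div 3 \<in> S \<and> x div 3 \<noteq> j \<longrightarrow> real (3 * N) / 24 \<le> f x)"
      using separated_potentials[OF refl L] unfolding D by blast
    from bchoice[OF ex] obtain f where "\<forall>j\<in>S.
     (\<forall>x<3 * N. x div 3 = j \<longrightarrow> f j x \<le> 0) \<and> (\<forall>x<3 * N. x div 3 \<noteq> j \<longrightarrow> f j x - 1 \<le> nb_avg (3 * N) 6 ?G (f j) x) \<and>
     (\<forall>x<3 * N. x div 3 \<in> S \<and> x div 3 \<noteq> j \<longrightarrow> real (3 * N) / 24 \<le> f j x)" ..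
    then show ?thesis using S by (intro that[of S f]) auto
  qed
  have "D \<ge> 1"
  proof -
    have "6 ^ 0 * 3 \<le> D" unfolding D using L(3) by (intro member_le_sum[of 0 "{..<L}" "\<lambda>t. 6 ^ t * 3"]) auto
    then show ?thesis by simp
  qed
  have "2 \<le> card S"
  proof (rule ccontr)
    assume "\<not> 2 \<le> card S"
    then have "D * card S \<le> D * 1" by (intro mult_left_mono) auto
    then show False using S(2) large \<open>D \<ge> 1\<close> by linarith
  qed
  then obtain k where k: "card S = k + 2" by (metis add.commute le_Suc_ex)
  interpret target_walk "3 * N" 6 N ?G S f 0 "real (3 * N) / 24"
  proof unfold_locales
    show "u < 3 * N \<Longrightarrow> v < 3 * N \<Longrightarrow> u \<noteq> v \<Longrightarrow> u div 3 = v div 3 \<Longrightarrow> ?G u v" for u v by (rule prism_triangles)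
    show "0 < 3 * N" using large \<open>D \<ge> 1\<close> by linarith
  qed (use regular S f in auto)
  \<comment> \<open>At least N / D targets are separated, so the harmonic sum is ln n up to a
    constant depending on \<open>L\<close> only.\<close>
  have "ln (real (3 * N)) - ln (3 * real D) - 3 / 2 \<le> ln (real k + 3) - 3 / 2"
  proof -
    have "N \<le> D * (k + 2)" using S(2) k by simp
    then have "real N \<le> real D * (real k + 2)" by (metis of_nat_add of_nat_le_iff of_nat_mult of_nat_numeral)
    also have "\<dots> \<le> real D * (real k + 3)" by (intro mult_left_mono) auto
    finally have "real (3 * N) \<le> (3 * real D) * (real k + 3)" by simp
    moreover have "0 < real (3 * N)" using large \<open>D \<ge> 1\<close> by simp
    ultimately have "ln (real (3 * N)) \<le> ln ((3 * real D) * (real k + 3))" by (subst ln_le_cancel_iff) auto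
    also have "\<dots> = ln (3 * real D) + ln (real k + 3)" using \<open>D \<ge> 1\<close> by (simp add: ln_mult)
    finally show ?thesis by simp
  qed
  also have "\<dots> \<le> (\<Sum>i<k. 1 / (real i + 3))" by (rule harmonic_tail_ge)
  finally have "real (3 * N) / 24 * (ln (real (3 * N)) - ln (3 * real D) - 3 / 2)
     \<le> real (3 * N) / 24 * (\<Sum>i<k. 1 / (real i + 3))" by (rule mult_left_mono) simp
  then show ?thesis using cover_time_lower_bound[OF k] by (meson ennreal_leI order_trans)
qed

theorem mainTheorem6:
  shows "\<exists>lam0::real. lam0 < 1 \<and> (\<exists>eps::real. eps > 0 \<and> (\<exists>c::real. c > 0 \<and> (\<exists>n0::nat.
    \<forall>n\<ge>n0. n mod 3 = 0 \<longrightarrow>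
      (\<exists>G. regular_graph n 6 G \<and>
           spectral_lambda n 6 G \<le> lam0 \<and>
           (\<forall>v<n. \<exists>cyc. induced_cycle n G cyc \<and> v \<in> set cyc \<and>
                         real (length cyc) \<ge> eps * ln (real n)) \<and>
           (\<exists>v0<n. \<exists>R. valid_rule G R \<and>
                expected_edge_cover_time G R v0 \<ge> ennreal (c * real n * ln (real n)))))))"
proof -
  define lam :: real where "lam = 1 - 1 / 4368048"
  have lam: "0 < lam" "lam < 1" by (simp_all add: lam_def)
  obtain L0 where L0: "lam ^ L0 < (1 - lam) / 8" using real_arch_pow_inv[of "(1 - lam) / 8" lam] lam by auto
  define L where "L = Suc L0"
  have "lam ^ L \<le> lam ^ L0" unfolding L_def using lam by (intro power_decreasing) auto
  then have L: "8 * lam ^ L \<le> 1 - lam" "1 \<le> L" using L0 by (simp_all add: L_def)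
  define D where "D = (\<Sum>t<L. 6 ^ t * 3 :: nat)"
  \<comment> \<open>The summands guarantee, in turn, \<open>20 \<le> N\<close>,
    \<open>12 * L \<le> n\<close>, \<open>2 * D \<le> N\<close>, and that the constant subtracted
    from ln n is at most half of it. The last one halves 1 / 24 to the final 1 / 48.\<close>
  define n0 where "n0 = 60 + 12 * L + 6 * D + nat \<lceil>exp (2 * (ln (3 * real D) + 3 / 2))\<rceil>"
  have main: "\<exists>G. regular_graph n 6 G \<and> spectral_lambda n 6 G \<le> lam \<and>
           (\<forall>v<n. \<exists>cyc. induced_cycle n G cyc \<and> v \<in> set cyc \<and> real (length cyc) \<ge> 1 / 3 * ln (real n)) \<and>
           (\<exists>v0<n. \<exists>R. valid_rule G R \<and> expected_edge_cover_time G R v0 \<ge> ennreal (1 / 48 * real n * ln (real n)))"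
    if n: "n0 \<le> n" "n mod 3 = 0" for n
  proof -
    define N where "N = n div 3"
    have nN: "n = 3 * N" using n(2) by (simp add: N_def mult_div_mod_eq[symmetric] mod_0_imp_dvd)
    have N: "20 \<le> N" "12 * L \<le> 3 * N" "2 * D \<le> N" using n(1) unfolding nN n0_def by linarith+
    obtain k r where kr: "k > 0" "2 \<le> r" "r \<le> 2 * (k * k)" "N = 2 * (k * k) + r" by (rule size_split[OF N(1)])
    let ?G = "prism_graph N (torus_perms k r)"
    have regular: "regular_graph n 6 ?G" unfolding nN
    proof (rule prism_regular)
      show "bij_betw (torus_perms k r c) {..<N} {..<N}" for c
        using torus_perms_bij[OF kr(1), of r c] kr(2) unfolding kr(4) by simp
      show "torus_perms k r c j \<noteq> j" if "j < N" for c j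
        using torus_perms_fixfree[OF kr(1,2)] that unfolding kr(4) by blast
    qed (use N in simp)
    have form: "\<bar>\<Sum>u<3 * N. f u * nb_avg (3 * N) 6 ?G f u\<bar> \<le> lam * (\<Sum>u<3 * N. (f u)\<^sup>2)"
      if "(\<Sum>u<3 * N. f u) = 0" for f
      unfolding lam_def by (rule prism_spectral_form[OF kr that])
    have "spectral_lambda n 6 ?G \<le> lam"
      by (rule spectral_lambda_le[OF regular _ _ lam(2)]) (use N form in \<open>auto simp: nN\<close>)
    moreover have "\<exists>cyc. induced_cycle n ?G cyc \<and> v \<in> set cyc \<and> real (length cyc) \<ge> 1 / 3 * ln (real n)" if v: "v < n" for v
    proof (intro exI conjI)
      let ?c = "map (\<lambda>j. 3 * j + v mod 3) [0..<N]"
      show "induced_cycle n ?G ?c" unfolding nN by (rule prism_induced_cycle) (use N in auto)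
      have "v div 3 < N" using v nN by simp
      then show "v \<in> set ?c" by (auto intro!: image_eqI[of _ _ "v div 3"])
      \<comment> \<open>The cycles have length n / 3, so this crude bound already permits 1 / 3 for
        \<open>eps\<close>.\<close>
      have "ln (real n) \<le> real n" using ln_bound[of "real n"] N nN by simp
      then show "real (length ?c) \<ge> 1 / 3 * ln (real n)" by (simp add: nN)
    qed
    moreover have "ennreal (1 / 48 * real n * ln (real n)) \<le> expected_edge_cover_time ?G (lazy_rule ?G) 0"
    proof -
      have "exp (2 * (ln (3 * real D) + 3 / 2)) \<le> real n" using n(1) unfolding n0_def by linarith
      then have "2 * (ln (3 * real D) + 3 / 2) \<le> ln (real n)" using N nN by (subst ln_ge_iff) auto
      moreover have "x / 2 \<le> x - y - 3 / 2" if "2 * (y + 3 / 2) \<le> x" for x y :: real using that by (simp add: field_simps)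
      ultimately have "ln (real n) / 2 \<le> ln (real (3 * N)) - ln (3 * real D) - 3 / 2" unfolding nN by blast
      then have "real n / 24 * (ln (real n) / 2) \<le> real n / 24 * (ln (real (3 * N)) - ln (3 * real D) - 3 / 2)"
        by (rule mult_left_mono) simp
      then have "ennreal (1 / 48 * real n * ln (real n)) \<le>
          ennreal (real (3 * N) / 24 * (ln (real (3 * N)) - ln (3 * real D) - 3 / 2))"
        by (intro ennreal_leI) (simp add: nN)
      also have "\<dots> \<le> expected_edge_cover_time ?G (lazy_rule ?G) 0"
        by (rule prism_cover_time[OF regular[unfolded nN] lam form L(1) N(2) L(2) D_def N(3)])
      finally show ?thesis .
    qed
    ultimately show ?thesis using regular lazy_rule_valid[of ?G] N nN
      by (intro exI[of _ ?G] conjI exI[of _ "0::nat"] exI[of _ "lazy_rule ?G"]) auto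
  qed
  show ?thesis
    by (rule exI[of _ lam], rule conjI[OF lam(2)], rule exI[of _ "1 / 3"], rule conjI, simp,
        rule exI[of _ "1 / 48"], rule conjI, simp, rule exI[of _ n0]) (use main in blast)
qed

end
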